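(* Let $-\tfrac13<w<1$ and let $\gamma$ be a generic orbit in $\mathbf B_{IX}$. Then its $\omega$-limit set is contained in the Mixmaster attractor: $\omega(\gamma)\subseteq\mathcal A_{IX}$.
   Context: Fix $w$ with $-\tfrac13<w<1$. Variables $(\bar H,\bar\Sigma_1,\bar\Sigma_2,\bar\Sigma_3,\bar N_1,\bar N_2,\bar N_3)\in\mathbb R^7$; set $\bar\Sigma^2=\tfrac16(\bar\Sigma_1^2+\bar\Sigma_2^2+\bar\Sigma_3^2)$ and $\bar\Omega=1-\bar\Sigma^2-\tfrac1{12}(\bar N_1^2+\bar N_2^2+\bar N_3^2)$. Admissible states satisfy $\bar\Sigma_1+\bar\Sigma_2+\bar\Sigma_3=0$, $\bar H^2+\tfrac16(\bar N_1\bar N_2+\bar N_1\bar N_3+\bar N_2\bar N_3)=1$, $\bar\Omega\ge0$. The dynamics in the time $\tau$ (increasing towards the past singularity) is $\frac{d\bar H}{d\tau}=\bar q(1-\bar H^2)-\bar F\bar H$, $\frac{d\bar\Sigma_\alpha}{d\tau}=\bar\Sigma_\alpha[(2-\bar q)\bar H-\bar F]+{}^3\bar S_\alpha$, $\frac{d\bar N_\alpha}{d\tau}=-\bar N_\alpha[\bar q\bar H+2\bar\Sigma_\alpha+\bar F]$ (no sum), with $\bar q=2\bar\Sigma^2+\tfrac12(1+3w)\bar\Omega$, $\bar F=\tfrac16(\bar N_1\bar N_2\bar\Sigma_3+\bar N_1\bar\Sigma_2\bar N_3+\bar\Sigma_1\bar N_2\bar N_3)$, ${}^3\bar S_\alpha=\tfrac13[\bar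 N_\alpha(2\bar N_\alpha-\bar N_\beta-\bar N_\gamma)-(\bar N_\beta-\bar N_\gamma)^2]$ for $(\alpha\beta\gamma)\in\{(123),(231),(312)\}$. The Bianchi IX state space is $\mathbf B_{IX}=\{\bar N_1,\bar N_2,\bar N_3>0,\ \bar H>0,\ \bar\Omega\ge0\}$ (with the constraints); it is invariant for increasing $\tau$ and relatively compact. $\omega(\gamma)$ denotes the set of limit points of the orbit $\gamma$ as $\tau\to+\infty$. Special points, for $(\alpha\beta\gamma)$ any permutation of $(123)$: the Friedmann point $\mathrm F$: all $\bar\Sigma_\alpha=0$, all $\bar N_\alpha=0$, $\bar H=1$; the Collins–Stewart points $\mathrm{CS}_\gamma$: $\bar H=1$, $\bar N_\alpha=\bar N_\beta=0$, $\bar N_\gamma=\tfrac34\sqrt{1-w}\sqrt{1+3w}$, $(\bar\Sigma_\alpha,\bar\Sigma_\beta,\bar\Sigma_\gamma)=\tfrac18(1+3w)(1,1,-2)$; the Taub lines of fixed points $\mathrm{TL}_\gamma=\{0<\bar H<1,\ \bar\Sigma_\alpha=\bar\Sigma_\beta=-\bar H,\ \bar\Sigma_\gamma=2\bar H,\ \bar N_\alpha=\bar N_\beta=\sqrt6\sqrt{1-\bar H^2},\ \bar N_\gamma=0,\ \bar\Omega=0\}$. An orbit in $\mathbf B_{IX}$ is generic if its $\omega$-limit set is neither $\{\mathrm F\}$, nor $\{\mathrm{CS}_\alpha\}$ for some $\alpha$, nor a single point of some $\mathrm{TL}_\alpha$. The Mixmaster attractor $\mathcal A_{IX}$ is the set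 of admissible states with $\bar\Omega=0$, all $\bar N_\alpha\ge0$ and at most one $\bar N_\alpha$ nonzero (the union of the vacuum Bianchi I set — the Kasner circle $\bar N_\alpha=0$, $\bar\Sigma^2=1$ — and the three vacuum Bianchi II sets $\bar N_\alpha>0=\bar N_\beta=\bar N_\gamma$, $\bar\Omega=0$). *)

theory Defs
  imports "HOL-Analysis.Analysis"
begin

text \<open>A state is (H, Sigma1, Sigma2, Sigma3, N1, N2, N3) in R^7.\<close>
type_synonym state = "real \<times> real \<times> real \<times> real \<times> real \<times> real \<times> real"

definition mk_state :: "real \<Rightarrow> (nat \<Rightarrow> real) \<Rightarrow> (nat \<Rightarrow> real) \<Rightarrow> state" where
  "mk_state h s n = (h, s 1, s 2, s 3, n 1, n 2, n 3)"

fun Hc :: "state \<Rightarrow> real" where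
  "Hc (h, s1, s2, s3, n1, n2, n3) = h"

fun Sig :: "state \<Rightarrow> nat \<Rightarrow> real" where
  "Sig (h, s1, s2, s3, n1, n2, n3) i = (if i = 1 then s1 else if i = 2 then s2 else s3)"

fun Nn :: "state \<Rightarrow> nat \<Rightarrow> real" where
  "Nn (h, s1, s2, s3, n1, n2, n3) i = (if i = 1 then n1 else if i = 2 then n2 else n3)"

definition Sigma2 :: "state \<Rightarrow> real" where
  "Sigma2 x = (Sig x 1 ^ 2 + Sig x 2 ^ 2 + Sig x 3 ^ 2) / 6"

definition Omega :: "state \<Rightarrow> real" where
  "Omega x = 1 - Sigma2 x - (Nn x 1 ^ 2 + Nn x 2 ^ 2 + Nn x 3 ^ 2) / 12"

definition admissible :: "state \<Rightarrow> bool" where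
  "admissible x \<longleftrightarrow> Sig x 1 + Sig x 2 + Sig x 3 = 0
     \<and> Hc x ^ 2 + (Nn x 1 * Nn x 2 + Nn x 1 * Nn x 3 + Nn x 2 * Nn x 3) / 6 = 1
     \<and> Omega x \<ge> 0"

definition qbar :: "real \<Rightarrow> state \<Rightarrow> real" where
  "qbar w x = 2 * Sigma2 x + (1 + 3 * w) / 2 * Omega x"

definition Fbar :: "state \<Rightarrow> real" where
  "Fbar x = (Nn x 1 * Nn x 2 * Sig x 3 + Nn x 1 * Sig x 2 * Nn x 3 + Sig x 1 * Nn x 2 * Nn x 3) / 6"

text \<open>Curvature term for (alpha beta gamma) cyclic; symmetric in beta, gamma.\<close>
definition S3 :: "state \<Rightarrow> nat \<Rightarrow> nat \<Rightarrow> nat \<Rightarrow> real" where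
  "S3 x a b c = (Nn x a * (2 * Nn x a - Nn x b - Nn x c) - (Nn x b - Nn x c) ^ 2) / 3"

definition field :: "real \<Rightarrow> state \<Rightarrow> state" where
  "field w x = mk_state
     (qbar w x * (1 - Hc x ^ 2) - Fbar x * Hc x)
     (\<lambda>i. Sig x i * ((2 - qbar w x) * Hc x - Fbar x)
           + (if i = 1 then S3 x 1 2 3 else if i = 2 then S3 x 2 3 1 else S3 x 3 1 2))
     (\<lambda>i. - Nn x i * (qbar w x * Hc x + 2 * Sig x i + Fbar x))"

definition B_IX :: "state set" where
  "B_IX = {x. admissible x \<and> Nn x 1 > 0 \<and> Nn x 2 > 0 \<and> Nn x 3 > 0 \<and> Hc x > 0}"

definition is_orbit :: "real \<Rightarrow> (real \<Rightarrow> state) \<Rightarrow> bool" where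
  "is_orbit w x \<longleftrightarrow> (\<forall>t\<ge>0. (x has_vector_derivative field w (x t)) (at t within {0..}))
                    \<and> (\<forall>t\<ge>0. x t \<in> B_IX)"

definition omega_limit :: "(real \<Rightarrow> state) \<Rightarrow> state set" where
  "omega_limit x = {p. \<exists>s :: nat \<Rightarrow> real. filterlim s at_top sequentially \<and> (\<lambda>n. x (s n)) \<longlonglongrightarrow> p}"

definition F_point :: state where
  "F_point = mk_state 1 (\<lambda>_. 0) (\<lambda>_. 0)"

definition CS_point :: "real \<Rightarrow> nat \<Rightarrow> state" where
  "CS_point w g = mk_state 1
     (\<lambda>i. if i = g then - (1 + 3 * w) / 4 else (1 + 3 * w) / 8)
     (\<lambda>i. if i = g then 3 / 4 * sqrt (1 - w) * sqrt (1 + 3 * w) else 0)"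

definition Taub_line :: "nat \<Rightarrow> state set" where
  "Taub_line g = {x. 0 < Hc x \<and> Hc x < 1 \<and>
     (\<forall>i\<in>{1,2,3}. i \<noteq> g \<longrightarrow> Sig x i = - Hc x \<and> Nn x i = sqrt 6 * sqrt (1 - Hc x ^ 2))
     \<and> Sig x g = 2 * Hc x \<and> Nn x g = 0 \<and> Omega x = 0}"

definition generic :: "real \<Rightarrow> (real \<Rightarrow> state) \<Rightarrow> bool" where
  "generic w x \<longleftrightarrow> omega_limit x \<noteq> {F_point}
     \<and> (\<forall>a\<in>{1,2,3}. omega_limit x \<noteq> {CS_point w a})
     \<and> (\<forall>a\<in>{1,2,3}. \<forall>p\<in>Taub_line a. omega_limit x \<noteq> {p})"

definition mixmaster_attractor :: "state set" where
  "mixmaster_attractor = {x. admissible x \<and> Omega x = 0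
     \<and> Nn x 1 \<ge> 0 \<and> Nn x 2 \<ge> 0 \<and> Nn x 3 \<ge> 0
     \<and> card {i\<in>{1,2,3::nat}. Nn x i \<noteq> 0} \<le> 1}"

end

theory Submission
  imports Defs "HOL-Real_Asymp.Real_Asymp"
begin

text \<open>
  Divide by the Hubble variable: with \<open>s\<^sub>i = \<Sigma>\<^sub>i / H\<close>, \<open>n\<^sub>i = N\<^sub>i / H\<close>,
  \<open>Om = \<Omega> / H\<^sup>2\<close> and the derivation \<open>D = H\<^sup>-\<^sup>1 d/d\<tau>\<close> the function \<open>F\<close> drops out of
  the equations, and \<open>D (n\<^sub>1 n\<^sub>2 n\<^sub>3) = - 3 q n\<^sub>1 n\<^sub>2 n\<^sub>3\<close>.  Barbalat's lemma and the absence of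
  suitable equilibria give \<open>N\<^sub>1 N\<^sub>2 N\<^sub>3 \<rightarrow> 0\<close>.

  For a pair, say \<open>P = n\<^sub>1 n\<^sub>2\<close>, as long as \<open>P\<close> stays away from 0, \<open>n\<^sub>3\<close> decays exponentially and
  three functions are almost monotone, with errors absorbed by a correction \<open>E\<close> of \<open>n\<^sub>1 n\<^sub>2 n\<^sub>3\<close>:
  \<open>M\<close>, which makes the matter density small when \<open>P\<close> is large compared with an earlier value;
  \<open>ln P\<close> with a virial correction, which then cannot grow; and \<open>((s\<^sub>1 - s\<^sub>2)\<^sup>2 + (n\<^sub>1 - n\<^sub>2)\<^sup>2) / P\<close>,
  which cannot decay.  By the first two, \<open>P\<close> tends to 0 or is eventually bounded below.  In
  the second case the third one vanishes, so \<open>n\<^sub>1 = n\<^sub>2\<close>, \<open>s\<^sub>1 = s\<^sub>2\<close>, and the orbit converges to a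
  point of a Taub line.

  If all pair products vanish asymptotically, at most one \<open>n\<^sub>i\<close> is non-negligible at a time.  The
  function \<open>ln Om - \<Sum> n\<^sub>i\<^sup>\<alpha> s\<^sub>i\<close> shows that \<open>Om\<close> tends to 0 or stays bounded below.  In the latter
  case either all \<open>n\<^sub>i\<close> tend to 0, which leads to the Friedmann point, or one fixed \<open>n\<^sub>i\<close> persists
  and a Lyapunov function with strict maximum at the Collins--Stewart point forces convergence to
  that point.  A generic orbit therefore has \<open>Om \<rightarrow> 0\<close> and \<open>n\<^sub>i n\<^sub>j \<rightarrow> 0\<close>.
\<close>

section \<open>Real functions and differential inequalities\<close>

text \<open>Two obstacles shape the argument. First, the functions of a pair are monotone only for
  \<open>n3 = 0\<close>, and a phase with \<open>n3\<close> small but nonzero may last arbitrarily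
  long. While \<open>P \<ge> \<delta>\<close>, however, all errors are at most multiples of
  \<open>err\<close>, \<open>err\<close> is at most a multiple of \<open>E\<close>, and
  \<open>E\<close> decays at a rate proportional to itself. Adding a multiple of \<open>E\<close>
  makes each candidate exactly monotone, so that pointwise inequalities replace integrals of errors.
  Second, \<open>H\<close> may approach 0, so the normalised variables need not be bounded a priori.
  Time is not rescaled: derivatives keep the factor \<open>H\<close>, whose sign suffices for
  monotonicity, and a positive lower bound for it is established only where a function has to move
  at a definite speed. What is known for every orbit is that \<open>N1 N2 N3 = g H^3\<close>
  vanishes asymptotically; passing from this to \<open>err\<close> needs a separate argument.
  Genericity enters only at the end: each exceptional alternative is followed until all seven
  variables converge, so that the limit set is a single excluded point.\<close>

lemma le_sinh:
  fixes y :: real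
  assumes "0 \<le> y"
  shows "y \<le> sinh y"
proof -
  have "sinh 0 - 0 \<le> sinh y - y"
    using assms
  proof (rule DERIV_nonneg_imp_nondecreasing)
    show "\<exists>z. ((\<lambda>y. sinh y - y) has_real_derivative z) (at u) \<and> 0 \<le> z" for u :: real
      by (rule exI[of _ "cosh u - 1"]) (auto intro!: derivative_eq_intros simp: cosh_real_ge_1)
  qed
  then show ?thesis by simp
qed

text \<open>For \<open>y > 0\<close> this is \<open>1 + y^2 / (3 + y) \<le> y * coth y\<close>, a
  bound of the right order both at 0, where \<open>y * coth y\<close> is \<open>1 + y^2 / 3\<close>
  to second order, and at infinity. The difference of the two sides and its first derivative vanish
  at 0, so the sign of the second derivative decides.\<close>

lemma sinh_cosh_bound:
  fixes y :: real
  assumes "0 \<le> y"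
  shows "(3 + y + y\<^sup>2) * sinh y \<le> y * (3 + y) * cosh y"
proof -
  define K where "K = (\<lambda>y::real. y * (3 + y) * cosh y - (3 + y + y\<^sup>2) * sinh y)"
  define K1 where "K1 = (\<lambda>y::real. (y - y\<^sup>2) * cosh y + (y\<^sup>2 + y - 1) * sinh y)"
  have D0: "(K has_real_derivative K1 u) (at u)" for u
    unfolding K_def K1_def by (auto intro!: derivative_eq_intros simp: algebra_simps power2_eq_square)
  have D1: "(K1 has_real_derivative (u\<^sup>2 - u) * cosh u + (3 * u - u\<^sup>2 + 1) * sinh u) (at u)" for u
    unfolding K1_def by (auto intro!: derivative_eq_intros simp: algebra_simps power2_eq_square)
  have pos: "0 \<le> (u\<^sup>2 - u) * cosh u + (3 * u - u\<^sup>2 + 1) * sinh u" if "0 \<le> u" for u :: real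
  proof -
    have s: "u \<le> sinh u" using that by (rule le_sinh)
    have e: "cosh u - sinh u = exp (- u)" by (simp add: cosh_def sinh_def field_simps)
    have c: "cosh u \<le> 1 + sinh u" using e exp_le_one_iff[of "- u"] that by linarith
    have "u * cosh u \<le> u * (1 + sinh u)" using c that by (rule mult_left_mono)
    moreover have "0 \<le> u\<^sup>2 * (cosh u - sinh u)" unfolding e by simp
    moreover have "0 \<le> u * sinh u" using s that by simp
    ultimately show ?thesis using s by (simp add: algebra_simps)
  qed
  have "K1 0 \<le> K1 u" if "0 \<le> u" for u
    using that by (intro DERIV_nonneg_imp_nondecreasing[of 0 u K1]) (use D1 pos in blast)+
  then have "0 \<le> K1 u" if "0 \<le> u" for u using that by (simp add: K1_def)
  then have "K 0 \<le> K y"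
    using assms by (intro DERIV_nonneg_imp_nondecreasing[of 0 y K]) (use D0 in blast)+
  then show ?thesis by (simp add: K_def)
qed

text \<open>\<open>f\<close> is the hyperbolic angle of the pair:
  \<open>a = sqrt (a * b) * exp f\<close> and \<open>b = sqrt (a * b) * exp (- f)\<close>.\<close>

lemma half_log_ratio:
  fixes a b :: real
  assumes "0 < a" "0 < b"
  defines "f \<equiv> ln (a / b) / 2"
  shows "a + b = 2 * sqrt (a * b) * cosh f" "a - b = 2 * sqrt (a * b) * sinh f"
proof -
  have f: "f = (ln a - ln b) / 2" using assms(1,2) unfolding f_def by (subst ln_div) auto
  have "f = ln (sqrt a) - ln (sqrt b)" using assms(1,2) unfolding f by (simp add: ln_sqrt)
  then have e1: "exp f = sqrt a / sqrt b" using assms(1,2) by (simp only: exp_diff) simp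
  have e2: "exp (- f) = sqrt b / sqrt a" unfolding exp_minus e1 using assms by (simp add: field_simps)
  have "sqrt (a * b) * exp f = a" "sqrt (a * b) * exp (- f) = b"
    unfolding e1 e2 using assms by (simp_all add: real_sqrt_mult)
  then show "a + b = 2 * sqrt (a * b) * cosh f" "a - b = 2 * sqrt (a * b) * sinh f"
    by (simp_all add: cosh_def sinh_def algebra_simps)
qed

text \<open>The excess \<open>f^2 / (3 + \<bar>f\<bar>)\<close> over the plain inequality
  \<open>(a - b)^2 \<le> f * (a - b) * (a + b)\<close> later pays for the term
  \<open>f * d * v^2\<close> in the derivative of \<open>Psi\<close>. Both sides are even in
  \<open>f\<close>, which reduces the claim to \<open>y = \<bar>f\<bar>\<close>.\<close>

lemma half_log_ratio_virial:
  fixes a b :: real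
  assumes "0 < a" "0 < b"
  defines "f \<equiv> ln (a / b) / 2"
  shows "(a - b)\<^sup>2 * (1 + f\<^sup>2 / (3 + \<bar>f\<bar>)) \<le> f * (a - b) * (a + b)"
proof -
  define c where "c = sqrt (a * b)"
  have v: "a - b = 2 * c * sinh f" and S: "a + b = 2 * c * cosh f"
    using half_log_ratio[OF assms(1,2)] by (simp_all add: f_def c_def)
  define y where "y = \<bar>f\<bar>"
  have sq: "(a - b)\<^sup>2 = (2 * c)\<^sup>2 * (sinh y)\<^sup>2"
    unfolding v y_def by (cases "0 \<le> f") (simp_all add: power_mult_distrib)
  have m: "f * (a - b) * (a + b) = (2 * c)\<^sup>2 * (y * sinh y * cosh y)"
    unfolding v S y_def by (cases "0 \<le> f") (simp_all add: power2_eq_square)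
  have y0: "0 \<le> y" by (simp add: y_def)
  have "(3 + y + y\<^sup>2) * sinh y \<le> y * (3 + y) * cosh y" by (rule sinh_cosh_bound[OF y0])
  then have "(1 + y\<^sup>2 / (3 + y)) * sinh y \<le> y * cosh y" using y0 by (simp add: field_simps)
  then have "sinh y * ((1 + y\<^sup>2 / (3 + y)) * sinh y) \<le> sinh y * (y * cosh y)"
    by (rule mult_left_mono) (use y0 in auto)
  from mult_left_mono[OF this, of "(2 * c)\<^sup>2"]
  have "(2 * c)\<^sup>2 * (sinh y * ((1 + y\<^sup>2 / (3 + y)) * sinh y)) \<le> (2 * c)\<^sup>2 * (sinh y * (y * cosh y))"
    by simp
  moreover have "f\<^sup>2 = y\<^sup>2" by (simp add: y_def)
  ultimately show ?thesis unfolding sq m y_def[symmetric] by (simp add: power2_eq_square mult_ac)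
qed

text \<open>The linear bound serves when the product is bounded below by a fixed number. For a small
  product \<open>\<delta>\<close> it would only give the order \<open>1 / sqrt \<delta>\<close>,
  whereas the logarithmic one grows like \<open>- ln \<delta>\<close>, slowly enough for
  \<open>no_growth\<close>.\<close>

lemma half_log_ratio_le:
  fixes a b :: real
  assumes "0 < a" "0 < b"
  shows "\<bar>ln (a / b) / 2\<bar> \<le> ln (1 + \<bar>a - b\<bar> / sqrt (a * b))"
    and "\<bar>ln (a / b) / 2\<bar> \<le> \<bar>a - b\<bar> / (2 * sqrt (a * b))"
proof -
  define f where "f = ln (a / b) / 2"
  define y where "y = \<bar>f\<bar>"
  have c: "0 < sqrt (a * b)" using assms by simp
  have s: "sinh y = \<bar>a - b\<bar> / (2 * sqrt (a * b))"
    using half_log_ratio(2)[OF assms] assms unfolding f_def[symmetric] y_def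
    by (cases "0 \<le> f") (simp_all add: abs_mult)
  have y0: "0 \<le> y" by (simp add: y_def)
  then show "\<bar>ln (a / b) / 2\<bar> \<le> \<bar>a - b\<bar> / (2 * sqrt (a * b))"
    using le_sinh[OF y0] s by (simp add: y_def f_def)
  have "exp y = 2 * sinh y + exp (- y)" by (simp add: sinh_def field_simps)
  also have "\<dots> \<le> 1 + \<bar>a - b\<bar> / sqrt (a * b)" using s y0 by simp
  finally have "y \<le> ln (1 + \<bar>a - b\<bar> / sqrt (a * b))"
    using exp_gt_zero[of y] by (subst ln_ge_iff) linarith+
  then show "\<bar>ln (a / b) / 2\<bar> \<le> ln (1 + \<bar>a - b\<bar> / sqrt (a * b))" by (simp add: y_def f_def)
qed

section \<open>Level crossings and trapping arguments for scalar functions\<close>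

lemma last_passage:
  fixes f :: "real \<Rightarrow> real"
  assumes "a \<le> b" "continuous_on {a..b} f" "f a \<le> y" "y \<le> f b"
  obtains c where "a \<le> c" "c \<le> b" "f c = y" "\<And>t. c \<le> t \<Longrightarrow> t \<le> b \<Longrightarrow> y \<le> f t"
proof -
  define A where "A = {t \<in> {a..b}. f t = y}"
  have cl: "closed A" unfolding A_def using continuous_closed_preimage_constant[OF assms(2)] by simp
  have ne: "A \<noteq> {}" using IVT'[of f a y b] assms by (auto simp: A_def)
  have bd: "bdd_above A" by (auto simp: A_def)
  define c where "c = Sup A"
  have cA: "c \<in> A" unfolding c_def by (rule closed_contains_Sup[OF ne bd cl])
  have "y \<le> f t" if "c \<le> t" "t \<le> b" for t
  proof (rule ccontr)
    assume "\<not> y \<le> f t"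
    moreover have "continuous_on {t..b} f"
      using that cA by (intro continuous_on_subset[OF assms(2)]) (auto simp: A_def)
    ultimately have "\<exists>u. t \<le> u \<and> u \<le> b \<and> f u = y"
      using IVT'[of f t y b] that assms(4) by auto
    then obtain u where u: "t \<le> u" "u \<le> b" "f u = y" by blast
    then have "u \<in> A" using that cA by (auto simp: A_def)
    then have "u \<le> c" unfolding c_def using bd by (rule cSup_upper)
    then have "t = c" using u that by simp
    then show False using \<open>\<not> y \<le> f t\<close> cA by (simp add: A_def)
  qed
  then show ?thesis using that cA by (auto simp: A_def)
qed

lemma up_crossing:
  fixes f :: "real \<Rightarrow> real"
  assumes "a \<le> b" "continuous_on {a..b} f" "f a \<le> y" "y \<le> z" "z \<le> f b"
  obtains c d where "a \<le> c" "c \<le> d" "d \<le> b" "f c = y" "f d = z"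
    "\<And>t. c \<le> t \<Longrightarrow> t \<le> d \<Longrightarrow> y \<le> f t \<and> f t \<le> z"
proof -
  obtain c where c: "a \<le> c" "c \<le> b" "f c = y" "\<And>t. c \<le> t \<Longrightarrow> t \<le> b \<Longrightarrow> y \<le> f t"
    by (rule last_passage[OF assms(1-3) order_trans[OF assms(4,5)]]) (rule that)
  \<comment> \<open>Reflecting time and sign turns the last passage through \<open>- z\<close> into
    the first passage of \<open>f\<close> through \<open>z\<close> after \<open>c\<close>.\<close>
  have "continuous_on {c..b} (\<lambda>t. - f (c + b - t))"
    using c by (intro continuous_intros continuous_on_compose2[OF assms(2)]) auto
  note last_passage[OF c(2) this, of "- z"]
  then obtain e where e: "c \<le> e" "e \<le> b" "- f (c + b - e) = - z"
      "\<And>t. e \<le> t \<Longrightarrow> t \<le> b \<Longrightarrow> - z \<le> - f (c + b - t)"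
    using c(3) assms(4,5) by auto
  have "f t \<le> z" if "c \<le> t" "t \<le> c + b - e" for t
    using e(4)[of "c + b - t"] that by simp
  then show ?thesis using that[of c "c + b - e"] c e by simp
qed

lemma continuous_if_deriv:
  fixes f :: "real \<Rightarrow> real"
  assumes "\<And>t. T \<le> t \<Longrightarrow> (f has_real_derivative f' t) (at t)"
  shows "continuous_on {T..u} f"
  using assms by (intro continuous_at_imp_continuous_on ballI) (metis DERIV_isCont atLeastAtMost_iff)

lemma nonincreasing_if_deriv_nonpos:
  fixes f :: "real \<Rightarrow> real"
  assumes "a \<le> b" "\<And>t. a \<le> t \<Longrightarrow> t \<le> b \<Longrightarrow> (f has_real_derivative f' t) (at t)"
    "\<And>t. a \<le> t \<Longrightarrow> t \<le> b \<Longrightarrow> f' t \<le> 0"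
  shows "f b \<le> f a"
  using assms by (intro DERIV_nonpos_imp_nonincreasing[of a b f]) blast+

text \<open>To escape, a continuous function would have to cross the band above \<open>y\<close>, so
  the sign of \<open>f'\<close> matters only inside the band. This suits estimates that are valid
  only near the threshold.\<close>

lemma stays_below_band:
  fixes f :: "real \<Rightarrow> real"
  assumes D: "\<And>t. T \<le> t \<Longrightarrow> (f has_real_derivative f' t) (at t)"
    and init: "f T \<le> y" and yz: "y < z"
    and neg: "\<And>t. T \<le> t \<Longrightarrow> y \<le> f t \<Longrightarrow> f t \<le> z \<Longrightarrow> f' t \<le> 0"
    and t: "T \<le> t"
  shows "f t \<le> y"
proof (rule ccontr)
  assume n: "\<not> f t \<le> y"
  define z' where "z' = min z (f t)"
  have z': "y < z'" "z' \<le> z" "z' \<le> f t" using n yz by (auto simp: z'_def)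
  obtain p r where p: "T \<le> p" "p \<le> r" "f p = y" "f r = z'"
      "\<And>s. p \<le> s \<Longrightarrow> s \<le> r \<Longrightarrow> y \<le> f s \<and> f s \<le> z'"
    by (rule up_crossing[OF t continuous_if_deriv[OF D] init, of z']) (use z' that in auto)
  have "f r \<le> f p"
  proof (rule nonincreasing_if_deriv_nonpos[OF p(2)])
    show "(f has_real_derivative f' s) (at s)" if "p \<le> s" "s \<le> r" for s
      using D p(1) that by simp
    show "f' s \<le> 0" if "p \<le> s" "s \<le> r" for s
      using neg[of s] p(1) p(5)[OF that] that z' by simp
  qed
  then show False using p z' by simp
qed

lemma linear_decay:
  fixes f :: "real \<Rightarrow> real"
  assumes D: "\<And>t. T \<le> t \<Longrightarrow> (f has_real_derivative f' t) (at t)"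
    and neg: "\<And>t. T \<le> t \<Longrightarrow> f' t \<le> - c"
    and t: "T \<le> t"
  shows "f t \<le> f T - c * (t - T)"
proof -
  have "f t + c * t \<le> f T + c * T"
  proof (rule nonincreasing_if_deriv_nonpos[OF t])
    show "((\<lambda>t. f t + c * t) has_real_derivative f' u + c) (at u)" if "T \<le> u" "u \<le> t" for u
      using D[OF that(1)] by (auto intro!: derivative_eq_intros)
    show "f' u + c \<le> 0" if "T \<le> u" "u \<le> t" for u
      using neg[OF that(1)] by simp
  qed
  then show ?thesis by (simp add: algebra_simps)
qed

text \<open>Below \<open>y\<close> the function falls at speed at least \<open>c\<close>, so it can
  never climb back to \<open>y\<close>; falling forever, it violates the lower bound.\<close>

lemma trapped_below_unbounded:
  fixes f :: "real \<Rightarrow> real"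
  assumes D: "\<And>t. T \<le> t \<Longrightarrow> (f has_real_derivative f' t) (at t)"
    and init: "f T < y" and neg: "\<And>t. T \<le> t \<Longrightarrow> f t < y \<Longrightarrow> f' t \<le> - c" and c: "0 < c"
    and bd: "\<And>t. T \<le> t \<Longrightarrow> b \<le> f t"
  shows False
proof -
  define z where "z = (f T + y) / 2"
  have z: "f T \<le> z" "z < y" using init by (auto simp: z_def)
  have below: "f t < y" if "T \<le> t" for t
  proof (rule ccontr)
    assume n: "\<not> f t < y"
    define y' where "y' = (z + y) / 2"
    have y': "z < y'" "y' < y" using z by (auto simp: y'_def)
    obtain p q where pq: "T \<le> p" "p \<le> q" "f p = z" "f q = y'"
        "\<And>s. p \<le> s \<Longrightarrow> s \<le> q \<Longrightarrow> z \<le> f s \<and> f s \<le> y'"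
      by (rule up_crossing[OF \<open>T \<le> t\<close> continuous_if_deriv[OF D], of z y']) (use n z y' that in auto)
    have "f q \<le> f p"
    proof (rule nonincreasing_if_deriv_nonpos[OF pq(2)])
      show "(f has_real_derivative f' s) (at s)" if "p \<le> s" "s \<le> q" for s
        using D pq(1) that by simp
      show "f' s \<le> 0" if "p \<le> s" "s \<le> q" for s
        using neg[of s] pq(1) pq(5)[OF that] that y' c by simp
    qed
    then show False using pq y' by simp
  qed
  define t where "t = T + (f T - b + 1) / c"
  have t: "T \<le> t" using bd[of T] c by (auto simp: t_def)
  have "f t \<le> f T - c * (t - T)"
    by (rule linear_decay[OF D _ t]) (auto intro: neg below)
  also have "\<dots> = b - 1" using c by (simp add: t_def)
  finally show False using bd[OF t] by simp
qed

text \<open>Uniform continuity is asked of \<open>k\<close> and not of \<open>F'\<close>, which only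
  has to dominate \<open>k\<close>. In the main application \<open>F'\<close> contains a division by
  \<open>H\<close>, which may tend to 0, while \<open>k\<close> is a continuous function of the
  state.\<close>

lemma barbalat:
  fixes F :: "real \<Rightarrow> real"
  assumes D: "\<And>t. T < t \<Longrightarrow> (F has_real_derivative F' t) (at t)" and le: "\<And>t. T < t \<Longrightarrow> \<bar>k t\<bar> \<le> \<bar>F' t\<bar>"
    and lim: "(F \<longlongrightarrow> L) at_top" and uc: "uniformly_continuous_on {T<..} k"
  shows "(k \<longlongrightarrow> 0) at_top"
proof (rule tendstoI)
  fix e :: real assume e: "0 < e"
  obtain h where h: "0 < h" "\<And>s t. T < s \<Longrightarrow> T < t \<Longrightarrow> \<bar>s - t\<bar> < h \<Longrightarrow> \<bar>k s - k t\<bar> < e / 2"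
    using uc e unfolding uniformly_continuous_on_def dist_real_def
    by (metis greaterThan_iff half_gt_zero)
  define \<tau> where "\<tau> = h / 2"
  have \<tau>: "0 < \<tau>" "\<tau> < h" using h by (auto simp: \<tau>_def)
  have "filterlim (\<lambda>t. t + \<tau>) at_top at_top"
    using filterlim_tendsto_add_at_top[OF tendsto_const[of \<tau> at_top] filterlim_ident] by (simp add: add.commute)
  then have "((\<lambda>t. F (t + \<tau>)) \<longlongrightarrow> L) at_top"
    by (rule filterlim_compose[OF lim])
  then have "((\<lambda>t. F (t + \<tau>) - F t) \<longlongrightarrow> L - L) at_top" by (intro tendsto_diff lim)
  then have "\<forall>\<^sub>F t in at_top. dist (F (t + \<tau>) - F t) 0 < \<tau> * (e / 2)"
    using \<tau> e by (intro tendstoD) auto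
  then show "\<forall>\<^sub>F t in at_top. dist (k t) 0 < e"
    using eventually_gt_at_top[of T]
  proof eventually_elim
    case (elim t)
    \<comment> \<open>The increment over a window of fixed length tends to 0, so \<open>F'\<close>
      is small at some point of the window; uniform continuity carries this back to
      \<open>t\<close>.\<close>
    obtain z where z: "t < z" "z < t + \<tau>" "F (t + \<tau>) - F t = \<tau> * F' z"
      using MVT2[of t "t + \<tau>" F F'] \<tau> elim D by auto
    have "\<tau> * \<bar>F' z\<bar> < \<tau> * (e / 2)" using elim z \<tau> by (simp add: abs_mult)
    then have "\<bar>k z\<bar> < e / 2" using \<tau> le[of z] z elim by simp
    moreover have "\<bar>k t - k z\<bar> < e / 2" using h(2)[of t z] z \<tau> elim by auto
    ultimately have "\<bar>k t\<bar> < e" by linarith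
    then show ?case by (simp add: dist_real_def)
  qed
qed

section \<open>The Hubble-normalised system\<close>

text \<open>\<open>\<mu>\<close> stands for \<open>(1 + 3 w) / 4\<close>.\<close>

locale bianchi =
  fixes \<mu> :: real and H q Om s1 s2 s3 n1 n2 n3 :: "real \<Rightarrow> real"
  assumes mu_pos: "0 < \<mu>" and mu_less: "\<mu> < 1"
    and H_pos: "0 < t \<Longrightarrow> 0 < H t"
    and H_eq: "0 < t \<Longrightarrow> (H t)\<^sup>2 * (1 + (n1 t * n2 t + n2 t * n3 t + n3 t * n1 t) / 6) = 1"
    and Om_eq: "0 < t \<Longrightarrow> Om t = 1 + (n1 t * n2 t + n2 t * n3 t + n3 t * n1 t) / 6
        - ((s1 t)\<^sup>2 + (s2 t)\<^sup>2 + (s3 t)\<^sup>2) / 6 - ((n1 t)\<^sup>2 + (n2 t)\<^sup>2 + (n3 t)\<^sup>2) / 12"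
    and q_eq: "0 < t \<Longrightarrow> q t = ((s1 t)\<^sup>2 + (s2 t)\<^sup>2 + (s3 t)\<^sup>2) / 3 + 2 * \<mu> * Om t"
    and s_sum: "0 < t \<Longrightarrow> s1 t + s2 t + s3 t = 0"
    and n_pos: "0 < t \<Longrightarrow> 0 < n1 t" "0 < t \<Longrightarrow> 0 < n2 t" "0 < t \<Longrightarrow> 0 < n3 t"
    and Om_nonneg: "0 < t \<Longrightarrow> 0 \<le> Om t"
    and D_s1: "0 < t \<Longrightarrow> (s1 has_real_derivative H t * ((2 - q t) * s1 t
        + (n1 t * (2 * n1 t - n2 t - n3 t) - (n2 t - n3 t)\<^sup>2) / 3)) (at t)"
    and D_s2: "0 < t \<Longrightarrow> (s2 has_real_derivative H t * ((2 - q t) * s2 t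
        + (n2 t * (2 * n2 t - n3 t - n1 t) - (n3 t - n1 t)\<^sup>2) / 3)) (at t)"
    and D_s3: "0 < t \<Longrightarrow> (s3 has_real_derivative H t * ((2 - q t) * s3 t
        + (n3 t * (2 * n3 t - n1 t - n2 t) - (n1 t - n2 t)\<^sup>2) / 3)) (at t)"
    and D_n1: "0 < t \<Longrightarrow> (n1 has_real_derivative - H t * (n1 t * (q t + 2 * s1 t))) (at t)"
    and D_n2: "0 < t \<Longrightarrow> (n2 has_real_derivative - H t * (n2 t * (q t + 2 * s2 t))) (at t)"
    and D_n3: "0 < t \<Longrightarrow> (n3 has_real_derivative - H t * (n3 t * (q t + 2 * s3 t))) (at t)"
    and vol_tendsto: "((\<lambda>t. n1 t * n2 t * n3 t * (H t) ^ 3) \<longlongrightarrow> 0) at_top"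
begin

text \<open>Invariance under cyclic permutations lets everything proved for the pair
  \<open>n1\<close>, \<open>n2\<close> be reused for the other two pairs.\<close>

lemma rotate: "bianchi \<mu> H q Om s2 s3 s1 n2 n3 n1"
proof
  fix t :: real
  assume t: "0 < t"
  show "(H t)\<^sup>2 * (1 + (n2 t * n3 t + n3 t * n1 t + n1 t * n2 t) / 6) = 1"
    using H_eq[OF t] by (simp add: algebra_simps)
  show "Om t = 1 + (n2 t * n3 t + n3 t * n1 t + n1 t * n2 t) / 6
        - ((s2 t)\<^sup>2 + (s3 t)\<^sup>2 + (s1 t)\<^sup>2) / 6 - ((n2 t)\<^sup>2 + (n3 t)\<^sup>2 + (n1 t)\<^sup>2) / 12"
    using Om_eq[OF t] by (simp add: algebra_simps)
  show "q t = ((s2 t)\<^sup>2 + (s3 t)\<^sup>2 + (s1 t)\<^sup>2) / 3 + 2 * \<mu> * Om t"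
    using q_eq[OF t] by (simp add: algebra_simps)
  show "s2 t + s3 t + s1 t = 0" using s_sum[OF t] by simp
next
  show "((\<lambda>t. n2 t * n3 t * n1 t * (H t) ^ 3) \<longlongrightarrow> 0) at_top"
    using vol_tendsto by (simp add: mult_ac)
qed (fact mu_pos mu_less H_pos n_pos Om_nonneg D_s1 D_s2 D_s3 D_n1 D_n2 D_n3)+

text \<open>Variables adapted to the pair \<open>n\<^sub>1, n\<^sub>2\<close>; \<open>err\<close> bounds every term that involves \<open>n\<^sub>3\<close>.\<close>

definition d where "d t = s1 t - s2 t"
definition v where "v t = n1 t - n2 t"
definition S where "S t = n1 t + n2 t"
definition P where "P t = n1 t * n2 t"
definition x where "x t = 1 - s3 t / 2"
definition xi where "xi t = (n3 t)\<^sup>2 / 12 - n3 t * S t / 6"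
definition err where "err t = n3 t * (1 + S t + n3 t)"
definition phi where "phi t = ln (n1 t / n2 t) / 2"
definition g where "g t = n1 t * n2 t * n3 t"
definition small where "small t \<longleftrightarrow> 0 < t \<and> err t \<le> \<mu> * (1 - \<mu>) / 24"

lemma small_pos: "small t \<Longrightarrow> 0 < t" by (simp add: small_def)

lemma pos: "0 < t \<Longrightarrow> 0 < S t" "0 < t \<Longrightarrow> 0 < P t" "0 < t \<Longrightarrow> 0 < g t" "0 < t \<Longrightarrow> 0 < err t"
  using n_pos[of t] by (simp_all add: S_def P_def g_def err_def add_pos_pos)

lemma s_squares: "0 < t \<Longrightarrow> (s1 t)\<^sup>2 + (s2 t)\<^sup>2 + (s3 t)\<^sup>2 = 3 / 2 * (s3 t)\<^sup>2 + (d t)\<^sup>2 / 2"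
proof -
  assume "0 < t"
  then have s: "s3 t = - s1 t - s2 t" using s_sum[of t] by simp
  show ?thesis unfolding d_def s by (simp add: power2_eq_square field_simps)
qed

lemma constraint: "0 < t \<Longrightarrow> (s3 t)\<^sup>2 / 4 + (d t)\<^sup>2 / 12 + (v t)\<^sup>2 / 12 + Om t + xi t = 1"
  using Om_eq[of t] s_squares[of t] unfolding v_def xi_def S_def
  by (simp add: power2_eq_square field_simps)

lemma q_eq': "0 < t \<Longrightarrow> q t = (s3 t)\<^sup>2 / 2 + (d t)\<^sup>2 / 6 + 2 * \<mu> * Om t"
  using q_eq[of t] s_squares[of t] by simp

text \<open>\<open>x\<close> vanishes where \<open>s3 = 2\<close>, its value on the Taub line. Up to
  \<open>xi\<close>, the oscillation energy \<open>(d^2 + v^2) / 12\<close> and the matter density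
  are together at most \<open>2 * x\<close>.\<close>

lemma x_eq: "0 < t \<Longrightarrow> 2 * x t = (x t)\<^sup>2 + ((d t)\<^sup>2 + (v t)\<^sup>2) / 12 + Om t + xi t"
  using constraint[of t] unfolding x_def by (simp add: power2_eq_square field_simps)

lemma two_minus_q: "0 < t \<Longrightarrow> 2 - q t = (v t)\<^sup>2 / 6 + (2 - 2 * \<mu>) * Om t + 2 * xi t"
  using constraint[of t] q_eq'[of t] by (simp add: algebra_simps)

text \<open>\<open>v * S\<close> here and \<open>- d * S\<close> in \<open>D_v\<close> make the pair
  \<open>d\<close>, \<open>v\<close> rotate with speed \<open>S\<close>. These terms cancel in
  \<open>d^2 + v^2\<close>.\<close>

lemma D_d: "0 < t \<Longrightarrow> (d has_real_derivative H t * ((2 - q t) * d t + v t * (S t - n3 t))) (at t)"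
  unfolding d_def[abs_def] v_def S_def
  by (rule DERIV_cong[OF DERIV_diff[OF D_s1 D_s2]]) (simp_all add: power2_eq_square field_simps)

lemma D_v: "0 < t \<Longrightarrow> (v has_real_derivative H t * (v t * (s3 t - q t) - d t * S t)) (at t)"
proof -
  assume t: "0 < t"
  have s: "s3 t = - s1 t - s2 t" using s_sum[OF t] by simp
  show ?thesis unfolding v_def[abs_def] S_def d_def s
    by (rule DERIV_cong[OF DERIV_diff[OF D_n1 D_n2]]) (simp_all add: t algebra_simps)
qed

lemma D_S: "0 < t \<Longrightarrow> (S has_real_derivative H t * (S t * (s3 t - q t) - d t * v t)) (at t)"
proof -
  assume t: "0 < t"
  have s: "s3 t = - s1 t - s2 t" using s_sum[OF t] by simp
  show ?thesis unfolding S_def[abs_def] v_def d_def s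
    by (rule DERIV_cong[OF DERIV_add[OF D_n1 D_n2]]) (simp_all add: t algebra_simps)
qed

lemma D_P: "0 < t \<Longrightarrow> (P has_real_derivative H t * (P t * (2 * s3 t - 2 * q t))) (at t)"
proof -
  assume t: "0 < t"
  have s: "s3 t = - s1 t - s2 t" using s_sum[OF t] by simp
  show ?thesis unfolding P_def[abs_def] s
    by (rule DERIV_cong[OF DERIV_mult[OF D_n1 D_n2]]) (simp_all add: t algebra_simps)
qed

lemma D_g: "0 < t \<Longrightarrow> (g has_real_derivative H t * (- 3 * q t * g t)) (at t)"
proof -
  assume t: "0 < t"
  have s: "s3 t = - s1 t - s2 t" using s_sum[OF t] by simp
  show ?thesis unfolding g_def[abs_def]
    by (rule DERIV_cong[OF DERIV_mult[OF DERIV_mult[OF D_n1 D_n2] D_n3]]) (simp_all add: t s algebra_simps)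
qed

lemma D_phi: "0 < t \<Longrightarrow> (phi has_real_derivative H t * (- d t)) (at t)"
proof -
  assume t: "0 < t"
  note n = n_pos[OF t]
  show ?thesis unfolding phi_def[abs_def] d_def using n
    by (auto intro!: derivative_eq_intros D_n1[OF t] D_n2[OF t] simp: field_simps)
qed

lemma D_Om: "0 < t \<Longrightarrow> (Om has_real_derivative H t * (Om t * (4 * \<mu> - 2 * q t))) (at t)"
proof -
  assume t: "0 < t"
  define F where "F = (\<lambda>t. 1 + (n1 t * n2 t + n2 t * n3 t + n3 t * n1 t) / 6
        - ((s1 t)\<^sup>2 + (s2 t)\<^sup>2 + (s3 t)\<^sup>2) / 6 - ((n1 t)\<^sup>2 + (n2 t)\<^sup>2 + (n3 t)\<^sup>2) / 12)"
  define A where "A = s1 t * (n1 t * (2 * n1 t - n2 t - n3 t) - (n2 t - n3 t)\<^sup>2)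
      + s2 t * (n2 t * (2 * n2 t - n3 t - n1 t) - (n3 t - n1 t)\<^sup>2)
      + s3 t * (n3 t * (2 * n3 t - n1 t - n2 t) - (n1 t - n2 t)\<^sup>2)"
  define B where "B = n1 t * n2 t * (s1 t + s2 t) + n2 t * n3 t * (s2 t + s3 t) + n3 t * n1 t * (s3 t + s1 t)"
  define C where "C = (n1 t)\<^sup>2 * s1 t + (n2 t)\<^sup>2 * s2 t + (n3 t)\<^sup>2 * s3 t"
  have "(F has_real_derivative H t *
     ((- 2 * q t * (n1 t * n2 t + n2 t * n3 t + n3 t * n1 t) - 2 * B) / 6
      - (2 - q t) * ((s1 t)\<^sup>2 + (s2 t)\<^sup>2 + (s3 t)\<^sup>2) / 3 - A / 9
      + q t * ((n1 t)\<^sup>2 + (n2 t)\<^sup>2 + (n3 t)\<^sup>2) / 6 + C / 3)) (at t)"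
    unfolding F_def A_def B_def C_def
    by (auto intro!: derivative_eq_intros D_s1[OF t] D_s2[OF t] D_s3[OF t] D_n1[OF t] D_n2[OF t] D_n3[OF t]
        simp: power2_eq_square field_simps)
  \<comment> \<open>The terms that couple shear and curvature cancel because the shears sum to
    0.\<close>
  moreover have "- B / 3 - A / 9 + C / 3 = 0"
  proof -
    have s: "s3 t = - s1 t - s2 t" using s_sum[OF t] by simp
    show ?thesis unfolding A_def B_def C_def s by (simp add: power2_eq_square field_simps)
  qed
  moreover have "(- 2 * q t * (n1 t * n2 t + n2 t * n3 t + n3 t * n1 t)) / 6
      - (2 - q t) * ((s1 t)\<^sup>2 + (s2 t)\<^sup>2 + (s3 t)\<^sup>2) / 3
      + q t * ((n1 t)\<^sup>2 + (n2 t)\<^sup>2 + (n3 t)\<^sup>2) / 6 = Om t * (4 * \<mu> - 2 * q t)"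
  proof -
    have alg: "(- 2 * q * \<pi>) / 6 - (2 - q) * a / 3 + q * b / 6 = om * (4 * \<mu> - 2 * q)"
      if "om = 1 + \<pi> / 6 - a / 6 - b / 12" "q = a / 3 + 2 * \<mu> * om" for q \<pi> a b om :: real
    proof -
      have p: "\<pi> = 6 * om - 6 + a + b / 2" and a: "a = 3 * (q - 2 * \<mu> * om)" using that by simp_all
      show ?thesis unfolding p unfolding a by (simp add: field_simps)
    qed
    show ?thesis by (rule alg[OF Om_eq[OF t] q_eq[OF t]])
  qed
  moreover have alg2: "(a - 2 * B) / 6 - b - A / 9 + c + C / 3 = a / 6 - b + c + (- B / 3 - A / 9 + C / 3)"
    for a b c A B C :: real by (simp add: diff_divide_distrib)
  ultimately have "(F has_real_derivative H t * (Om t * (4 * \<mu> - 2 * q t))) (at t)"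
    using alg2[of "- 2 * q t * (n1 t * n2 t + n2 t * n3 t + n3 t * n1 t)" B
        "(2 - q t) * ((s1 t)\<^sup>2 + (s2 t)\<^sup>2 + (s3 t)\<^sup>2) / 3" A
        "q t * ((n1 t)\<^sup>2 + (n2 t)\<^sup>2 + (n3 t)\<^sup>2) / 6" C] by simp
  \<comment> \<open>\<open>Om\<close> is known to agree with \<open>F\<close> only at positive
    times, hence the passage through the open half-line.\<close>
  then show ?thesis
    by (rule has_field_derivative_transform_within_open[of _ _ _ "{0<..}"])
      (auto simp: F_def Om_eq t)
qed

end

section \<open>Almost monotone quantities for a pair\<close>

text \<open>All reduces to \<open>\<bar>f\<bar> * \<bar>d\<bar> / 6 \<le> f^2 / (3 + \<bar>f\<bar>)
  + d^2 / 16\<close>. For \<open>\<bar>f\<bar> \<le> 6\<close> the denominator is at most 9 and the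
  arithmetic-geometric mean applies; beyond that, the first summand is at least
  \<open>2 / 3 * \<bar>f\<bar>\<close>, which suffices because
  \<open>\<bar>d\<bar> \<le> 4\<close>.\<close>

lemma virial_quadratic:
  fixes f d v S :: real
  assumes "v\<^sup>2 * (1 + f\<^sup>2 / (3 + \<bar>f\<bar>)) \<le> f * v * S" "\<bar>d\<bar> \<le> 4"
  shows "v\<^sup>2 / 6 - f * v * S / 6 - f * d * v\<^sup>2 / 36 \<le> v\<^sup>2 * d\<^sup>2 / 96"
proof -
  have "\<bar>f\<bar> * \<bar>d\<bar> / 6 \<le> f\<^sup>2 / (3 + \<bar>f\<bar>) + d\<^sup>2 / 16"
  proof (cases "\<bar>f\<bar> \<le> 6")
    case True
    have "f\<^sup>2 / 9 \<le> f\<^sup>2 / (3 + \<bar>f\<bar>)"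
      using True by (intro divide_left_mono) auto
    moreover have "0 \<le> (\<bar>d\<bar> / 4 - \<bar>f\<bar> / 3)\<^sup>2" by simp
    then have "\<bar>f\<bar> * \<bar>d\<bar> / 6 \<le> \<bar>f\<bar>\<^sup>2 / 9 + \<bar>d\<bar>\<^sup>2 / 16"
      by (simp add: power2_eq_square field_simps del: zero_le_square)
    ultimately show ?thesis by simp
  next
    case False
    have "\<bar>f\<bar> * \<bar>d\<bar> / 6 \<le> \<bar>f\<bar> * (2 / 3)" using mult_left_mono[OF assms(2), of "\<bar>f\<bar>"] by linarith
    also have "\<dots> \<le> \<bar>f\<bar> * (\<bar>f\<bar> / (3 + \<bar>f\<bar>))" using False by (intro mult_left_mono) (auto simp: field_simps)
    also have "\<dots> = f\<^sup>2 / (3 + \<bar>f\<bar>)" by (simp add: power2_eq_square)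
    also have "\<dots> \<le> \<dots> + d\<^sup>2 / 16" by simp
    finally show ?thesis .
  qed
  from mult_left_mono[OF this, of "v\<^sup>2"]
  have "v\<^sup>2 * (\<bar>f\<bar> * \<bar>d\<bar>) / 6 \<le> v\<^sup>2 * (f\<^sup>2 / (3 + \<bar>f\<bar>)) + v\<^sup>2 * d\<^sup>2 / 16" by (simp add: distrib_left)
  moreover have "v\<^sup>2 * (- f * d) \<le> v\<^sup>2 * (\<bar>f\<bar> * \<bar>d\<bar>)"
    by (intro mult_left_mono) (auto simp flip: abs_mult)
  ultimately show ?thesis using assms(1) by (simp add: algebra_simps)
qed

context bianchi
begin

lemma xi_abs: "0 < t \<Longrightarrow> \<bar>xi t\<bar> \<le> err t / 6"
proof -
  assume t: "0 < t"
  have "0 \<le> n3 t * S t" "0 \<le> n3 t" "0 \<le> (n3 t)\<^sup>2" using n_pos[OF t] pos[OF t] by simp_all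
  moreover have "err t = n3 t + n3 t * S t + (n3 t)\<^sup>2" by (simp add: err_def power2_eq_square algebra_simps)
  moreover have "\<bar>(n3 t)\<^sup>2 / 12 - n3 t * S t / 6\<bar> \<le> \<bar>(n3 t)\<^sup>2 / 12\<bar> + \<bar>n3 t * S t / 6\<bar>" by (rule abs_triangle_ineq4)
  moreover have "0 \<le> (n3 t)\<^sup>2" by simp
  ultimately show ?thesis unfolding xi_def by linarith
qed

lemma xi_le: "0 < t \<Longrightarrow> xi t \<le> err t / 6" "0 < t \<Longrightarrow> - xi t \<le> err t / 6"
  using xi_abs[of t] by (simp_all add: abs_le_iff)

text \<open>The threshold in \<open>small\<close> is a product so that one condition makes
  \<open>err\<close> small against \<open>\<mu>\<close>, against \<open>1 - \<mu>\<close> and, as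
  \<open>\<mu> * (1 - \<mu>) \<le> 1 / 4\<close>, absolutely.\<close>

lemma err_small: "small t \<Longrightarrow> err t \<le> 1 / 96" "small t \<Longrightarrow> err t \<le> 1 - \<mu>" "small t \<Longrightarrow> err t \<le> \<mu> / 24"
proof -
  assume s: "small t"
  then have s: "err t \<le> \<mu> * (1 - \<mu>) / 24" by (simp only: small_def)
  have "(1 - 2 * \<mu>)\<^sup>2 \<ge> 0" by simp
  then have "\<mu> * (1 - \<mu>) \<le> 1 / 4" by (simp add: power2_eq_square algebra_simps)
  then show "err t \<le> 1 / 96" using s by linarith
  have "\<mu> * (1 - \<mu>) \<le> 1 - \<mu>" using mu_less mu_pos by (intro mult_left_le_one_le) auto
  then show "err t \<le> 1 - \<mu>" using s mu_less by linarith
  have "\<mu> * (1 - \<mu>) \<le> \<mu>" using mu_less mu_pos by (intro mult_right_le_one_le) auto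
  then show "err t \<le> \<mu> / 24" using s by linarith
qed

lemma bounds:
  assumes "small t"
  shows "\<bar>d t\<bar> \<le> 18 / 5" "\<bar>v t\<bar> \<le> 18 / 5" "\<bar>s3 t / 2\<bar> \<le> 1 + err t" "0 \<le> q t" "\<bar>2 - q t\<bar> \<le> 21 / 10"
    "Om t \<le> 11 / 10" "- err t / 12 \<le> x t" "\<bar>x t\<bar> \<le> 21 / 10" "\<bar>v t\<bar> \<le> S t"
    "(v t)\<^sup>2 \<le> 12 * (1 - xi t)" "(v t)\<^sup>2 \<le> 13" "(d t)\<^sup>2 \<le> 13"
proof -
  have t: "0 < t" using assms by (rule small_pos)
  note e = err_small(1)[OF assms] and xi = xi_le[OF t] and c = constraint[OF t] and Om = Om_nonneg[OF t]
  \<comment> \<open>The constraint writes \<open>1 - xi\<close> as a sum of nonnegative terms, and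
    \<open>\<bar>xi\<bar> \<le> 1 / 576\<close>; the numerical bounds are slightly enlarged values
    of what this yields.\<close>
  have nn: "0 \<le> (s3 t)\<^sup>2" "0 \<le> (d t)\<^sup>2" "0 \<le> (v t)\<^sup>2" by simp_all
  show "(d t)\<^sup>2 \<le> 13" using nn e xi c Om by linarith
  have "(v t)\<^sup>2 \<le> 12 - 12 * xi t" using nn e xi c Om by linarith
  then show "(v t)\<^sup>2 \<le> 12 * (1 - xi t)" by simp
  show "(v t)\<^sup>2 \<le> 13" using nn e xi c Om by linarith
  show "Om t \<le> 11 / 10" using nn e xi c Om by linarith
  have "(d t)\<^sup>2 \<le> 324 / 25" using nn e xi c Om by linarith
  then show "\<bar>d t\<bar> \<le> 18 / 5" using abs_le_square_iff[of "d t" "18 / 5"] by (simp add: power_divide)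
  have "(v t)\<^sup>2 \<le> 324 / 25" using nn e xi c Om by linarith
  then show "\<bar>v t\<bar> \<le> 18 / 5" using abs_le_square_iff[of "v t" "18 / 5"] by (simp add: power_divide)
  have "(s3 t)\<^sup>2 / 4 \<le> 1 + err t / 6" using nn xi c Om by linarith
  then have "(s3 t / 2)\<^sup>2 \<le> 1 + err t / 6" by (simp add: power_divide)
  also have "\<dots> \<le> (1 + err t)\<^sup>2" using pos[OF t] by (simp add: power2_eq_square algebra_simps)
  finally have "\<bar>s3 t / 2\<bar>\<^sup>2 \<le> (1 + err t)\<^sup>2" by (simp only: power2_abs)
  then show s: "\<bar>s3 t / 2\<bar> \<le> 1 + err t" by (rule power2_le_imp_le) (use pos[OF t] in simp)
  show "0 \<le> q t" using q_eq'[OF t] Om mu_pos by simp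
  then have "2 - q t \<le> 2" by simp
  moreover have "(2 - 2 * \<mu>) * Om t \<ge> 0" using mu_less Om by simp
  then have "- err t / 3 \<le> 2 - q t" using two_minus_q[OF t] nn xi by linarith
  ultimately show "\<bar>2 - q t\<bar> \<le> 21 / 10" using e \<open>0 \<le> q t\<close> by linarith
  show "\<bar>x t\<bar> \<le> 21 / 10" using s e unfolding x_def by linarith
  have "xi t \<le> 2 * x t" using x_eq[OF t, unfolded add_divide_distrib] nn Om zero_le_power2[of "x t"] by linarith
  then show "- err t / 12 \<le> x t" using xi by simp
  show "\<bar>v t\<bar> \<le> S t" using n_pos[OF t] by (simp add: v_def S_def)
qed

text \<open>As \<open>v\<close> is bounded, \<open>S \<le> P + 5\<close>, hence
  \<open>err \<le> n3 * (P + 7)\<close>; \<open>P \<ge> \<delta>\<close> absorbs the constant into a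
  multiple of \<open>P\<close>, and \<open>n3 * P = g\<close>.\<close>

lemma err_le_g:
  assumes "small t" "\<delta> \<le> P t" "0 < \<delta>" "\<delta> \<le> 1"
  shows "err t \<le> 10 * g t / \<delta>"
proof -
  have t: "0 < t" using assms(1) by (rule small_pos)
  note n = n_pos[OF t] and p = pos
  have "n3 t * 1 \<le> err t" unfolding err_def using n p[OF t] by (intro mult_left_mono) auto
  then have n3: "n3 t \<le> 1" using err_small(1)[OF assms(1)] by simp
  have "(S t)\<^sup>2 = 4 * P t + (v t)\<^sup>2" by (simp add: S_def P_def v_def power2_eq_square algebra_simps)
  moreover have "0 \<le> (S t - 2)\<^sup>2" by simp
  ultimately have S: "S t \<le> P t + 5" using bounds(11)[OF assms(1)] by (simp add: power2_eq_square algebra_simps del: zero_le_square)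
  have "err t \<le> n3 t * (P t + 7)" unfolding err_def using n n3 S by (intro mult_left_mono) auto
  also have "\<dots> \<le> n3 t * (P t * (10 / \<delta>))"
  proof (intro mult_left_mono)
    have "\<delta> * P t \<le> P t" using p(2)[OF t] assms by (intro mult_left_le_one_le) auto
    then have "\<delta> * P t + \<delta> * 7 \<le> 10 * P t" using assms by linarith
    then show "P t + 7 \<le> P t * (10 / \<delta>)" using assms by (simp add: field_simps)
  qed (use n in simp)
  also have "\<dots> = 10 * g t / \<delta>" by (simp add: g_def P_def)
  finally show ?thesis .
qed

text \<open>\<open>g\<close> is only weakly decreasing because \<open>q\<close> is close to 0 whenever \<open>v\<close> carries
  all the energy of the \<open>(d, v)\<close> oscillation.  As \<open>D (d v / S)\<close> is about \<open>v\<^sup>2 - d\<^sup>2\<close>, the factor in \<open>E\<close> equidistributes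
  that energy and makes the decay uniform.\<close>

definition j where "j t = d t * v t / S t"
definition j_rate where "j_rate t = (2 - q t) * j t + (v t)\<^sup>2 - (d t)\<^sup>2 - (v t)\<^sup>2 * n3 t / S t + (j t)\<^sup>2"
definition E where "E t = g t * exp (- (\<mu> / 8 * j t))"
definition E_rate where "E_rate t = E t * (- 3 * q t - \<mu> / 8 * j_rate t)"

lemma D_j: "0 < t \<Longrightarrow> (j has_real_derivative H t * j_rate t) (at t)"
proof -
  assume t: "0 < t"
  have S: "S t \<noteq> 0" using pos[OF t] by simp
  show ?thesis unfolding j_def[abs_def] j_rate_def
    by (rule DERIV_cong[OF DERIV_divide[OF DERIV_mult[OF D_d D_v] D_S]])
      (use t S in \<open>simp_all add: j_def field_simps power2_eq_square\<close>)
qed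

lemma D_E: "0 < t \<Longrightarrow> (E has_real_derivative H t * E_rate t) (at t)"
  unfolding E_def[abs_def] E_rate_def
  by (auto intro!: derivative_eq_intros D_g D_j simp: algebra_simps)

lemma E_pos: "0 < t \<Longrightarrow> 0 < E t"
  using pos[of t] by (simp add: E_def)

lemma j_abs: "small t \<Longrightarrow> \<bar>j t\<bar> \<le> \<bar>d t\<bar>"
proof -
  assume s: "small t"
  have "\<bar>v t\<bar> \<le> S t" "0 < S t" using bounds(9)[OF s] pos(1)[OF small_pos[OF s]] by auto
  then have "\<bar>d t\<bar> * \<bar>v t\<bar> \<le> \<bar>d t\<bar> * S t" by (intro mult_left_mono) auto
  then show ?thesis using \<open>0 < S t\<close> by (simp add: j_def abs_mult field_simps)
qed

text \<open>\<open>\<bar>j\<bar> \<le> 18 / 5\<close> and \<open>\<mu> < 1\<close> bound the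
  exponent by \<open>9 / 20\<close>, so the correcting factor in \<open>E\<close> lies between
  \<open>1 / 2\<close> and 2.\<close>

lemma E_g:
  assumes "small t"
  shows "g t \<le> 2 * E t" "E t \<le> 2 * g t"
proof -
  have t: "0 < t" using assms by (rule small_pos)
  have j: "\<bar>\<mu> / 8 * j t\<bar> \<le> 9 / 20"
  proof -
    have "\<mu> * \<bar>j t\<bar> \<le> 1 * (18 / 5)"
      using j_abs[OF assms] bounds(1)[OF assms] mu_pos mu_less by (intro mult_mono) auto
    then show ?thesis using mu_pos by (simp add: abs_mult)
  qed
  have ex: "exp y \<le> 2" if "\<bar>y\<bar> \<le> 9 / 20" for y :: real
  proof -
    have "1 - y \<le> exp (- y)" using exp_ge_add_one_self[of "- y"] by simp
    then have "1 / 2 \<le> exp (- y)" using that by (simp add: abs_le_iff)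
    then show ?thesis by (simp add: exp_minus field_simps)
  qed
  have "exp (- (\<mu> / 8 * j t)) \<le> 2" by (rule ex) (use j in simp)
  then show "E t \<le> 2 * g t" using pos(3)[OF t] unfolding E_def by simp
  have "g t = E t * exp (\<mu> / 8 * j t)" by (simp add: E_def exp_minus)
  also have "\<dots> \<le> E t * 2" using E_pos[OF t] ex[OF j] by (intro mult_left_mono) auto
  finally show "g t \<le> 2 * E t" by simp
qed

text \<open>Three times the lower bound for \<open>q\<close> is about
  \<open>3 * \<mu> - \<mu> * v^2 / 4 + d^2 / 4\<close>, and the \<open>j\<close> term gives back
  \<open>\<mu> * v^2 / 8\<close>. As \<open>v^2\<close> is at most about 12,
  \<open>3 / 2 * \<mu>\<close> remains; the \<open>d\<close> terms of \<open>j_rate\<close> are paid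
  by \<open>d^2 / 4\<close> and by part of the surplus over \<open>3 / 8 * \<mu>\<close>.\<close>

lemma E_rate_le:
  assumes "small t"
  shows "E_rate t \<le> - (3 * \<mu> / 8) * E t"
proof -
  have t: "0 < t" using assms by (rule small_pos)
  note b = bounds[OF assms] and xi = xi_abs[OF t] and p = pos[OF t] and n = n_pos[OF t]
  \<comment> \<open>The share \<open>d^2 / 12\<close> is kept aside; it pays below for the terms in
    \<open>d\<close> that come from \<open>j_rate\<close>.\<close>
  have q: "\<mu> * (1 - (v t)\<^sup>2 / 12 - xi t) + (d t)\<^sup>2 / 12 \<le> q t"
  proof -
    have "0 \<le> (2 - \<mu>) * (s3 t)\<^sup>2" "0 \<le> (1 - \<mu>) * (d t)\<^sup>2" "0 \<le> \<mu> * Om t"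
      using mu_pos mu_less Om_nonneg[OF t] by simp_all
    moreover have c: "1 - (v t)\<^sup>2 / 12 - xi t = (s3 t)\<^sup>2 / 4 + (d t)\<^sup>2 / 12 + Om t" using constraint[OF t] by simp
    ultimately show ?thesis unfolding q_eq'[OF t] c by (simp add: algebra_simps)
  qed
  have jr: "(v t)\<^sup>2 - (d t)\<^sup>2 - 21 / 10 * \<bar>d t\<bar> - err t \<le> j_rate t"
  proof -
    have "\<bar>(2 - q t) * j t\<bar> \<le> 21 / 10 * \<bar>d t\<bar>"
      unfolding abs_mult using b(5) j_abs[OF assms] by (intro mult_mono) auto
    moreover have "(v t)\<^sup>2 * n3 t / S t \<le> err t"
    proof -
      have "\<bar>v t\<bar> * \<bar>v t\<bar> \<le> S t * S t" using b(9) by (intro mult_mono) auto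
      then have "(v t)\<^sup>2 \<le> S t * S t" by (simp add: power2_eq_square)
      then have "(v t)\<^sup>2 * n3 t \<le> S t * S t * n3 t" using n by (intro mult_right_mono) auto
      then have "(v t)\<^sup>2 * n3 t / S t \<le> S t * n3 t" using p by (simp add: field_simps)
      also have "\<dots> \<le> err t" using n by (simp add: err_def algebra_simps)
      finally show ?thesis .
    qed
    moreover have "0 \<le> (j t)\<^sup>2" by simp
    ultimately show ?thesis unfolding j_rate_def by linarith
  qed
  have "\<mu> * ((v t)\<^sup>2 - (d t)\<^sup>2 - 21 / 10 * \<bar>d t\<bar> - err t) \<le> \<mu> * j_rate t"
    using jr mu_pos by (intro mult_left_mono) auto
  then have 1: "\<mu> * (v t)\<^sup>2 - \<mu> * (d t)\<^sup>2 - 21 / 10 * (\<mu> * \<bar>d t\<bar>) - \<mu> * err t \<le> \<mu> * j_rate t"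
    by (simp add: right_diff_distrib)
  have "\<mu> * (v t)\<^sup>2 \<le> \<mu> * (12 * (1 - xi t))" using b(10) mu_pos by (intro mult_left_mono) auto
  then have 2: "\<mu> * (v t)\<^sup>2 \<le> 12 * \<mu> - 12 * (\<mu> * xi t)" by (simp add: right_diff_distrib)
  have 3: "\<mu> * (d t)\<^sup>2 \<le> (d t)\<^sup>2" using mu_less mu_pos by (intro mult_left_le_one_le) auto
  have "0 \<le> (\<bar>d t\<bar> - 21 / 20 * \<mu>)\<^sup>2" by simp
  then have 4: "21 / 10 * (\<mu> * \<bar>d t\<bar>) \<le> (d t)\<^sup>2 + 441 / 400 * \<mu>\<^sup>2"
    by (simp add: power2_diff power_mult_distrib algebra_simps power2_eq_square del: zero_le_square)
  have 5: "\<mu>\<^sup>2 \<le> \<mu>" using mu_pos mu_less by (simp add: power2_eq_square mult_left_le)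
  have "\<bar>xi t\<bar> \<le> 1 / 576" using xi err_small(1)[OF assms] by simp
  then have "\<mu> * \<bar>xi t\<bar> \<le> \<mu> * (1 / 576)" using mu_pos by (intro mult_left_mono) auto
  then have "\<bar>\<mu> * xi t\<bar> \<le> \<mu> / 576" using mu_pos by (simp add: abs_mult)
  then have 6: "\<mu> * xi t \<le> \<mu> / 576" "- (\<mu> * xi t) \<le> \<mu> / 576" by linarith+
  have "\<mu> * err t \<le> \<mu> * (1 / 96)" using err_small(1)[OF assms] mu_pos by (intro mult_left_mono) auto
  then have 7: "\<mu> * err t \<le> \<mu> / 96" by simp
  have 8: "\<mu> - \<mu> * (v t)\<^sup>2 / 12 - \<mu> * xi t + (d t)\<^sup>2 / 12 \<le> q t" using q by (simp add: right_diff_distrib)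
  have "3 * \<mu> / 8 \<le> 3 * q t + \<mu> * j_rate t / 8"
    using 1 2 3 4 5 6 7 8 mu_pos zero_le_power2[of "d t"] by linarith
  then have "3 * \<mu> / 8 \<le> 3 * q t + \<mu> / 8 * j_rate t" by simp
  then have "E t * (3 * \<mu> / 8) \<le> E t * (3 * q t + \<mu> / 8 * j_rate t)"
    using E_pos[OF t] by (intro mult_left_mono) auto
  then show ?thesis unfolding E_rate_def by (simp add: algebra_simps)
qed

text \<open>The factor 60 makes \<open>K C \<delta> * (3 * \<mu> / 8)\<close> equal to
  \<open>45 / 2 * C / \<delta>\<close>, above the \<open>20 * C / \<delta>\<close> that
  \<open>err \<le> 20 * E / \<delta>\<close> requires.\<close>

definition K where "K C \<delta> = 60 * C / (\<mu> * \<delta>)"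

text \<open>The interface between errors and \<open>E\<close>: whoever has a rate bounded by
  \<open>C * err\<close> adds \<open>K C \<delta> * E\<close> to the function and obtains
  monotonicity.\<close>

lemma absorb:
  assumes "small t" "\<delta> \<le> P t" "0 < \<delta>" "\<delta> \<le> 1" "0 \<le> C" "F \<le> C * err t"
  shows "F + K C \<delta> * E_rate t \<le> 0"
proof -
  have "C * err t \<le> C * (20 * E t / \<delta>)"
  proof (intro mult_left_mono)
    have "10 * g t / \<delta> \<le> 20 * E t / \<delta>" using E_g[OF assms(1)] assms(3) by (intro divide_right_mono) auto
    then show "err t \<le> 20 * E t / \<delta>" using err_le_g[OF assms(1-4)] by simp
  qed fact
  moreover have "K C \<delta> * E_rate t \<le> K C \<delta> * (- (3 * \<mu> / 8) * E t)"
    using E_rate_le[OF assms(1)] assms mu_pos by (intro mult_left_mono) (auto simp: K_def)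
  moreover have "K C \<delta> * (- (3 * \<mu> / 8) * E t) = - (45 / 2) * (C * (E t / \<delta>))"
    using mu_pos assms by (simp add: K_def field_simps)
  moreover have "0 \<le> C * (E t / \<delta>)" using assms E_pos[OF small_pos[OF assms(1)]] by simp
  ultimately show ?thesis using assms(6) by simp
qed

text \<open>For \<open>n\<^sub>3 = 0\<close>, \<open>M\<close> is nonincreasing: up to the factor \<open>l\<close>, its logarithmic derivative is
  \<open>- 4 ((s\<^sub>3 / 2 - \<mu>)\<^sup>2 + (1 - \<mu>\<^sup>2) d\<^sup>2 / 12)\<close>.\<close>

definition l where "l t = 1 - \<mu> * s3 t / 2"
definition M where "M t = Om t * exp (\<mu> * ln (P t) - 2 * (1 + \<mu>) * ln (l t))"
definition M_rate where "M_rate t = 4 * \<mu> - 2 * q t + \<mu> * (2 * s3 t - 2 * q t)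
   + (1 + \<mu>) * \<mu> * ((2 - q t) * s3 t + (n3 t * (2 * n3 t - n1 t - n2 t) - (n1 t - n2 t)\<^sup>2) / 3) / l t"

lemma l_bounds: "small t \<Longrightarrow> (1 - \<mu>) / 2 \<le> l t" "small t \<Longrightarrow> l t \<le> 3"
proof -
  assume s: "small t"
  have s3: "s3 t / 2 \<le> 1 + err t" "- (s3 t / 2) \<le> 1 + err t" using bounds(3)[OF s] by (simp_all add: abs_le_iff)
  have e: "err t \<le> 1 / 96" "err t \<le> (1 - \<mu>) / 24"
  proof -
    have "\<mu> * (1 - \<mu>) \<le> 1 - \<mu>" using mu_less mu_pos by (intro mult_left_le_one_le) auto
    then show "err t \<le> (1 - \<mu>) / 24" using s by (simp add: small_def)
  qed (rule err_small(1)[OF s])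
  have "\<mu> * (s3 t / 2) \<le> \<mu> * (1 + err t)" "\<mu> * (- (s3 t / 2)) \<le> \<mu> * (1 + err t)"
    by (rule mult_left_mono[OF s3(1)] mult_left_mono[OF s3(2)]; use mu_pos in simp)+
  moreover have "\<mu> * err t \<le> 1 * err t" using mu_less pos(4)[OF small_pos[OF s]] by (intro mult_right_mono) auto
  ultimately have "\<mu> * s3 t / 2 \<le> \<mu> + err t" "- (\<mu> * s3 t / 2) \<le> \<mu> + err t" by (simp_all add: algebra_simps)
  then show "(1 - \<mu>) / 2 \<le> l t" "l t \<le> 3"
    using e mu_less by (simp_all add: l_def)
qed

lemma D_M: "small t \<Longrightarrow> (M has_real_derivative H t * (M t * M_rate t)) (at t)"
proof -
  assume s: "small t"
  have t: "0 < t" using s by (rule small_pos)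
  have l: "0 < l t" using l_bounds(1)[OF s] mu_less by simp
  have Dl: "(l has_real_derivative - (\<mu> * (H t * ((2 - q t) * s3 t
        + (n3 t * (2 * n3 t - n1 t - n2 t) - (n1 t - n2 t)\<^sup>2) / 3)) / 2)) (at t)"
    unfolding l_def[abs_def] by (rule derivative_eq_intros D_s3 refl | simp add: t)+
  show ?thesis unfolding M_def[abs_def] M_rate_def
    by (rule derivative_eq_intros D_P Dl D_Om refl t | use l pos(2)[OF t] in \<open>simp add: field_simps\<close>)+
qed

lemma M_rate_le:
  assumes "small t"
  shows "M_rate t \<le> 4 / (1 - \<mu>) * err t"
proof -
  have t: "0 < t" using assms by (rule small_pos)
  have l: "0 < l t" "(1 - \<mu>) / 2 \<le> l t" using l_bounds(1)[OF assms] mu_less by auto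
  define y where "y = s3 t / 2"
  define r where "r = (d t)\<^sup>2 / 12"
  define m where "m = (v t)\<^sup>2 / 12"
  have c: "Om t = 1 - y\<^sup>2 - r - m - xi t"
    using constraint[OF t] by (simp add: y_def r_def m_def power_divide)
  have q: "q t = 2 * y\<^sup>2 + 2 * r + 2 * \<mu> * Om t"
    using q_eq'[OF t] by (simp add: y_def r_def power_divide)
  define \<nu> where "\<nu> = (n3 t)\<^sup>2 / 2 + 2 * xi t"
  have N: "(n3 t * (2 * n3 t - n1 t - n2 t) - (n1 t - n2 t)\<^sup>2) / 3 = \<nu> - 4 * m"
    by (simp add: \<nu>_def xi_def m_def v_def S_def power2_eq_square field_simps)
  have lc: "l t * (a + b / l t) = l t * a + b" for a b using l by (simp add: field_simps)
  have s3: "s3 t = 2 * y" by (simp add: y_def)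
  \<comment> \<open>Multiplying by \<open>l\<close> removes the only denominator. The constraint
    then eliminates \<open>Om\<close>, and completing the square at \<open>y = \<mu>\<close> leaves
    a nonpositive form plus terms that contain \<open>n3\<close>.\<close>
  have "l t * M_rate t = l t * (4 * \<mu> - 2 * q t + \<mu> * (4 * y - 2 * q t))
      + (1 + \<mu>) * \<mu> * ((2 - q t) * (2 * y) + \<nu> - 4 * m)"
    unfolding M_rate_def N s3 lc by simp
  also have "l t = 1 - \<mu> * y" by (simp add: l_def y_def)
  also have "(1 - \<mu> * y) * (4 * \<mu> - 2 * q t + \<mu> * (4 * y - 2 * q t))
      + (1 + \<mu>) * \<mu> * ((2 - q t) * (2 * y) + \<nu> - 4 * m)
    = 4 * \<mu> + 8 * \<mu> * y - 4 * \<mu>\<^sup>2 * y\<^sup>2 + \<mu> * (1 + \<mu>) * (\<nu> - 4 * m) - 2 * (1 + \<mu>) * q t"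
    by (simp add: power2_eq_square algebra_simps)
  also have "q t = 2 * (\<mu> + (1 - \<mu>) * (y\<^sup>2 + r) - \<mu> * m - \<mu> * xi t)"
    unfolding q c by (simp add: algebra_simps)
  also have "4 * \<mu> + 8 * \<mu> * y - 4 * \<mu>\<^sup>2 * y\<^sup>2 + \<mu> * (1 + \<mu>) * (\<nu> - 4 * m)
      - 2 * (1 + \<mu>) * (2 * (\<mu> + (1 - \<mu>) * (y\<^sup>2 + r) - \<mu> * m - \<mu> * xi t))
    = - 4 * ((y - \<mu>)\<^sup>2 + (1 - \<mu>\<^sup>2) * r) + \<mu> * (1 + \<mu>) * (\<nu> + 4 * xi t)"
    by (simp add: power2_eq_square algebra_simps)
  also have "\<dots> \<le> \<mu> * (1 + \<mu>) * (\<nu> + 4 * xi t)"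
  proof -
    have "\<mu>\<^sup>2 \<le> 1" using mu_pos mu_less by (intro power_le_one) auto
    then have "0 \<le> (1 - \<mu>\<^sup>2) * r" by (simp add: r_def)
    then have z: "0 \<le> (y - \<mu>)\<^sup>2 + (1 - \<mu>\<^sup>2) * r" by (intro add_nonneg_nonneg) simp_all
    have "- 4 * z + a \<le> a" if "0 \<le> z" for z a :: real using that by simp
    from this[OF z] show ?thesis .
  qed
  also have "\<dots> \<le> \<mu> * (1 + \<mu>) * err t"
  proof (intro mult_left_mono)
    have "0 \<le> n3 t * S t" "0 \<le> n3 t" using n_pos[OF t] pos[OF t] by simp_all
    then show "\<nu> + 4 * xi t \<le> err t" by (simp add: \<nu>_def xi_def err_def power2_eq_square algebra_simps)
  qed (use mu_pos in simp)
  also have "\<dots> \<le> 2 * err t"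
    using mu_pos mu_less pos(4)[OF t] mult_mono[of \<mu> 1 "1 + \<mu>" 2]
    by (intro mult_right_mono) auto
  finally have "(1 - \<mu> * y) * M_rate t \<le> 2 * err t" .
  then have "l t * M_rate t \<le> 2 * err t" by (simp add: l_def y_def)
  then have "M_rate t \<le> 2 * err t / l t" using l by (simp add: field_simps)
  also have "\<dots> \<le> 2 * err t / ((1 - \<mu>) / 2)"
    using l mu_less pos(4)[OF t] by (intro divide_left_mono) auto
  finally show ?thesis by (simp add: field_simps)
qed

text \<open>The derivative of \<open>ln P\<close> contains the indefinite term \<open>(v\<^sup>2 - d\<^sup>2) / 6\<close>.  Subtracting \<open>d phi / 6\<close>
  turns it into \<open>(v\<^sup>2 - phi v S) / 6\<close> up to lower order, and \<open>v\<^sup>2 \<le> phi v S\<close>.\<close>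

definition Psi where "Psi t = ln (P t) - d t * phi t / 6"
definition Psi_rate where
  "Psi_rate t = 2 * s3 t - 2 * q t - (phi t * ((2 - q t) * d t + v t * (S t - n3 t)) - (d t)\<^sup>2) / 6"

lemma D_Psi: "0 < t \<Longrightarrow> (Psi has_real_derivative H t * Psi_rate t) (at t)"
proof -
  assume t: "0 < t"
  show ?thesis unfolding Psi_def[abs_def] Psi_rate_def
    by (rule derivative_eq_intros D_P D_d D_phi refl t | use pos(2)[OF t] in \<open>simp add: field_simps power2_eq_square\<close>)+
qed

text \<open>The virial correction leaves at most \<open>v^2 * d^2 / 96\<close>. Since
  \<open>2 * x\<close> bounds \<open>(d^2 + v^2) / 12\<close> up to \<open>xi\<close>, this is at
  most \<open>3 / 2 * x^2\<close> up to errors, and the \<open>- 2 * x^2\<close> in the derivative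
  of \<open>ln P\<close> outweighs it by \<open>x^2 / 2\<close>.\<close>

lemma Psi_rate_le:
  assumes "small t"
  shows "Psi_rate t \<le> - (x t)\<^sup>2 / 2 + (2 - 4 * \<mu>) * Om t + (2 - 2 * \<mu>) * (\<bar>phi t * d t\<bar> * Om t) / 6
    + 2 * (1 + \<bar>phi t\<bar>) * err t"
proof -
  have t: "0 < t" using assms by (rule small_pos)
  note b = bounds[OF assms] and xi = xi_abs[OF t] and p = pos[OF t] and n = n_pos[OF t]
  define \<rho> where "\<rho> = ((d t)\<^sup>2 + (v t)\<^sup>2) / 12"
  have rho: "0 \<le> \<rho>" "\<rho> \<le> 2 * x t - xi t"
    using x_eq[OF t] Om_nonneg[OF t] zero_le_power2[of "x t"] unfolding \<rho>_def[symmetric]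
    by (simp add: \<rho>_def, linarith)
  have main: "Psi_rate t = - 2 * (x t)\<^sup>2 + ((v t)\<^sup>2 / 6 - phi t * v t * S t / 6 - phi t * d t * (v t)\<^sup>2 / 36)
     + (2 - 4 * \<mu>) * Om t - (2 - 2 * \<mu>) * (phi t * d t * Om t) / 6
     + 2 * xi t - phi t * d t * xi t / 3 + phi t * v t * n3 t / 6"
  proof -
    have 1: "2 * s3 t - 2 * q t = - 2 * (x t)\<^sup>2 + ((v t)\<^sup>2 - (d t)\<^sup>2) / 6 + (2 - 4 * \<mu>) * Om t + 2 * xi t"
    proof -
      have "s3 t = 2 - 2 * x t" by (simp add: x_def)
      moreover have "q t = 2 - ((v t)\<^sup>2 / 6 + (2 - 2 * \<mu>) * Om t + 2 * xi t)" using two_minus_q[OF t] by simp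
      ultimately show ?thesis using x_eq[OF t] by (simp add: field_simps)
    qed
    show ?thesis unfolding Psi_rate_def 1 two_minus_q[OF t] by (simp add: field_simps power2_eq_square)
  qed
  have "(v t)\<^sup>2 / 6 - phi t * v t * S t / 6 - phi t * d t * (v t)\<^sup>2 / 36 \<le> (v t)\<^sup>2 * (d t)\<^sup>2 / 96"
    using half_log_ratio_virial[OF n(1,2)] b(1) unfolding phi_def v_def S_def
    by (intro virial_quadratic) auto
  \<comment> \<open>\<open>4 * d^2 * v^2 \<le> (d^2 + v^2)^2 = 144 * \<rho>^2\<close>.\<close>
  also have "\<dots> \<le> 3 / 8 * \<rho>\<^sup>2"
  proof -
    have "0 \<le> ((d t)\<^sup>2 - (v t)\<^sup>2)\<^sup>2" by simp
    then show ?thesis unfolding \<rho>_def by (simp add: power2_eq_square field_simps del: zero_le_square)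
  qed
  also have "\<dots> \<le> 3 / 8 * (2 * x t - xi t)\<^sup>2" using rho by (intro mult_left_mono power_mono) auto
  also have "\<dots> \<le> 3 / 2 * (x t)\<^sup>2 + 3 / 5 * err t"
  proof -
    have 1: "\<bar>x t * xi t\<bar> \<le> 21 / 10 * (err t / 6)" unfolding abs_mult using b(8) xi by (intro mult_mono) auto
    have "\<bar>xi t\<bar> * \<bar>xi t\<bar> \<le> 1 / 576 * (err t / 6)"
      using xi err_small(1)[OF assms] by (intro mult_mono) auto
    then have "(xi t)\<^sup>2 \<le> err t / 6 / 576" by (simp add: power2_eq_square)
    then show ?thesis using 1 p by (simp add: power2_diff power_mult_distrib abs_le_iff algebra_simps)
  qed
  finally have A: "(v t)\<^sup>2 / 6 - phi t * v t * S t / 6 - phi t * d t * (v t)\<^sup>2 / 36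
      \<le> 3 / 2 * (x t)\<^sup>2 + 3 / 5 * err t" .
  have B: "- (2 - 2 * \<mu>) * (phi t * d t * Om t) \<le> (2 - 2 * \<mu>) * (\<bar>phi t * d t\<bar> * Om t)"
  proof -
    have gen: "- k * (p * u) \<le> k * (\<bar>p\<bar> * u)" if "0 \<le> k" "0 \<le> u" for k p u :: real
      using that mult_left_mono[OF mult_right_mono[of "- p" "\<bar>p\<bar>" u], of k] by simp
    show ?thesis by (rule gen) (use mu_less Om_nonneg[OF t] in auto)
  qed
  have "\<bar>phi t * d t * xi t\<bar> \<le> \<bar>phi t\<bar> * (18 / 5) * (err t / 6)"
    unfolding abs_mult using b(1) xi by (intro mult_mono) auto
  then have 1: "- (phi t * d t * xi t) \<le> 3 / 5 * (\<bar>phi t\<bar> * err t)" by simp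
  have 2: "phi t * v t * n3 t \<le> \<bar>phi t\<bar> * err t"
  proof -
    have "\<bar>v t\<bar> * \<bar>n3 t\<bar> \<le> S t * n3 t" using b(9) n by (intro mult_mono) auto
    also have "\<dots> \<le> err t" using n by (simp add: err_def algebra_simps)
    finally have "\<bar>phi t * v t * n3 t\<bar> \<le> \<bar>phi t\<bar> * err t"
      unfolding abs_mult mult.assoc by (intro mult_left_mono) auto
    then show ?thesis by simp
  qed
  have 3: "0 \<le> \<bar>phi t\<bar> * err t" "0 \<le> err t" using p by simp_all
  have 4: "2 * (1 + \<bar>phi t\<bar>) * err t = 2 * err t + 2 * (\<bar>phi t\<bar> * err t)" by (simp add: algebra_simps)
  show ?thesis unfolding main 4 using A B xi_le[OF t] 1 2 3 by linarith
qed

text \<open>With \<open>k = 2 - 2 * \<mu>\<close>, adding \<open>lam * Om\<close> contributes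
  \<open>- 2 * k * lam * Om\<close>. One half of this goes to the cross term
  \<open>8 * lam * x * Om\<close>, which also uses up the spare \<open>- x^2 / 2\<close>; a quarter
  goes to the term quadratic in \<open>Om\<close> and a quarter to the matter terms of
  \<open>Psi_rate\<close>. The last share dictates \<open>lam = 4 + 2 * \<Lambda>\<close>, the cross
  term dictates the bound on \<open>Om\<close>.\<close>

lemma Psi_Om_rate_le:
  assumes "small t" and phi: "\<bar>phi t\<bar> \<le> \<Lambda>" and lam: "lam = 4 + 2 * \<Lambda>"
    and Om: "Om t \<le> (2 - 2 * \<mu>) / (32 * lam)"
  shows "Psi_rate t + lam * (Om t * (4 * \<mu> - 2 * q t)) \<le> 2 * (1 + \<Lambda>) * err t"
proof -
  have t: "0 < t" using assms(1) by (rule small_pos)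
  note b = bounds[OF assms(1)] and xi = xi_abs[OF t] and p = pos[OF t] and O0 = Om_nonneg[OF t]
  define k where "k = 2 - 2 * \<mu>"
  have k: "0 < k" "k \<le> 2" using mu_pos mu_less by (auto simp: k_def)
  have La: "0 \<le> \<Lambda>" using phi by linarith
  then have l4: "4 \<le> lam" using lam by simp
  have Om': "32 * (lam * Om t) \<le> k" using Om l4 by (simp add: k_def field_simps)
  have "4 * Om t \<le> lam * Om t" using l4 O0 by (intro mult_right_mono) auto
  then have O4: "Om t \<le> 1 / 4" using Om' k by simp
  have 1: "4 * \<mu> - 2 * q t \<le> - 2 * k + 8 * x t + 2 * k * Om t"
  proof -
    have "(v t)\<^sup>2 / 12 \<le> 2 * x t - xi t"
      using x_eq[OF t] O0 zero_le_power2[of "x t"] zero_le_power2[of "d t"] by (simp add: add_divide_distrib)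
    then show ?thesis using two_minus_q[OF t] unfolding k_def by (simp add: algebra_simps)
  qed
  have "lam * Om t * (4 * \<mu> - 2 * q t) \<le> lam * Om t * (- 2 * k + 8 * x t + 2 * k * Om t)"
    using 1 l4 O0 by (intro mult_left_mono) auto
  moreover have "k * (lam * Om t) * Om t \<le> k * (lam * Om t) * (1 / 4)"
    using O4 k l4 O0 by (intro mult_left_mono) auto
  moreover have "lam * Om t * (8 * x t) \<le> (x t)\<^sup>2 / 2 + k * (lam * Om t)"
  proof -
    have "0 \<le> (x t - 8 * (lam * Om t))\<^sup>2" by simp
    then have "8 * (lam * Om t) * x t \<le> (x t)\<^sup>2 / 2 + lam * Om t * (32 * (lam * Om t))"
      by (simp add: power2_eq_square algebra_simps del: zero_le_square)
    moreover have "lam * Om t * (32 * (lam * Om t)) \<le> lam * Om t * k" using Om' l4 O0 by (intro mult_left_mono) auto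
    ultimately show ?thesis by (simp add: algebra_simps)
  qed
  moreover have "(2 - 4 * \<mu>) * Om t + k * (\<bar>phi t * d t\<bar> * Om t) / 6 \<le> k * (lam * Om t) / 2"
  proof -
    have "(2 - 4 * \<mu>) * Om t \<le> k * Om t" using O0 mu_pos unfolding k_def by (intro mult_right_mono) auto
    moreover have "\<bar>phi t * d t\<bar> \<le> \<Lambda> * 6" unfolding abs_mult using phi b(1) La by (intro mult_mono) auto
    then have "k * (\<bar>phi t * d t\<bar> * Om t) \<le> k * (\<Lambda> * 6 * Om t)" using k O0 by (intro mult_left_mono mult_right_mono) auto
    moreover have "0 \<le> k * Om t" using k O0 by simp
    ultimately show ?thesis unfolding lam by (simp add: algebra_simps)
  qed
  moreover have "2 * (1 + \<bar>phi t\<bar>) * err t \<le> 2 * (1 + \<Lambda>) * err t"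
    using phi p by (intro mult_right_mono) auto
  ultimately show ?thesis using Psi_rate_le[OF assms(1)] unfolding k_def[symmetric]
    by (simp add: algebra_simps)
qed

section \<open>Smallness of the error terms from the vanishing volume\<close>

lemma q_nonneg: "0 < t \<Longrightarrow> 0 \<le> q t"
  using q_eq[of t] Om_nonneg[of t] mu_pos by simp

lemma g_antimono:
  assumes "0 < s" "s \<le> t"
  shows "g t \<le> g s"
proof (rule nonincreasing_if_deriv_nonpos[OF assms(2)])
  show "(g has_real_derivative H u * (- 3 * q u * g u)) (at u)" if "s \<le> u" "u \<le> t" for u
    using D_g that assms by simp
  show "H u * (- 3 * q u * g u) \<le> 0" if "s \<le> u" "u \<le> t" for u
    using H_pos[of u] q_nonneg[of u] pos(3)[of u] that assms by (auto simp: mult_nonneg_nonneg intro!: mult_nonneg_nonpos)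
qed

text \<open>Only \<open>g * H^3\<close> is known to vanish, and \<open>H^2\<close> is bounded below
  merely by a multiple of \<open>1 / P\<close>; this gives
  \<open>g^2 \<le> C * P^3 * (g * H^3)^2\<close> with a loss of \<open>P^3\<close>. On the other
  hand \<open>err^2\<close> is at most a multiple of \<open>g^2 / P\<close>. The third power of this
  estimate gains \<open>P^3\<close> back, and the surplus factor \<open>g^4\<close> is bounded
  because \<open>g\<close> decreases. Hence the sixth power of \<open>err\<close>.\<close>

lemma pair_control:
  assumes \<delta>: "0 < \<delta>" "\<delta> \<le> 1"
  obtains C where "0 \<le> C"
    "\<And>t. 1 \<le> t \<Longrightarrow> \<delta> \<le> P t \<Longrightarrow> err t ^ 6 \<le> C * (g t * H t ^ 3)\<^sup>2"
    "\<And>t. 1 \<le> t \<Longrightarrow> \<delta> \<le> P t \<Longrightarrow> P t \<le> 1 \<Longrightarrow> (g t)\<^sup>2 \<le> C * (g t * H t ^ 3)\<^sup>2"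
proof -
  define G where "G = g 1"
  define a where "a = G / \<delta>"
  define C2 where "C2 = (2 + a\<^sup>2) * (2 / \<delta>)"
  define C3 where "C3 = 3 * (23 + 7 * a\<^sup>2) / \<delta>"
  define C where "C = C2 ^ 3 * (1 + C3 ^ 3 * G ^ 4)"
  have G: "0 < G" using pos(3)[of 1] by (simp add: G_def)
  have C23: "0 \<le> C2" "0 \<le> C3" using \<delta> by (simp_all add: C2_def C3_def)
  have key: "(g t)\<^sup>2 \<le> C2 ^ 3 * P t ^ 3 * (g t * H t ^ 3)\<^sup>2 \<and> (err t)\<^sup>2 \<le> C3 * (g t)\<^sup>2 / P t \<and> g t \<le> G"
    if t1: "1 \<le> t" and Pt: "\<delta> \<le> P t" for t
  proof -
    have t: "0 < t" using t1 by simp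
    note n = n_pos[OF t] and p = pos[OF t]
    have gG: "g t \<le> G" unfolding G_def by (rule g_antimono) (use t1 in auto)
    have n3: "n3 t = g t / P t" using n by (simp add: g_def P_def)
    have n3a: "n3 t \<le> a" unfolding n3 a_def using gG p \<delta> Pt G by (intro frac_le) auto
    have S2: "(S t)\<^sup>2 = 4 * P t + (v t)\<^sup>2" by (simp add: S_def P_def v_def power2_eq_square algebra_simps)
    \<comment> \<open>Weight for the arithmetic-geometric mean on \<open>n3 * S\<close>: with
      \<open>c\<close> proportional to \<open>P\<close>, both \<open>c * n3^2\<close> and
      \<open>S^2 / c\<close> stay bounded, apart from a term \<open>v^2 / 4\<close>.\<close>
    define c where "c = 4 * P t / \<delta>"
    have c: "0 < c" using p \<delta> by (simp add: c_def)
    have "0 \<le> (c * n3 t - S t)\<^sup>2" by simp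
    then have "2 * (c * (n3 t * S t)) \<le> c * (c * (n3 t)\<^sup>2) + (S t)\<^sup>2"
      by (simp add: power2_eq_square algebra_simps del: zero_le_square)
    then have "2 * (n3 t * S t) \<le> c * (n3 t)\<^sup>2 + (S t)\<^sup>2 / c" using c by (simp add: field_simps)
    moreover have "c * (n3 t)\<^sup>2 \<le> 4 * a\<^sup>2"
    proof -
      have "c * (n3 t)\<^sup>2 = 4 * (g t)\<^sup>2 / (\<delta> * P t)" using p \<delta> by (simp add: c_def n3 field_simps power2_eq_square)
      also have "\<dots> \<le> 4 * G\<^sup>2 / (\<delta> * \<delta>)" using gG p \<delta> Pt G by (intro frac_le mult_left_mono power_mono) auto
      finally show ?thesis by (simp add: a_def power_divide power2_eq_square)
    qed
    moreover have "(S t)\<^sup>2 / c \<le> 1 + (v t)\<^sup>2 / 4"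
    proof -
      have "(S t)\<^sup>2 / c = \<delta> + \<delta> / P t * ((v t)\<^sup>2 / 4)" using p \<delta> by (simp add: S2 c_def field_simps)
      also have "\<dots> \<le> 1 + 1 * ((v t)\<^sup>2 / 4)" using p \<delta> Pt by (intro add_mono mult_right_mono) auto
      finally show ?thesis by simp
    qed
    ultimately have nS: "2 * (n3 t * S t) \<le> 4 * a\<^sup>2 + 1 + (v t)\<^sup>2 / 4" by linarith
    have "(v t)\<^sup>2 / 12 \<le> 1 - xi t" using constraint[OF t] Om_nonneg[OF t]
      zero_le_power2[of "s3 t"] zero_le_power2[of "d t"] by linarith
    moreover have "- xi t \<le> n3 t * S t / 6" by (simp add: xi_def)
    ultimately have "(v t)\<^sup>2 \<le> 12 + 2 * (n3 t * S t)" by linarith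
    \<comment> \<open>The loop closes: \<open>2 * n3 * S\<close> is bounded in terms of
      \<open>v^2 / 4\<close>, and \<open>v^2\<close> in terms of \<open>2 * n3 * S\<close>, so
      \<open>v^2\<close> returns with a coefficient below 1.\<close>
    then have v2: "(v t)\<^sup>2 \<le> 18 + 6 * a\<^sup>2" using nS zero_le_power2[of a] by linarith
    define W where "W = 1 + (P t + n3 t * S t) / 6"
    have HW: "(H t)\<^sup>2 * W = 1" using H_eq[OF t] by (simp add: W_def P_def S_def algebra_simps)
    have "W \<le> (2 + a\<^sup>2) * (1 + P t)"
    proof -
      have "0 \<le> a\<^sup>2 * P t" using p by simp
      moreover have "n3 t * S t \<le> 3 + 3 * a\<^sup>2" using nS v2 zero_le_power2[of a] by linarith
      ultimately have "W \<le> 2 + 2 * P t + a\<^sup>2 + a\<^sup>2 * P t"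
        unfolding W_def add_divide_distrib using p(2) zero_le_power2[of a] by linarith
      then show ?thesis by (simp add: algebra_simps)
    qed
    also have "\<dots> \<le> (2 + a\<^sup>2) * (2 / \<delta> * P t)"
    proof (intro mult_left_mono)
      have "\<delta> * P t \<le> P t" using p \<delta> by (intro mult_left_le_one_le) auto
      then have "\<delta> * (1 + P t) \<le> 2 * P t" using Pt by (simp add: algebra_simps)
      then show "1 + P t \<le> 2 / \<delta> * P t" using \<delta> by (simp add: field_simps)
    qed simp
    finally have W: "W \<le> C2 * P t" by (simp only: C2_def mult.assoc)
    have W0: "0 \<le> W" using p n by (simp add: W_def add_nonneg_nonneg mult_nonneg_nonneg)
    have "(g t)\<^sup>2 = (g t)\<^sup>2 * ((H t)\<^sup>2 * W) ^ 3" by (simp add: HW)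
    also have "\<dots> = W ^ 3 * (g t * H t ^ 3)\<^sup>2" by (simp add: power_mult_distrib mult_ac flip: power_mult)
    also have "\<dots> \<le> (C2 * P t) ^ 3 * (g t * H t ^ 3)\<^sup>2" using W W0 by (intro mult_right_mono power_mono) auto
    finally have 1: "(g t)\<^sup>2 \<le> C2 ^ 3 * P t ^ 3 * (g t * H t ^ 3)\<^sup>2" by (simp add: power_mult_distrib)
    have "(1 + S t + n3 t)\<^sup>2 \<le> 3 * (1 + (S t)\<^sup>2 + (n3 t)\<^sup>2)"
    proof -
      have "0 \<le> (1 - S t)\<^sup>2 + (1 - n3 t)\<^sup>2 + (S t - n3 t)\<^sup>2" by simp
      then show ?thesis by (simp add: power2_eq_square algebra_simps del: zero_le_square)
    qed
    also have "\<dots> \<le> 3 * (23 + 7 * a\<^sup>2) / \<delta> * P t"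
    proof -
      have "(n3 t)\<^sup>2 \<le> a\<^sup>2" using n3a n by (intro power_mono) auto
      then have "1 + (S t)\<^sup>2 + (n3 t)\<^sup>2 \<le> (19 + 7 * a\<^sup>2) + 4 * P t" using S2 v2 by linarith
      moreover have "19 + 7 * a\<^sup>2 \<le> (19 + 7 * a\<^sup>2) * (P t / \<delta>)"
        using mult_left_mono[of 1 "P t / \<delta>" "19 + 7 * a\<^sup>2"] Pt \<delta> by simp
      moreover have "4 * P t \<le> 4 * (P t / \<delta>)"
        using \<delta> p mult_left_le[of \<delta> "P t"] by (simp add: field_simps)
      ultimately have "1 + (S t)\<^sup>2 + (n3 t)\<^sup>2 \<le> (19 + 7 * a\<^sup>2) * (P t / \<delta>) + 4 * (P t / \<delta>)" by linarith
      also have "\<dots> = (23 + 7 * a\<^sup>2) * (P t / \<delta>)" by (simp add: algebra_simps)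
      finally have "1 + (S t)\<^sup>2 + (n3 t)\<^sup>2 \<le> (23 + 7 * a\<^sup>2) * (P t / \<delta>)" .
      then have "3 * (1 + (S t)\<^sup>2 + (n3 t)\<^sup>2) \<le> 3 * ((23 + 7 * a\<^sup>2) * (P t / \<delta>))" by (rule mult_left_mono) simp
      then show ?thesis by (simp only: times_divide_eq_right times_divide_eq_left mult.assoc)
    qed
    finally have ineq: "(n3 t)\<^sup>2 * (1 + S t + n3 t)\<^sup>2 \<le> (n3 t)\<^sup>2 * (C3 * P t)"
      unfolding C3_def by (intro mult_left_mono) auto
    have "(err t)\<^sup>2 \<le> C3 * (g t)\<^sup>2 / P t"
    proof -
      have "(n3 t)\<^sup>2 * (C3 * P t) = C3 * (g t)\<^sup>2 / P t"
        unfolding n3 using p by (simp add: power2_eq_square field_simps)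
      moreover have "(err t)\<^sup>2 = (n3 t)\<^sup>2 * (1 + S t + n3 t)\<^sup>2" by (simp only: err_def power_mult_distrib)
      ultimately show ?thesis
        using ineq by simp
    qed
    then show ?thesis using 1 gG by simp
  qed
  show ?thesis
  proof (rule that)
    show "0 \<le> C" using C23 by (simp add: C_def)
    show "err t ^ 6 \<le> C * (g t * H t ^ 3)\<^sup>2" if t1: "1 \<le> t" and Pt: "\<delta> \<le> P t" for t
    proof -
      have p: "0 < P t" "0 < g t" "0 < err t" using pos[of t] t1 by auto
      have "err t ^ 6 = ((err t)\<^sup>2) ^ 3" by (simp flip: power_mult)
      also have "\<dots> \<le> (C3 * (g t)\<^sup>2 / P t) ^ 3" using key[OF that] by (intro power_mono) auto
      also have "\<dots> = C3 ^ 3 * (g t) ^ 4 * (g t)\<^sup>2 / P t ^ 3"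
        by (simp add: power_mult_distrib power_divide flip: power_mult power_add)
      also have "\<dots> \<le> C3 ^ 3 * G ^ 4 * (C2 ^ 3 * P t ^ 3 * (g t * H t ^ 3)\<^sup>2) / P t ^ 3"
        using key[OF that] p C23 G by (intro divide_right_mono mult_mono power_mono) auto
      also have "\<dots> = C3 ^ 3 * G ^ 4 * C2 ^ 3 * (g t * H t ^ 3)\<^sup>2" using p by simp
      also have "\<dots> \<le> C * (g t * H t ^ 3)\<^sup>2"
        unfolding C_def using C23 by (intro mult_right_mono) (auto simp: algebra_simps)
      finally show ?thesis .
    qed
    show "(g t)\<^sup>2 \<le> C * (g t * H t ^ 3)\<^sup>2" if t1: "1 \<le> t" and Pt: "\<delta> \<le> P t" and P1: "P t \<le> 1" for t
    proof -
      have "(g t)\<^sup>2 \<le> C2 ^ 3 * P t ^ 3 * (g t * H t ^ 3)\<^sup>2" using key[OF t1 Pt] by simp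
      also have "\<dots> \<le> C2 ^ 3 * 1 * (g t * H t ^ 3)\<^sup>2"
        using C23 P1 Pt \<delta> by (intro mult_right_mono mult_left_mono power_le_one) auto
      also have "\<dots> \<le> C * (g t * H t ^ 3)\<^sup>2"
        unfolding C_def using C23 G by (intro mult_right_mono) (auto simp: algebra_simps)
      finally show ?thesis .
    qed
  qed
qed

lemma err_eventually_small:
  assumes \<delta>: "0 < \<delta>" "\<delta> \<le> 1" and \<eta>: "0 < \<eta>"
  shows "\<forall>\<^sub>F t in at_top. \<delta> \<le> P t \<longrightarrow> err t \<le> \<eta> \<and> (P t \<le> 1 \<longrightarrow> g t \<le> \<eta>)"
proof -
  obtain C where C: "0 \<le> C"
    "\<And>t. 1 \<le> t \<Longrightarrow> \<delta> \<le> P t \<Longrightarrow> err t ^ 6 \<le> C * (g t * H t ^ 3)\<^sup>2"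
    "\<And>t. 1 \<le> t \<Longrightarrow> \<delta> \<le> P t \<Longrightarrow> P t \<le> 1 \<Longrightarrow> (g t)\<^sup>2 \<le> C * (g t * H t ^ 3)\<^sup>2"
    by (rule pair_control[OF \<delta>]) (rule that)
  have "((\<lambda>t. C * (g t * H t ^ 3)\<^sup>2) \<longlongrightarrow> C * 0\<^sup>2) at_top"
    using vol_tendsto unfolding g_def by (intro tendsto_intros)
  then have lim: "((\<lambda>t. C * (g t * H t ^ 3)\<^sup>2) \<longlongrightarrow> 0) at_top" by simp
  have "\<forall>\<^sub>F t in at_top. C * (g t * H t ^ 3)\<^sup>2 < \<eta> ^ 6" "\<forall>\<^sub>F t in at_top. C * (g t * H t ^ 3)\<^sup>2 < \<eta>\<^sup>2"
    using \<eta> by (auto intro!: order_tendstoD(2)[OF lim])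
  then show ?thesis using eventually_ge_at_top[of 1]
  proof eventually_elim
    case (elim t)
    have "err t \<le> \<eta>" if "\<delta> \<le> P t"
    proof -
      have "err t ^ 6 < \<eta> ^ 6" using C(2)[OF elim(3) that] elim(1) by simp
      then show ?thesis using \<eta> by (intro less_imp_le) (rule power_less_imp_less_base, auto)
    qed
    moreover have "g t \<le> \<eta>" if "\<delta> \<le> P t" "P t \<le> 1"
    proof -
      have "(g t)\<^sup>2 < \<eta>\<^sup>2" using C(3)[OF elim(3) that] elim(2) by simp
      then show ?thesis using \<eta> by (intro less_imp_le) (rule power_less_imp_less_base, auto)
    qed
    ultimately show ?case by blast
  qed
qed

lemma E_antimono:
  assumes "a \<le> b" "\<And>t. a \<le> t \<Longrightarrow> t \<le> b \<Longrightarrow> small t"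
  shows "E b \<le> E a"
proof (rule nonincreasing_if_deriv_nonpos[OF assms(1)])
  fix t assume t: "a \<le> t" "t \<le> b"
  have s: "small t" using assms(2) t by blast
  show "(E has_real_derivative H t * E_rate t) (at t)" by (rule D_E[OF small_pos[OF s]])
  have "E_rate t \<le> 0"
    using E_rate_le[OF s] E_pos[OF small_pos[OF s]] mu_pos
    by (smt (verit) divide_nonneg_nonneg mult_minus_left mult_nonneg_nonneg)
  then show "H t * E_rate t \<le> 0" using H_pos[OF small_pos[OF s]] by (intro mult_nonneg_nonpos) auto
qed

lemma M_bound:
  assumes "a \<le> b" "\<And>t. a \<le> t \<Longrightarrow> t \<le> b \<Longrightarrow> small t \<and> \<delta> \<le> P t" "0 < \<delta>" "\<delta> \<le> 1"
  shows "M b \<le> M a * exp (K (4 / (1 - \<mu>)) \<delta> * E a)"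
proof -
  define k where "k = K (4 / (1 - \<mu>)) \<delta>"
  have k: "0 \<le> k" using mu_pos mu_less assms by (simp add: k_def K_def)
  have sb: "small b" "small a" using assms by auto
  have M0: "0 \<le> M t" if "0 < t" for t using Om_nonneg[OF that] by (simp add: M_def)
  have "M b * 1 \<le> M b * exp (k * E b)"
    using k E_pos[OF small_pos[OF sb(1)]] M0[OF small_pos[OF sb(1)]] by (intro mult_left_mono) auto
  also have "\<dots> \<le> M a * exp (k * E a)"
  proof (rule nonincreasing_if_deriv_nonpos[OF assms(1)])
    fix t assume t: "a \<le> t" "t \<le> b"
    have s: "small t" "\<delta> \<le> P t" using assms(2) t by blast+
    note t0 = small_pos[OF s(1)]
    show "((\<lambda>t. M t * exp (k * E t)) has_real_derivative
        H t * (M t * exp (k * E t) * (M_rate t + k * E_rate t))) (at t)"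
      by (rule derivative_eq_intros D_M D_E refl s t0 | simp add: algebra_simps)+
    have "M_rate t + k * E_rate t \<le> 0"
      unfolding k_def using M_rate_le[OF s(1)] mu_less by (intro absorb[OF s assms(3,4)]) auto
    then show "H t * (M t * exp (k * E t) * (M_rate t + k * E_rate t)) \<le> 0"
      using H_pos[OF t0] M0[OF t0] by (intro mult_nonneg_nonpos mult_nonneg_nonneg) auto
  qed
  finally show ?thesis by (simp add: k_def)
qed

lemma Om_le_M:
  assumes "small t"
  shows "Om t * exp (\<mu> * ln (P t)) \<le> M t * exp (2 * (1 + \<mu>) * ln 3)"
proof -
  have l: "0 < l t" "l t \<le> 3" using l_bounds[OF assms] mu_less by auto
  have "exp (\<mu> * ln (P t)) = exp (\<mu> * ln (P t) - 2 * (1 + \<mu>) * ln (l t)) * exp (2 * (1 + \<mu>) * ln (l t))"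
    by (simp flip: exp_add)
  also have "\<dots> \<le> exp (\<mu> * ln (P t) - 2 * (1 + \<mu>) * ln (l t)) * exp (2 * (1 + \<mu>) * ln 3)"
    using l mu_pos by (intro mult_left_mono) auto
  finally have "Om t * exp (\<mu> * ln (P t)) \<le> Om t * (exp (\<mu> * ln (P t) - 2 * (1 + \<mu>) * ln (l t)) * exp (2 * (1 + \<mu>) * ln 3))"
    using Om_nonneg[OF small_pos[OF assms]] by (rule mult_left_mono)
  then show ?thesis by (simp add: M_def mult_ac)
qed

lemma M_le:
  assumes "small t"
  shows "M t \<le> 2 * exp (\<mu> * ln (P t)) * exp (- 2 * (1 + \<mu>) * ln ((1 - \<mu>) / 2))"
proof -
  have l: "0 < (1 - \<mu>) / 2" "(1 - \<mu>) / 2 \<le> l t" using l_bounds[OF assms] mu_less by auto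
  have "ln ((1 - \<mu>) / 2) \<le> ln (l t)" using l by simp
  then have "2 * (1 + \<mu>) * ln ((1 - \<mu>) / 2) \<le> 2 * (1 + \<mu>) * ln (l t)" using mu_pos by (intro mult_left_mono) auto
  then have "exp (\<mu> * ln (P t) - 2 * (1 + \<mu>) * ln (l t)) \<le> exp (\<mu> * ln (P t) + - 2 * (1 + \<mu>) * ln ((1 - \<mu>) / 2))"
    unfolding exp_le_cancel_iff by linarith
  then have "M t \<le> 2 * exp (\<mu> * ln (P t) + - 2 * (1 + \<mu>) * ln ((1 - \<mu>) / 2))"
    unfolding M_def using bounds(6)[OF assms] Om_nonneg[OF small_pos[OF assms]] by (intro mult_mono) auto
  then show ?thesis by (simp only: exp_add mult.assoc)
qed

lemma Psi_Om_E_nonincreasing: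
  assumes "small t" "\<delta> \<le> P t" "0 < \<delta>" "\<delta> \<le> 1" "\<bar>phi t\<bar> \<le> \<Lambda>" "lam = 4 + 2 * \<Lambda>"
    "Om t \<le> (2 - 2 * \<mu>) / (32 * lam)"
  obtains D where "((\<lambda>t. Psi t + lam * Om t + K (2 * (1 + \<Lambda>)) \<delta> * E t) has_real_derivative D) (at t)" "D \<le> 0"
proof -
  note t = small_pos[OF assms(1)]
  define D where "D = H t * (Psi_rate t + lam * (Om t * (4 * \<mu> - 2 * q t)) + K (2 * (1 + \<Lambda>)) \<delta> * E_rate t)"
  have "((\<lambda>t. Psi t + lam * Om t + K (2 * (1 + \<Lambda>)) \<delta> * E t) has_real_derivative D) (at t)"
    unfolding D_def by (rule derivative_eq_intros D_Psi D_Om D_E refl t | simp add: algebra_simps)+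
  moreover have "Psi_rate t + lam * (Om t * (4 * \<mu> - 2 * q t)) + K (2 * (1 + \<Lambda>)) \<delta> * E_rate t \<le> 0"
    using Psi_Om_rate_le[OF assms(1,5,6,7)] assms(5) by (intro absorb[OF assms(1-4)]) auto
  then have "D \<le> 0" unfolding D_def using H_pos[OF t] by (intro mult_nonneg_nonpos) auto
  ultimately show ?thesis by (rule that)
qed

section \<open>The alternative between vanishing and persistent pair products\<close>

text \<open>\<open>C * exp (- 2 * \<mu> * N)\<close> will bound the matter density once
  \<open>P\<close> has passed the level \<open>exp (- 2 * N)\<close>; the right-hand side is the
  smallness required by \<open>Psi_Om_rate_le\<close> for \<open>lam = 8 + 2 * N\<close>. The
  exponential beats the linear growth of \<open>lam\<close>.\<close>

lemma exponent_choice: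
  fixes C B :: real
  assumes "0 < C"
  obtains N where "0 < N" "C * exp (- 2 * \<mu> * N) \<le> (2 - 2 * \<mu>) / (32 * (8 + 2 * N))" "- N \<le> B"
proof -
  have "((\<lambda>N. (8 + 2 * N) * exp (- 2 * \<mu> * N)) \<longlongrightarrow> 0) at_top" using mu_pos by real_asymp
  then have "((\<lambda>N. C * ((8 + 2 * N) * exp (- 2 * \<mu> * N))) \<longlongrightarrow> C * 0) at_top" by (intro tendsto_intros)
  then have "\<forall>\<^sub>F N in at_top. C * ((8 + 2 * N) * exp (- 2 * \<mu> * N)) < (2 - 2 * \<mu>) / 32"
    using mu_less by (intro order_tendstoD(2)[where y = "C * 0"]) auto
  moreover have "\<forall>\<^sub>F N in at_top. 0 < N \<and> - N \<le> B"
    using eventually_gt_at_top[of 0] eventually_ge_at_top[of "- B"] by eventually_elim auto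
  ultimately have "\<forall>\<^sub>F N in at_top. C * ((8 + 2 * N) * exp (- 2 * \<mu> * N)) < (2 - 2 * \<mu>) / 32 \<and> 0 < N \<and> - N \<le> B"
    by eventually_elim auto
  then obtain N where N: "C * ((8 + 2 * N) * exp (- 2 * \<mu> * N)) < (2 - 2 * \<mu>) / 32" "0 < N" "- N \<le> B"
    using eventually_happens'[OF trivial_limit_at_top_linorder] by blast
  show ?thesis
  proof (rule that[OF N(2) _ N(3)])
    have "C * exp (- 2 * \<mu> * N) * (8 + 2 * N) \<le> (2 - 2 * \<mu>) / 32" using N(1) by (simp add: mult_ac)
    then have "C * exp (- 2 * \<mu> * N) \<le> (2 - 2 * \<mu>) / 32 / (8 + 2 * N)" using N(2) by (subst pos_le_divide_eq) auto
    then show "C * exp (- 2 * \<mu> * N) \<le> (2 - 2 * \<mu>) / (32 * (8 + 2 * N))" by simp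
  qed
qed

lemma P_cont: "0 < a \<Longrightarrow> continuous_on {a..b} P"
  by (rule continuous_if_deriv[of a P "\<lambda>t. H t * (P t * (2 * s3 t - 2 * q t))"]) (rule D_P, simp)

text \<open>Suppose \<open>P\<close> climbs from \<open>\<delta>^2\<close> over
  \<open>\<delta>\<close> to \<open>\<epsilon>\<close>, where
  \<open>\<delta> = exp (- 2 * N)\<close> and \<open>\<delta>^2\<close> is the witness. The stretch
  up to \<open>\<delta>\<close> makes the matter density tiny by means of \<open>M\<close>. After
  that, \<open>Psi + lam * Om + k2 * E\<close> cannot increase, yet it is at most
  \<open>- N + 4\<close> at the level \<open>\<delta>\<close> and at least
  \<open>ln \<epsilon> - 2 / sqrt \<epsilon>\<close> at the end, a contradiction for large
  \<open>N\<close>.\<close>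

lemma no_growth:
  assumes \<epsilon>: "0 < \<epsilon>" "\<epsilon> \<le> 1"
  obtains \<delta> T where "0 < \<delta>" "1 \<le> T" "\<And>s t. T \<le> s \<Longrightarrow> s \<le> t \<Longrightarrow> P s \<le> \<delta> \<Longrightarrow> P t < \<epsilon>"
proof -
  define CM where "CM = 6 * exp (- 2 * (1 + \<mu>) * ln ((1 - \<mu>) / 2)) * exp (2 * (1 + \<mu>) * ln 3)"
  \<comment> \<open>The subtracted 5 exceeds the 4 in the bound \<open>- N + 4\<close> for the
    starting value.\<close>
  define B where "B = ln \<epsilon> - 2 / sqrt \<epsilon> - 5"
  have CM: "0 < CM" by (simp add: CM_def)
  obtain N where N: "0 < N" "CM * exp (- 2 * \<mu> * N) \<le> (2 - 2 * \<mu>) / (32 * (8 + 2 * N))" "- N \<le> B"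
    by (rule exponent_choice[OF CM]) (rule that)
  define \<delta> where "\<delta> = exp (- 2 * N)"
  have \<delta>: "0 < \<delta>" "\<delta> < 1" "ln \<delta> = - 2 * N" "ln (\<delta>\<^sup>2) = - 4 * N"
    using N(1) by (simp_all add: \<delta>_def ln_realpow)
  have \<delta>2: "0 < \<delta>\<^sup>2" "\<delta>\<^sup>2 \<le> 1" "\<delta>\<^sup>2 \<le> \<delta>"
    using \<delta>(1,2) by (simp_all add: power_le_one power2_eq_square mult_left_le mult_le_one)
  have \<delta>\<epsilon>: "\<delta> < \<epsilon>"
  proof -
    have "ln \<delta> < ln \<epsilon>" using N(1,3) \<epsilon> real_sqrt_gt_zero[OF \<epsilon>(1)] unfolding \<delta>(3) B_def
      by (smt (verit) divide_nonneg_nonneg)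
    then show ?thesis using \<delta>(1) \<epsilon>(1) by (simp add: ln_less_cancel_iff)
  qed
  define k1 where "k1 = K (4 / (1 - \<mu>)) (\<delta>\<^sup>2)"
  \<comment> \<open>Bound for \<open>phi\<close> above the level \<open>\<delta>\<close>. It is
    linear in \<open>N\<close> thanks to the logarithmic estimate, and
    \<open>4 + 2 * \<Lambda>\<close> is the \<open>8 + 2 * N\<close> of
    \<open>exponent_choice\<close>.\<close>
  define \<Lambda> where "\<Lambda> = N + 2"
  define k2 where "k2 = K (2 * (1 + \<Lambda>)) \<delta>"
  have k: "0 \<le> k1" "0 \<le> k2" using mu_pos mu_less \<delta> N by (auto simp: k1_def k2_def K_def \<Lambda>_def)
  define \<eta> where "\<eta> = min (\<mu> * (1 - \<mu>) / 24) (1 / (k1 + k2 + 1) / 2)"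
  have \<eta>: "0 < \<eta>" using mu_pos mu_less k by (simp add: \<eta>_def)
  have "\<forall>\<^sub>F t in at_top. (\<delta>\<^sup>2 \<le> P t \<longrightarrow> err t \<le> \<eta> \<and> (P t \<le> 1 \<longrightarrow> g t \<le> \<eta>)) \<and> 1 \<le> t"
    using err_eventually_small[OF \<delta>2(1,2) \<eta>] eventually_ge_at_top[of 1] by eventually_elim auto
  then obtain T where T: "\<And>t. T \<le> t \<Longrightarrow> (\<delta>\<^sup>2 \<le> P t \<longrightarrow> err t \<le> \<eta> \<and> (P t \<le> 1 \<longrightarrow> g t \<le> \<eta>)) \<and> 1 \<le> t"
    unfolding eventually_at_top_linorder by blast
  have sm: "small t" if "T \<le> t" "\<delta>\<^sup>2 \<le> P t" for t
    using T[OF that(1)] that(2) by (auto simp: small_def \<eta>_def)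
  have phi_le: "\<bar>phi t\<bar> \<le> \<bar>v t\<bar> / (2 * sqrt (P t))" if "0 < t" for t
    using half_log_ratio_le(2)[OF n_pos(1,2)[OF that]] by (simp add: phi_def v_def P_def)
  have phi_\<Lambda>: "\<bar>phi t\<bar> \<le> \<Lambda>" if "T \<le> t" "\<delta> \<le> P t" for t
  proof -
    have s: "small t" using that \<delta>2 by (intro sm) auto
    have "\<bar>phi t\<bar> \<le> ln (1 + \<bar>v t\<bar> / sqrt (P t))"
      using half_log_ratio_le(1)[OF n_pos(1,2)[OF small_pos[OF s]]] by (simp add: phi_def v_def P_def)
    also have "\<dots> \<le> ln (exp (N + 2))"
    proof (subst ln_le_cancel_iff)
      have "sqrt \<delta> = exp (- N)"
        unfolding \<delta>_def by (rule real_sqrt_unique) (simp_all flip: exp_of_nat_mult)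
      then have sq: "exp (- N) \<le> sqrt (P t)" using that(2) by (metis real_sqrt_le_mono)
      have "\<bar>v t\<bar> / sqrt (P t) \<le> 4 / exp (- N)"
        using bounds(2)[OF s] sq by (intro frac_le) auto
      also have "\<dots> = 4 * exp N" by (simp add: exp_minus field_simps)
      finally have "1 + \<bar>v t\<bar> / sqrt (P t) \<le> 5 * exp N" using N(1) one_le_exp_iff[of N] by linarith
      also have "\<dots> \<le> exp 2 * exp N"
      proof (intro mult_right_mono)
        have "(1 + 1 + 1\<^sup>2 / 2) \<le> exp (1::real)" using exp_lower_Taylor_quadratic[of 1] by simp
        then have "(5 / 2) * (5 / 2) \<le> exp (1::real) * exp 1" by (intro mult_mono) auto
        then show "5 \<le> exp (2::real)" by (simp flip: exp_add)
      qed simp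
      finally show "1 + \<bar>v t\<bar> / sqrt (P t) \<le> exp (N + 2)" by (simp add: exp_add mult.commute)
      show "0 < 1 + \<bar>v t\<bar> / sqrt (P t)" using pos(2)[OF small_pos[OF s]] by (intro add_pos_nonneg) auto
    qed simp
    finally show ?thesis by (simp add: \<Lambda>_def)
  qed
  have "P t < \<epsilon>" if s: "T \<le> s" "s \<le> t" "P s \<le> \<delta>\<^sup>2" for s t
  proof (rule ccontr)
    assume "\<not> P t < \<epsilon>"
    then have Pt: "\<epsilon> \<le> P t" by simp
    have s0: "0 < s" using T[OF s(1)] by auto
    \<comment> \<open>Last passages ensure that \<open>P\<close> stays above
      \<open>\<delta>^2\<close> after \<open>a\<close> and above \<open>\<delta>\<close> after
      \<open>c\<close>.\<close>
    obtain a where a: "s \<le> a" "a \<le> t" "P a = \<delta>\<^sup>2" "\<And>u. a \<le> u \<Longrightarrow> u \<le> t \<Longrightarrow> \<delta>\<^sup>2 \<le> P u"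
      by (rule last_passage[OF s(2) P_cont[OF s0] s(3)]) (use Pt \<delta>2 \<delta>\<epsilon> that in auto)
    have a0: "0 < a" using a s0 by simp
    obtain c where c: "a \<le> c" "c \<le> t" "P c = \<delta>" "\<And>u. c \<le> u \<Longrightarrow> u \<le> t \<Longrightarrow> \<delta> \<le> P u"
      by (rule last_passage[OF a(2) P_cont[OF a0], of \<delta>]) (use Pt \<delta>2 \<delta>\<epsilon> a that in auto)
    have sma: "small u" if "a \<le> u" "u \<le> t" for u using sm a(1,4) s that by auto
    have ga: "g a \<le> \<eta>" using T[of a] a s \<delta>2 by auto
    have Ea: "k1 * E a \<le> 1" "k2 * E a \<le> 1"
    proof -
      have two_halves: "2 * (y / 2) = y" for y :: real by simp
      have "E a \<le> 2 * \<eta>" using E_g(2)[OF sma[of a]] a ga by auto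
      also have "\<dots> \<le> 2 * (1 / (k1 + k2 + 1) / 2)" by (intro mult_left_mono) (auto simp: \<eta>_def)
      also have "\<dots> = 1 / (k1 + k2 + 1)" by (rule two_halves)
      finally have "E a * (k1 + k2 + 1) \<le> 1" using k by (simp add: field_simps)
      moreover have "0 \<le> E a * k1" "0 \<le> E a * k2" "0 \<le> E a" using E_pos[OF a0] k by auto
      ultimately show "k1 * E a \<le> 1" "k2 * E a \<le> 1" by (simp_all add: algebra_simps)
    qed
    \<comment> \<open>\<open>M\<close> is comparable to \<open>Om * P powr \<mu>\<close> and almost
      nonincreasing. Going from \<open>P a = \<delta>^2\<close> to \<open>P u \<ge> \<delta>\<close>
      therefore yields the factor
      \<open>(\<delta>^2 / \<delta>) powr \<mu> = exp (- 2 * \<mu> * N)\<close>.\<close>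
    have Om_small: "Om u \<le> CM * exp (- 2 * \<mu> * N)" if u: "c \<le> u" "u \<le> t" for u
    proof -
      have su: "small u" and sa: "small a" using sma u c a by auto
      have "Om u * exp (- 2 * \<mu> * N) \<le> Om u * exp (\<mu> * ln (P u))"
      proof -
        have "ln \<delta> \<le> ln (P u)" using c(4)[OF u] \<delta>(1) by (intro ln_mono) auto
        then have "\<mu> * (- 2 * N) \<le> \<mu> * ln (P u)" unfolding \<delta>(3) using mu_pos by (intro mult_left_mono) auto
        then show ?thesis using Om_nonneg[OF small_pos[OF su]] by (intro mult_left_mono) auto
      qed
      also have "\<dots> \<le> M u * exp (2 * (1 + \<mu>) * ln 3)" by (rule Om_le_M[OF su])
      also have "\<dots> \<le> (M a * exp (k1 * E a)) * exp (2 * (1 + \<mu>) * ln 3)"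
        unfolding k1_def using u c a sma \<delta>2 by (intro mult_right_mono M_bound) auto
      also have "\<dots> \<le> (M a * 3) * exp (2 * (1 + \<mu>) * ln 3)"
      proof (intro mult_right_mono mult_left_mono)
        have "exp (k1 * E a) \<le> exp 1" using Ea by simp
        then show "exp (k1 * E a) \<le> 3" using exp_le by linarith
        show "0 \<le> M a" using Om_nonneg[OF a0] by (simp add: M_def)
      qed simp
      also have "\<dots> \<le> (2 * exp (\<mu> * ln (P a)) * exp (- 2 * (1 + \<mu>) * ln ((1 - \<mu>) / 2)) * 3) * exp (2 * (1 + \<mu>) * ln 3)"
        using M_le[OF sa] by (intro mult_right_mono) auto
      also have "\<dots> = CM * exp (\<mu> * ln (\<delta>\<^sup>2))" by (simp add: CM_def a(3))
      also have "\<dots> = (CM * exp (- 2 * \<mu> * N)) * exp (- 2 * \<mu> * N)"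
        unfolding \<delta>(4) by (simp flip: exp_add add: mult_ac)
      finally show ?thesis by simp
    qed
    define f where "f = (\<lambda>t. Psi t + (8 + 2 * N) * Om t + k2 * E t)"
    have "f t \<le> f c"
    proof (rule DERIV_nonpos_imp_nonincreasing[OF c(2)])
      fix u assume u: "c \<le> u" "u \<le> t"
      have su: "small u" using sma u c by auto
      obtain D where "((\<lambda>t. Psi t + (8 + 2 * N) * Om t + K (2 * (1 + \<Lambda>)) \<delta> * E t) has_real_derivative D) (at u)" "D \<le> 0"
      proof (rule Psi_Om_E_nonincreasing[OF su c(4)[OF u] \<delta>(1)])
        show "\<delta> \<le> 1" using \<delta> by simp
        show "\<bar>phi u\<bar> \<le> \<Lambda>" using u c a s \<delta> by (intro phi_\<Lambda>) auto
        show "8 + 2 * N = 4 + 2 * \<Lambda>" by (simp add: \<Lambda>_def)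
        show "Om u \<le> (2 - 2 * \<mu>) / (32 * (8 + 2 * N))" using Om_small[OF u] N(2) by simp
      qed (rule that)
      then show "\<exists>y. (f has_real_derivative y) (at u) \<and> y \<le> 0" unfolding f_def k2_def by blast
    qed
    moreover have "ln \<epsilon> - 2 / sqrt \<epsilon> \<le> f t"
    proof -
      have st: "small t" using sma a by auto
      note t0 = small_pos[OF st]
      have "\<bar>phi t\<bar> \<le> \<bar>v t\<bar> / (2 * sqrt (P t))" by (rule phi_le[OF t0])
      also have "\<dots> \<le> (18 / 5) / (2 * sqrt \<epsilon>)" using bounds(2)[OF st] Pt \<epsilon> by (intro frac_le) auto
      finally have "\<bar>d t\<bar> * \<bar>phi t\<bar> \<le> (18 / 5) * ((18 / 5) / (2 * sqrt \<epsilon>))"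
        using bounds(1)[OF st] by (intro mult_mono) auto
      then have "d t * phi t / 6 \<le> (18 / 5) * ((18 / 5) / (2 * sqrt \<epsilon>)) / 6"
        using abs_ge_self[of "d t * phi t"] by (simp add: abs_mult)
      also have "\<dots> \<le> 2 / sqrt \<epsilon>" using \<epsilon> by (simp add: field_simps)
      finally have "d t * phi t / 6 \<le> 2 / sqrt \<epsilon>" .
      moreover have "ln \<epsilon> \<le> ln (P t)" using Pt \<epsilon> by (intro ln_mono) auto
      moreover have "0 \<le> (8 + 2 * N) * Om t" "0 \<le> k2 * E t"
        using Om_nonneg[OF t0] N k E_pos[OF t0] by auto
      ultimately show ?thesis unfolding f_def Psi_def by linarith
    qed
    \<comment> \<open>\<open>ln (P c)\<close> is \<open>- 2 * N\<close>, and the virial correction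
      costs only \<open>3 / 5 * N\<close> because \<open>\<bar>d\<bar> \<le> 18 / 5\<close>.\<close>
    moreover have "f c \<le> - N + 4"
    proof -
      have sc: "small c" using sma c by auto
      have "\<bar>d c\<bar> * \<bar>phi c\<bar> \<le> (18 / 5) * \<Lambda>"
        using bounds(1)[OF sc] phi_\<Lambda>[of c] c a s by (intro mult_mono) auto
      then have "- (d c * phi c / 6) \<le> 3 / 5 * N + 6 / 5"
        using abs_ge_minus_self[of "d c * phi c"] by (simp add: abs_mult \<Lambda>_def)
      moreover have "(8 + 2 * N) * Om c \<le> 1"
      proof -
        have "Om c \<le> (2 - 2 * \<mu>) / (32 * (8 + 2 * N))" using Om_small[of c] c N(2) by simp
        then have "(8 + 2 * N) * Om c \<le> (2 - 2 * \<mu>) / 32" using N by (simp add: field_simps)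
        then show ?thesis using mu_pos by simp
      qed
      moreover have "k2 * E c \<le> 1"
      proof -
        have "E c \<le> E a" using c sma by (intro E_antimono) auto
        then show ?thesis using Ea(2) k mult_left_mono[of "E c" "E a" k2] by simp
      qed
      moreover have "ln (P c) = - 2 * N" using c(3) \<delta>(3) by simp
      ultimately show ?thesis unfolding f_def Psi_def using N(1) by linarith
    qed
    ultimately show False using N(3) by (simp add: B_def)
  qed
  then show ?thesis using that[of "\<delta>\<^sup>2" T] \<delta>2 T[of T] by blast
qed

lemma pair_dichotomy: "(P \<longlongrightarrow> 0) at_top \<or> (\<exists>\<delta>>0. \<forall>\<^sub>F t in at_top. \<delta> \<le> P t)"
proof (rule disjCI)
  assume n: "\<not> (\<exists>\<delta>>0. \<forall>\<^sub>F t in at_top. \<delta> \<le> P t)"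
  show "(P \<longlongrightarrow> 0) at_top"
  proof (rule tendstoI)
    fix e :: real assume "0 < e"
    then have e: "0 < min e 1" "min e 1 \<le> 1" by auto
    obtain \<delta> T where T: "0 < \<delta>" "1 \<le> T" "\<And>s t. T \<le> s \<Longrightarrow> s \<le> t \<Longrightarrow> P s \<le> \<delta> \<Longrightarrow> P t < min e 1"
      by (rule no_growth[OF e]) (rule that)
    obtain s where s: "T \<le> s" "P s \<le> \<delta>"
      using n T(1) unfolding eventually_at_top_linorder by (meson linear)
    have "dist (P t) 0 < e" if "s \<le> t" for t
      using T(3)[OF s(1) that s(2)] pos(2)[of t] T(2) s(1) that by (simp add: dist_real_def)
    then show "\<forall>\<^sub>F t in at_top. dist (P t) 0 < e" unfolding eventually_at_top_linorder by blast
  qed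
qed

end

section \<open>Pairs bounded below: the Taub points\<close>

lemma nonincreasing_tendsto:
  fixes f :: "real \<Rightarrow> real"
  assumes mono: "\<And>s t. T \<le> s \<Longrightarrow> s \<le> t \<Longrightarrow> f t \<le> f s" and bd: "\<And>t. T \<le> t \<Longrightarrow> b \<le> f t"
  obtains L where "(f \<longlongrightarrow> L) at_top"
proof
  have bdd: "bdd_below (f ` {T..})" using bd by (intro bdd_belowI[of _ b]) auto
  show "(f \<longlongrightarrow> (INF t\<in>{T..}. f t)) at_top"
  proof (rule decreasing_tendsto)
    show "\<forall>\<^sub>F t in at_top. (INF t\<in>{T..}. f t) \<le> f t"
      using eventually_ge_at_top[of T] by eventually_elim (rule cINF_lower[OF bdd], simp)
    fix y assume "(INF t\<in>{T..}. f t) < y"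
    then obtain s where s: "T \<le> s" "f s < y" using cINF_less_iff[OF _ bdd, of y] by auto
    show "\<forall>\<^sub>F t in at_top. f t < y"
      using eventually_ge_at_top[of s] by eventually_elim (use s mono le_less_trans in blast)
  qed
qed

context bianchi
begin

lemma x_le_Om: "0 < t \<Longrightarrow> ((d t)\<^sup>2 + (v t)\<^sup>2) / 12 + xi t \<le> 2 * x t"
  using x_eq[of t] Om_nonneg[of t] zero_le_power2[of "x t"] by linarith

lemma phi_abs: "0 < t \<Longrightarrow> \<bar>phi t\<bar> \<le> \<bar>v t\<bar> / (2 * sqrt (P t))"
  using half_log_ratio_le(2)[OF n_pos(1,2), of t] by (simp add: phi_def v_def P_def)

text \<open>Where \<open>P\<close> is large, the bound on \<open>M\<close> makes \<open>Om\<close>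
  small and \<open>phi\<close> is at most 2, so \<open>Psi + 8 * Om + k * E\<close> cannot increase
  there. Since large values of this function force \<open>P\<close> to be large, it is trapped below
  a level, and \<open>P\<close> with it.\<close>

lemma P_bounded:
  assumes T: "\<And>t. T \<le> t \<Longrightarrow> small t \<and> \<delta> \<le> P t" and \<delta>: "0 < \<delta>" "\<delta> \<le> 1"
  obtains B where "\<And>t. T \<le> t \<Longrightarrow> P t \<le> B"
proof -
  define c where "c = exp (2 * (1 + \<mu>) * ln 3)"
  define m where "m = M T * exp (K (4 / (1 - \<mu>)) \<delta> * E T) * c"
  \<comment> \<open>The smallness of \<open>Om\<close> that \<open>Psi_Om_rate_le\<close> requires
    for \<open>\<Lambda> = 2\<close>, where \<open>lam = 8\<close>.\<close>
  define w where "w = (2 - 2 * \<mu>) / (32 * 8)"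
  have w: "0 < w" using mu_less by (simp add: w_def)
  have m0: "0 \<le> m" using T[of T] Om_nonneg[OF small_pos] by (simp add: m_def M_def c_def)
  define k where "k = K (2 * (1 + 2)) \<delta>"
  have k: "0 \<le> k" using mu_pos \<delta> by (simp add: k_def K_def)
  \<comment> \<open>For \<open>P \<ge> B\<close> the quantity \<open>w * P powr \<mu>\<close>
    exceeds the bound \<open>m\<close> of \<open>Om * P powr \<mu>\<close>.\<close>
  define B where "B = max 1 (exp (ln ((m + 1) / w) / \<mu>))"
  have B1: "1 \<le> B" by (simp add: B_def)
  have Om_w: "Om t \<le> w" if t: "T \<le> t" "B \<le> P t" for t
  proof -
    have s: "small t" using T t by blast
    have "m + 1 = w * exp (\<mu> * (ln ((m + 1) / w) / \<mu>))" using mu_pos w m0 by simp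
    also have "\<dots> \<le> w * exp (\<mu> * ln (P t))"
    proof -
      have "exp (ln ((m + 1) / w) / \<mu>) \<le> P t" using t by (simp add: B_def)
      then have "ln ((m + 1) / w) / \<mu> \<le> ln (P t)" using pos(2)[OF small_pos[OF s]] by (simp add: ln_ge_iff)
      then have "\<mu> * (ln ((m + 1) / w) / \<mu>) \<le> \<mu> * ln (P t)" using mu_pos by (intro mult_left_mono) auto
      then have "exp (\<mu> * (ln ((m + 1) / w) / \<mu>)) \<le> exp (\<mu> * ln (P t))" by (simp only: exp_le_cancel_iff)
      then show ?thesis by (rule mult_left_mono) (use w in simp)
    qed
    finally have 1: "m + 1 \<le> w * exp (\<mu> * ln (P t))" .
    have "Om t * exp (\<mu> * ln (P t)) \<le> M t * c" unfolding c_def by (rule Om_le_M[OF s])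
    also have "\<dots> \<le> m" unfolding m_def using T t \<delta> by (intro mult_right_mono M_bound) (auto simp: c_def)
    finally have "Om t * exp (\<mu> * ln (P t)) \<le> w * exp (\<mu> * ln (P t))" using 1 by linarith
    then show ?thesis by simp
  qed
  have ET: "E t \<le> E T" if "T \<le> t" for t using E_antimono[OF that] T by blast
  have dphi: "\<bar>d t * phi t\<bar> / 6 \<le> 3 / sqrt \<delta>" if "T \<le> t" for t
  proof -
    have s: "small t" and P: "\<delta> \<le> P t" using T that by auto
    have "\<bar>phi t\<bar> \<le> \<bar>v t\<bar> / (2 * sqrt (P t))" by (rule phi_abs[OF small_pos[OF s]])
    also have "\<dots> \<le> (18 / 5) / (2 * sqrt \<delta>)" using bounds(2)[OF s] P \<delta> by (intro frac_le) auto
    finally have "\<bar>d t\<bar> * \<bar>phi t\<bar> \<le> (18 / 5) * ((18 / 5) / (2 * sqrt \<delta>))"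
      using bounds(1)[OF s] by (intro mult_mono) auto
    then have "\<bar>d t * phi t\<bar> / 6 \<le> (18 / 5) * ((18 / 5) / (2 * sqrt \<delta>)) / 6" by (simp add: abs_mult)
    also have "\<dots> \<le> 3 / sqrt \<delta>" using \<delta> by (simp add: field_simps)
    finally show ?thesis .
  qed
  define f where "f t = Psi t + 8 * Om t + k * E t" for t
  define f' where "f' t = H t * (Psi_rate t + 8 * (Om t * (4 * \<mu> - 2 * q t)) + k * E_rate t)" for t
  define y where "y = max (f T) (ln B + 3 / sqrt \<delta> + 9 + k * E T)"
  have fy: "f t \<le> y" if "T \<le> t" for t
  proof (rule stays_below_band[where f = f and T = T and z = "y + 1"])
    show "(f has_real_derivative f' t) (at t)" if "T \<le> t" for t
      unfolding f_def[abs_def] f'_def using T[OF that] small_pos[of t]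
      by (auto intro!: derivative_eq_intros D_Psi D_Om D_E simp: algebra_simps)
    show "f T \<le> y" by (simp add: y_def)
    show "y < y + 1" by simp
    show "f' t \<le> 0" if t: "T \<le> t" "y \<le> f t" for t
    proof -
      have s: "small t" and P: "\<delta> \<le> P t" using T t by auto
      note t0 = small_pos[OF s]
      have "B \<le> P t"
      proof (rule ccontr)
        assume "\<not> B \<le> P t"
        then have "ln (P t) < ln B" using pos(2)[OF t0] by simp
        moreover have "- (d t * phi t / 6) \<le> 3 / sqrt \<delta>" using dphi[OF t(1)] by (simp add: abs_le_iff)
        moreover have "k * E t \<le> k * E T" using ET[OF t(1)] k by (rule mult_left_mono)
        moreover have "8 * Om t \<le> 9" using bounds(6)[OF s] by simp
        ultimately have "f t < ln B + 3 / sqrt \<delta> + 9 + k * E T" unfolding f_def Psi_def by linarith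
        then show False using t(2) by (simp add: y_def)
      qed
      then have P1: "1 \<le> P t" and O: "Om t \<le> w" using B1 Om_w t by auto
      have "\<bar>phi t\<bar> \<le> \<bar>v t\<bar> / (2 * sqrt (P t))" by (rule phi_abs[OF t0])
      also have "\<dots> \<le> (18 / 5) / (2 * 1)" using bounds(2)[OF s] P1 by (intro frac_le) auto
      finally have "\<bar>phi t\<bar> \<le> 2" by simp
      then have "Psi_rate t + 8 * (Om t * (4 * \<mu> - 2 * q t)) \<le> 2 * (1 + 2) * err t"
        using O by (intro Psi_Om_rate_le[OF s]) (auto simp: w_def)
      then have "Psi_rate t + 8 * (Om t * (4 * \<mu> - 2 * q t)) + k * E_rate t \<le> 0"
        unfolding k_def by (intro absorb[OF s P \<delta>]) auto
      then show ?thesis unfolding f'_def using H_pos[OF t0] by (intro mult_nonneg_nonpos) auto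
    qed
  qed fact
  have "P t \<le> exp (y + 3 / sqrt \<delta>)" if t: "T \<le> t" for t
  proof -
    have s: "small t" using T t by auto
    note t0 = small_pos[OF s]
    have "0 \<le> k * E t" using k E_pos[OF t0] by simp
    then have "ln (P t) \<le> y + 3 / sqrt \<delta>"
      using fy[OF t] dphi[OF t] Om_nonneg[OF t0] abs_ge_self[of "d t * phi t"]
      unfolding f_def Psi_def by linarith
    then show ?thesis using pos(2)[OF t0] by (metis exp_le_cancel_iff exp_ln)
  qed
  then show ?thesis by (rule that)
qed

text \<open>Converts rates with respect to the derivation \<open>D\<close> into rates in time. As
  \<open>1 / (2 + B) \<le> 1\<close>, its square is at most \<open>1 / (2 + B)\<close>, which spares
  a square root in the bound.\<close>

lemma H_lower_bound:
  assumes "small t" "P t \<le> B"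
  shows "1 / (2 + B) \<le> H t"
proof -
  have t: "0 < t" using assms(1) by (rule small_pos)
  define W where "W = 1 + (P t + n3 t * S t) / 6"
  have HW: "(H t)\<^sup>2 * W = 1" using H_eq[OF t] by (simp add: W_def P_def S_def algebra_simps)
  note n = n_pos[OF t] and p = pos[OF t]
  have "n3 t * S t \<le> err t" using n by (simp add: err_def algebra_simps)
  then have W: "W \<le> 2 + B" "1 \<le> W" using assms(2) err_small(1)[OF assms(1)] p n unfolding W_def by auto
  have B: "0 < 2 + B" using p assms by simp
  have "1 / (2 + B) \<le> 1" using p(2) assms(2) by simp
  then have "(1 / (2 + B))\<^sup>2 \<le> 1 / (2 + B)" unfolding power2_eq_square by (rule mult_left_le) (use B in simp)
  also have "\<dots> \<le> 1 / W" using W by (intro divide_left_mono) auto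
  also have "1 / W = (H t)\<^sup>2" using HW W by (simp add: field_simps)
  finally show ?thesis by (rule power2_le_imp_le) (use H_pos[OF t] in simp)
qed

definition rho where "rho t = (d t)\<^sup>2 + (v t)\<^sup>2"
definition R_rate where "R_rate t = (4 * x t * (d t)\<^sup>2 - 2 * d t * v t * n3 t) / P t"

text \<open>The rotation terms cancel in \<open>rho\<close>, and dividing by \<open>P\<close>
  removes the \<open>v^2\<close> terms as well, since \<open>v^2\<close> and \<open>P\<close> share
  the rate \<open>2 * s3 - 2 * q\<close>. What is left in \<open>d^2\<close> is
  \<open>4 - 2 * s3 = 4 * x\<close>.\<close>

lemma D_R: "0 < t \<Longrightarrow> ((\<lambda>t. rho t / P t) has_real_derivative H t * R_rate t) (at t)"
proof -
  assume t: "0 < t"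
  have P: "P t \<noteq> 0" using pos(2)[OF t] by simp
  have r: "(rho has_real_derivative H t * (2 * d t * ((2 - q t) * d t + v t * (S t - n3 t))
      + 2 * v t * (v t * (s3 t - q t) - d t * S t))) (at t)"
    unfolding rho_def[abs_def]
    by (rule derivative_eq_intros D_d D_v refl t | simp add: algebra_simps)+
  show ?thesis unfolding R_rate_def x_def
    by (rule DERIV_cong[OF DERIV_divide[OF r D_P[OF t] P]])
      (use P in \<open>simp add: rho_def field_simps power2_eq_square\<close>)
qed

text \<open>\<open>x\<close> can be negative only by \<open>err / 12\<close>, so monotonicity of
  \<open>rho / P\<close> fails only by a multiple of \<open>err\<close>.\<close>

lemma R_rate_ge:
  assumes "small t"
  shows "- 2 * err t * (rho t / P t) \<le> R_rate t"
proof -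
  note t = small_pos[OF assms]
  note n = n_pos[OF t] and p = pos[OF t] and b = bounds(7)[OF assms]
  have "- err t / 12 * (4 * (d t)\<^sup>2) \<le> x t * (4 * (d t)\<^sup>2)" using b by (intro mult_right_mono) auto
  moreover have "2 * d t * v t * n3 t \<le> rho t * err t"
  proof -
    have "0 \<le> (d t - v t)\<^sup>2" by simp
    then have "2 * d t * v t \<le> rho t" by (simp add: rho_def power2_eq_square algebra_simps del: zero_le_square)
    then have "2 * d t * v t * n3 t \<le> rho t * n3 t" using n by (intro mult_right_mono) auto
    also have "n3 t * 1 \<le> err t" unfolding err_def using n p by (intro mult_left_mono) auto
    then have "rho t * n3 t \<le> rho t * err t" by (intro mult_left_mono) (auto simp: rho_def)
    finally show ?thesis .
  qed
  moreover have "err t * (d t)\<^sup>2 \<le> err t * rho t" using p by (intro mult_left_mono) (auto simp: rho_def)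
  moreover have "0 \<le> err t * (d t)\<^sup>2" using p by simp
  ultimately have "- 2 * err t * rho t \<le> 4 * x t * (d t)\<^sup>2 - 2 * d t * v t * n3 t" by (simp add: algebra_simps)
  then show ?thesis unfolding R_rate_def using p by (simp add: field_simps)
qed

text \<open>\<open>rho / P\<close> is almost nondecreasing, and its growth rate \<open>4 x d\<^sup>2 / P\<close> degenerates only where
  \<open>d = 0\<close>.  A small multiple of \<open>d v\<close>, which grows there, makes it increase at a uniform rate;
  this contradicts its boundedness.\<close>

lemma rho_eventually_zero:
  assumes T: "\<And>t. T \<le> t \<Longrightarrow> small t \<and> \<delta> \<le> P t" and \<delta>: "0 < \<delta>" "\<delta> \<le> 1"
    and B: "\<And>t. T \<le> t \<Longrightarrow> P t \<le> B" and err: "(err \<longlongrightarrow> 0) at_top" and a: "T \<le> a"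
  shows "rho a = 0"
proof (rule ccontr)
  assume "rho a \<noteq> 0"
  have T0: "0 < t" if "T \<le> t" for t using T[OF that] small_pos by blast
  have rho0: "0 \<le> rho t" for t by (simp add: rho_def)
  have ra: "0 < rho a / P a" using \<open>rho a \<noteq> 0\<close> rho0[of a] pos(2)[OF T0[OF a]] by simp
  define k where "k = K 2 \<delta>"
  have k: "0 \<le> k" using mu_pos \<delta> by (simp add: k_def K_def)
  \<comment> \<open>\<open>rho / P * exp (- (k * E))\<close> is nondecreasing, so
    \<open>rho / P\<close> never falls below this value after \<open>a\<close>.\<close>
  define c where "c = rho a / P a * exp (- (k * E a))"
  have c: "0 < c" unfolding c_def by (intro mult_pos_pos ra) simp
  have R_ge: "c \<le> rho t / P t" if t: "a \<le> t" for t
  proof -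
    have "- (rho t / P t * exp (- (k * E t))) \<le> - (rho a / P a * exp (- (k * E a)))"
    proof (rule nonincreasing_if_deriv_nonpos[OF t])
      fix u assume u: "a \<le> u" "u \<le> t"
      have s: "small u" "\<delta> \<le> P u" using T u a by auto
      note u0 = small_pos[OF s(1)]
      show "((\<lambda>t. - (rho t / P t * exp (- (k * E t)))) has_real_derivative
          - (H u * (exp (- (k * E u)) * (R_rate u - k * (rho u / P u) * E_rate u)))) (at u)"
        by (rule derivative_eq_intros D_R D_E refl u0 | simp add: algebra_simps)+
      have "2 * err u + k * E_rate u \<le> 0" unfolding k_def by (intro absorb[OF s \<delta>]) auto
      then have "rho u / P u * (2 * err u + k * E_rate u) \<le> 0"
        using rho0 pos(2)[OF u0] by (intro mult_nonneg_nonpos) auto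
      then have "0 \<le> R_rate u - k * (rho u / P u) * E_rate u" using R_rate_ge[OF s(1)] by (simp add: algebra_simps)
      then have "0 \<le> H u * (exp (- (k * E u)) * (R_rate u - k * (rho u / P u) * E_rate u))"
        using H_pos[OF u0] by (intro mult_nonneg_nonneg) auto
      then show "- (H u * (exp (- (k * E u)) * (R_rate u - k * (rho u / P u) * E_rate u))) \<le> 0" by linarith
    qed
    then have "c \<le> rho t / P t * exp (- (k * E t))" by (simp add: c_def)
    also have "\<dots> \<le> rho t / P t * 1"
    proof (intro mult_left_mono)
      have tT: "T \<le> t" using a t by simp
      show "exp (- (k * E t)) \<le> 1" using k E_pos[OF T0[OF tT]] by simp
      show "0 \<le> rho t / P t" using rho0 pos(2)[OF T0[OF tT]] by simp
    qed
    finally show ?thesis by simp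
  qed
  \<comment> \<open>Bounds the coefficient of \<open>\<bar>d\<bar>\<close> in the derivative of
    \<open>d * v\<close>: 33 exceeds \<open>9 * 18 / 5\<close> from the terms with \<open>q\<close>
    and \<open>s3\<close>, and the rest comes from \<open>d^2 * S\<close> with
    \<open>S \<le> B + 5\<close>.\<close>
  define C where "C = 33 + 4 * (B + 5)"
  have B0: "0 < B" using B[of T] T[of T] \<delta> by auto
  have C: "0 < C" using B0 by (simp add: C_def)
  \<comment> \<open>The first bound lets \<open>c * d^2 / 12\<close> supply the \<open>d\<close>
    part of \<open>2 * lam * \<delta> * rho\<close>. The second lets another
    \<open>c * d^2 / 12\<close>, together with \<open>F\<close>, absorb the cross term
    \<open>lam * C * \<bar>d\<bar>\<close>. As \<open>rho \<ge> c * \<delta>\<close>, the gain is at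
    least \<open>2 * F\<close> and \<open>F\<close> remains.\<close>
  define lam where "lam = min (c / (24 * \<delta>)) (\<delta>\<^sup>2 * c\<^sup>2 / (3 * C\<^sup>2))"
  have lam: "0 < lam" "24 * lam * \<delta> \<le> c" "3 * lam * C\<^sup>2 \<le> \<delta>\<^sup>2 * c\<^sup>2"
  proof -
    show "0 < lam" using c C \<delta> by (simp add: lam_def)
    have "lam \<le> c / (24 * \<delta>)" by (simp add: lam_def)
    then show "24 * lam * \<delta> \<le> c" using \<delta> by (simp add: field_simps)
    have "lam \<le> \<delta>\<^sup>2 * c\<^sup>2 / (3 * C\<^sup>2)" by (simp add: lam_def)
    then show "3 * lam * C\<^sup>2 \<le> \<delta>\<^sup>2 * c\<^sup>2" using C by (simp add: field_simps)
  qed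
  define F where "F = lam * \<delta>\<^sup>2 * c"
  define A where "A = 40 / \<delta> + 13 * lam"
  have F: "0 < F" and A: "0 < A" using lam \<delta> c by (auto simp: F_def A_def intro: add_pos_pos)
  define W_rate where "W_rate t = R_rate t + lam * (((2 - q t) * d t + v t * (S t - n3 t)) * v t
     + d t * (v t * (s3 t - q t) - d t * S t))" for t
  have W_ge: "F - A * err t \<le> W_rate t" if t: "a \<le> t" for t
  proof -
    have s: "small t" "\<delta> \<le> P t" and PB: "P t \<le> B" using T B t a by auto
    note t0 = small_pos[OF s(1)]
    note n = n_pos[OF t0] and p = pos[OF t0] and b = bounds[OF s(1)] and xi = xi_abs[OF t0]
    have cP: "c * P t \<le> rho t" using R_ge[OF t] p by (simp add: field_simps)
    have "2 * (rho t / 12 + xi t) \<le> 2 * (2 * x t)"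
      using x_le_Om[OF t0] unfolding rho_def[symmetric] by (rule mult_left_mono) simp
    then have "2 * (rho t / 12 + xi t) * (d t)\<^sup>2 \<le> 4 * x t * (d t)\<^sup>2"
      by (intro mult_right_mono) simp_all
    then have 1: "rho t * (d t)\<^sup>2 / 6 + 2 * (xi t * (d t)\<^sup>2) \<le> 4 * x t * (d t)\<^sup>2" by (simp add: algebra_simps)
    have "\<bar>xi t * (d t)\<^sup>2\<bar> \<le> err t / 6 * 13" unfolding abs_mult using xi b by (intro mult_mono) auto
    then have 2: "- (err t / 6 * 13) \<le> xi t * (d t)\<^sup>2" by linarith
    have n3e: "n3 t \<le> err t"
      using mult_left_mono[of 1 "1 + S t + n3 t" "n3 t"] n p by (simp add: err_def)
    have "\<bar>2 * d t * v t\<bar> * \<bar>n3 t\<bar> \<le> (2 * (18/5) * (18/5)) * err t"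
      using n3e n b(1,2) unfolding abs_mult by (intro mult_mono) auto
    then have "\<bar>2 * d t * v t * n3 t\<bar> \<le> 26 * err t" using p(4) unfolding abs_mult by linarith
    then have 3: "2 * d t * v t * n3 t \<le> 26 * err t" by linarith
    have "c * P t * (d t)\<^sup>2 / 6 - 31 * err t \<le> 4 * x t * (d t)\<^sup>2 - 2 * d t * v t * n3 t"
      using 1 2 3 mult_right_mono[OF cP, of "(d t)\<^sup>2"] p(4) zero_le_power2[of "d t"] by linarith
    then have "(c * P t * (d t)\<^sup>2 / 6 - 31 * err t) / P t \<le> R_rate t"
      unfolding R_rate_def using p by (intro divide_right_mono) auto
    moreover have "(c * P t * (d t)\<^sup>2 / 6 - 31 * err t) / P t = c * (d t)\<^sup>2 / 6 - 31 * err t / P t"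
      using p by (simp add: field_simps)
    moreover have "31 * err t / P t \<le> 40 * err t / \<delta>" using p s \<delta> by (intro frac_le) auto
    ultimately have R: "c * (d t)\<^sup>2 / 6 - 40 * err t / \<delta> \<le> R_rate t" by linarith
    have S2: "(S t)\<^sup>2 = 4 * P t + (v t)\<^sup>2" by (simp add: S_def P_def v_def power2_eq_square algebra_simps)
    have Slow: "2 * \<delta> \<le> S t"
    proof (rule power2_le_imp_le)
      have "(2 * \<delta>)\<^sup>2 \<le> 4 * \<delta>" using \<delta> by (simp add: power2_eq_square)
      also have "\<dots> \<le> 4 * P t + (v t)\<^sup>2" using s by (simp add: add_increasing2)
      finally show "(2 * \<delta>)\<^sup>2 \<le> (S t)\<^sup>2" by (simp add: S2)
    qed (use p in simp)
    have "0 \<le> (S t - 2)\<^sup>2" by simp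
    then have Sup: "S t \<le> B + 5" using b(11) S2 PB by (simp add: power2_eq_square algebra_simps del: zero_le_square)
    have q: "\<bar>(2 - q t) + (s3 t - q t)\<bar> \<le> 9"
    proof -
      have "\<bar>s3 t\<bar> \<le> 21 / 10" using b(3) err_small(1)[OF s(1)] by simp
      then show ?thesis using b(5) by linarith
    qed
    have "\<bar>((2 - q t) + (s3 t - q t)) * v t\<bar> \<le> 9 * (18 / 5)" unfolding abs_mult using q b(2) by (intro mult_mono) auto
    then have "\<bar>((2 - q t) + (s3 t - q t)) * v t * d t\<bar> \<le> 33 * \<bar>d t\<bar>" unfolding abs_mult
      by (intro mult_right_mono) auto
    then have 4: "- 33 * \<bar>d t\<bar> \<le> ((2 - q t) + (s3 t - q t)) * v t * d t" by linarith
    have 5: "2 * \<delta> * (v t)\<^sup>2 \<le> S t * (v t)\<^sup>2" using Slow by (intro mult_right_mono) auto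
    have "n3 t * (v t)\<^sup>2 \<le> err t * 13" using n3e b n by (intro mult_mono) auto
    then have 6: "n3 t * (v t)\<^sup>2 \<le> 13 * err t" by simp
    have "\<bar>d t\<bar> * \<bar>d t\<bar> \<le> 4 * \<bar>d t\<bar>" using b(1) by (intro mult_right_mono) auto
    then have "(d t)\<^sup>2 \<le> 4 * \<bar>d t\<bar>" by (simp add: power2_eq_square)
    then have 7: "(d t)\<^sup>2 * S t \<le> 4 * \<bar>d t\<bar> * (B + 5)" using Sup p by (intro mult_mono) auto
    have "2 * \<delta> * (v t)\<^sup>2 - C * \<bar>d t\<bar> - 13 * err t \<le> ((2 - q t) * d t + v t * (S t - n3 t)) * v t
        + d t * (v t * (s3 t - q t) - d t * S t)"
      using 4 5 6 7 unfolding C_def by (simp add: algebra_simps power2_eq_square)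
    then have W0: "lam * (2 * \<delta> * (v t)\<^sup>2 - C * \<bar>d t\<bar> - 13 * err t) \<le> W_rate t - R_rate t"
      unfolding W_rate_def using lam by (simp add: mult_left_mono)
    have W1: "c * (d t)\<^sup>2 / 6 + 2 * lam * \<delta> * (v t)\<^sup>2 - lam * C * \<bar>d t\<bar> - A * err t \<le> W_rate t"
    proof -
      have "A * err t = 40 * err t / \<delta> + 13 * (lam * err t)" by (simp add: A_def algebra_simps)
      moreover have "lam * (2 * \<delta> * (v t)\<^sup>2 - C * \<bar>d t\<bar> - 13 * err t)
          = 2 * lam * \<delta> * (v t)\<^sup>2 - lam * C * \<bar>d t\<bar> - 13 * (lam * err t)" by (simp add: algebra_simps)
      ultimately show ?thesis using R W0 by linarith
    qed
    have "0 \<le> (c * \<bar>d t\<bar> - 6 * (lam * C))\<^sup>2" by simp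
    then have "12 * (c * (lam * C * \<bar>d t\<bar>)) \<le> c * (c * (d t)\<^sup>2) + 36 * (lam * C)\<^sup>2"
      by (simp add: power2_eq_square algebra_simps del: zero_le_square)
    also have "36 * (lam * C)\<^sup>2 = 12 * lam * (3 * lam * C\<^sup>2)" by (simp add: power2_eq_square)
    also have "\<dots> \<le> 12 * lam * (\<delta>\<^sup>2 * c\<^sup>2)" using lam by (intro mult_left_mono) auto
    also have "\<dots> = c * (12 * F)" by (simp add: F_def power2_eq_square)
    finally have "c * (12 * (lam * C * \<bar>d t\<bar>)) \<le> c * (c * (d t)\<^sup>2 + 12 * F)" by (simp add: algebra_simps)
    then have W2: "12 * (lam * C * \<bar>d t\<bar>) \<le> c * (d t)\<^sup>2 + 12 * F" using c by simp
    have "24 * lam * \<delta> * (d t)\<^sup>2 \<le> c * (d t)\<^sup>2" using lam by (intro mult_right_mono) auto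
    then have "2 * lam * \<delta> * rho t \<le> c * (d t)\<^sup>2 / 12 + 2 * lam * \<delta> * (v t)\<^sup>2"
      by (simp add: rho_def algebra_simps)
    moreover have "2 * F \<le> 2 * lam * \<delta> * rho t"
    proof -
      have "c * \<delta> \<le> c * P t" using s c by (intro mult_left_mono) auto
      then have "2 * lam * \<delta> * (c * \<delta>) \<le> 2 * lam * \<delta> * rho t" using cP lam \<delta> by (intro mult_left_mono) auto
      then show ?thesis by (simp add: F_def power2_eq_square algebra_simps)
    qed
    ultimately show ?thesis using W1 W2 by linarith
  qed
  have "\<forall>\<^sub>F t in at_top. err t < F / (2 * A) \<and> a \<le> t"
    using order_tendstoD(2)[OF err, of "F / (2 * A)"] F A eventually_ge_at_top[of a]
    by (auto intro: eventually_conj)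
  then obtain T2 where T2: "\<And>t. T2 \<le> t \<Longrightarrow> err t < F / (2 * A) \<and> a \<le> t"
    unfolding eventually_at_top_linorder by blast
  define h where "h = 1 / (2 + B)"
  have h: "0 < h" using B0 by (simp add: h_def)
  define W where "W t = rho t / P t + lam * (d t * v t)" for t
  have dec: "- W t \<le> - W T2 - (h * (F / 2)) * (t - T2)" if "T2 \<le> t" for t
  proof (rule linear_decay[OF _ _ that, where f = "\<lambda>t. - W t" and f' = "\<lambda>t. - (H t * W_rate t)"])
    fix u assume u: "T2 \<le> u"
    then have ua: "a \<le> u" and eu: "err u < F / (2 * A)" using T2 by auto
    have s: "small u" "\<delta> \<le> P u" and PB: "P u \<le> B" using T B ua a by auto
    note u0 = small_pos[OF s(1)]
    show "((\<lambda>t. - W t) has_real_derivative - (H u * W_rate u)) (at u)"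
      unfolding W_def W_rate_def
      by (rule derivative_eq_intros D_R D_d D_v refl u0 | simp add: algebra_simps)+
    have "A * err u \<le> F / 2" using eu A by (simp add: field_simps)
    then have "F / 2 \<le> W_rate u" using W_ge[OF ua] by simp
    then have "h * (F / 2) \<le> H u * W_rate u"
      using H_lower_bound[OF s(1) PB] H_pos[OF u0] F by (intro mult_mono) (auto simp: h_def)
    then show "- (H u * W_rate u) \<le> - (h * (F / 2))" by simp
  qed
  have up: "W t \<le> 26 / \<delta> + lam * 13" if "T2 \<le> t" for t
  proof -
    have "a \<le> t" using T2 that by auto
    then have s: "small t" "\<delta> \<le> P t" using T a by auto
    note b = bounds[OF s(1)]
    have "rho t / P t \<le> 26 / \<delta>" using b s \<delta> unfolding rho_def by (intro frac_le) auto
    moreover have "0 \<le> (d t - v t)\<^sup>2" by simp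
    then have "d t * v t \<le> 13" using b(11,12) by (simp add: power2_eq_square algebra_simps del: zero_le_square)
    then have "lam * (d t * v t) \<le> lam * 13" using lam by (intro mult_left_mono) auto
    ultimately show ?thesis by (simp add: W_def)
  qed
  define hF where "hF = h * (F / 2)"
  define t where "t = T2 + (26 / \<delta> + lam * 13 - W T2 + 1) / hF"
  have hF: "0 < hF" using h F by (simp add: hF_def)
  have t: "T2 \<le> t" using up[of T2] hF unfolding t_def by (intro add_increasing2 divide_nonneg_pos) auto
  have "hF * (t - T2) = 26 / \<delta> + lam * 13 - W T2 + 1" using hF unfolding t_def by simp
  then show False using dec[OF t] up[OF t] unfolding hF_def[symmetric] by linarith
qed

section \<open>Rotationally symmetric orbits and convergence to the Taub line\<close>

text \<open>With \<open>d = v = 0\<close> the constraint makes \<open>Om\<close> equal to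
  \<open>x * (2 - x)\<close> up to \<open>xi\<close>, so both rates depend on \<open>x\<close> alone
  up to errors. The first is then \<open>- 4 * x + (4 - 4 * \<mu>) * x^2 * (2 - x)\<close>, and
  \<open>x * (2 - x) \<le> 1\<close> turns it into \<open>- 4 * \<mu> * x\<close> for
  \<open>x \<ge> 0\<close>.\<close>

lemma lrs_rate:
  assumes s: "small t" and r: "rho t = 0"
  shows "(2 * s3 t - 2 * q t) - ((2 - q t) * s3 t + (n3 t * (2 * n3 t - n1 t - n2 t) - (n1 t - n2 t)\<^sup>2) / 3)
      \<le> - 4 * \<mu> * \<bar>x t\<bar> + 8 * err t" (is "?L \<le> _")
    and "\<bar>2 * s3 t - 2 * q t\<bar> \<le> 9 * \<bar>x t\<bar> + err t"
proof -
  note t = small_pos[OF s]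
  note n = n_pos[OF t] and p = pos[OF t] and b = bounds[OF s] and xi = xi_abs[OF t]
  have dv: "d t = 0" "v t = 0" using r by (simp_all add: rho_def sum_power2_eq_zero_iff)
  have Om: "Om t = 2 * x t - (x t)\<^sup>2 - xi t" using x_eq[OF t] dv by simp
  have q: "q t = 2 - (2 - 2 * \<mu>) * Om t - 2 * xi t" using two_minus_q[OF t] dv by simp
  have s3: "s3 t = 2 - 2 * x t" by (simp add: x_def)
  have vv: "n1 t - n2 t = 0" using dv by (simp add: v_def)
  define u where "u = n3 t * (2 * n3 t - S t) / 3"
  have N: "(n3 t * (2 * n3 t - n1 t - n2 t) - (n1 t - n2 t)\<^sup>2) / 3 = u"
    unfolding vv u_def S_def by (simp add: field_simps)
  have u: "\<bar>u\<bar> \<le> err t"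
  proof -
    have "0 \<le> n3 t * n3 t" "0 \<le> n3 t * S t" "0 \<le> n3 t" using n p by auto
    moreover have "u = 2 / 3 * (n3 t * n3 t) - n3 t * S t / 3" by (simp add: u_def diff_divide_distrib algebra_simps)
    moreover have "err t = n3 t + n3 t * S t + n3 t * n3 t" by (simp add: err_def algebra_simps)
    ultimately show ?thesis by linarith
  qed
  have id: "?L = - 4 * x t + (4 - 4 * \<mu>) * (x t * (x t * (2 - x t)))
      + (4 * \<mu> - 4) * (x t * xi t) + 4 * x t * xi t - u"
    unfolding N unfolding q s3 unfolding Om by (simp add: power2_eq_square algebra_simps)
  have "\<bar>x t * xi t\<bar> \<le> 21 / 10 * (err t / 6)" unfolding abs_mult using b xi by (intro mult_mono) auto
  then have e1: "\<mu> * \<bar>x t * xi t\<bar> \<le> 1 * (21 / 10 * (err t / 6))" using mu_pos mu_less by (intro mult_mono) auto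
  then have e2: "\<bar>4 * (\<mu> * (x t * xi t))\<bar> \<le> 2 * err t" using mu_pos p(4) by (simp add: abs_mult)
  have e3: "(4 * \<mu> - 4) * (x t * xi t) + 4 * x t * xi t = 4 * (\<mu> * (x t * xi t))" by (simp add: algebra_simps)
  have main: "- 4 * x t + (4 - 4 * \<mu>) * (x t * (x t * (2 - x t))) \<le> - 4 * \<mu> * \<bar>x t\<bar> + 4 * err t"
  proof -
    have "0 \<le> (1 - x t)\<^sup>2" by simp
    then have 1: "x t * (2 - x t) \<le> 1" by (simp add: power2_eq_square algebra_simps del: zero_le_square)
    show ?thesis
    proof (cases "0 \<le> x t")
      case True
      have "(4 - 4 * \<mu>) * (x t * (x t * (2 - x t))) \<le> (4 - 4 * \<mu>) * (x t * 1)"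
        using 1 True mu_less by (intro mult_left_mono) auto
      then show ?thesis using True p by (simp add: algebra_simps)
    next
      \<comment> \<open>Here \<open>- x \<le> err / 12\<close>, so this case is a matter of
        errors.\<close>
      case False
      have "x t * (x t * (2 - x t)) = (- x t) * (- (x t * (2 - x t)))" by simp
      also have "\<dots> \<le> (- x t) * 1"
      proof (intro mult_left_mono)
        have "- x t * (2 - x t) \<le> (1 / 12) * 3" using False b(7) err_small(1)[OF s] by (intro mult_mono) auto
        then show "- (x t * (2 - x t)) \<le> 1" by simp
      qed (use False in simp)
      finally have "(4 - 4 * \<mu>) * (x t * (x t * (2 - x t))) \<le> (4 - 4 * \<mu>) * (- x t)"
        using mu_less by (intro mult_left_mono) auto
      moreover have "- x t \<le> err t / 12" using b(7) by simp
      moreover have "\<mu> * (- x t) \<ge> 0" using mu_pos False by (simp add: mult_nonneg_nonpos)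
      moreover have "\<bar>x t\<bar> = - x t" using False by simp
      ultimately show ?thesis using p by (simp add: algebra_simps)
    qed
  qed
  show "?L \<le> - 4 * \<mu> * \<bar>x t\<bar> + 8 * err t"
    unfolding id using main e2 e3 u p by (simp add: abs_le_iff)
  have "2 * s3 t - 2 * q t = - 2 * (x t * x t) + (2 - 4 * \<mu>) * Om t + 2 * xi t"
    unfolding q s3 using Om by (simp add: power2_eq_square algebra_simps)
  moreover have "x t * x t \<le> 21 / 10 * \<bar>x t\<bar>"
    using mult_right_mono[OF b(8), of "\<bar>x t\<bar>"] by simp
  moreover have "\<bar>(2 - 4 * \<mu>) * Om t\<bar> \<le> 2 * Om t"
    unfolding abs_mult using Om_nonneg[OF t] mu_pos mu_less by (intro mult_mono) auto
  moreover have "0 \<le> x t * x t" by simp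
  moreover have "Om t = 2 * x t - x t * x t - xi t" using Om by (simp add: power2_eq_square)
  ultimately show "\<bar>2 * s3 t - 2 * q t\<bar> \<le> 9 * \<bar>x t\<bar> + err t"
    using xi p(4) by linarith
qed

text \<open>\<open>G = ln P - s3 + k * E\<close> is monotone and bounded below, hence convergent.
  Its speed dominates that of \<open>ln P\<close>, so \<open>ln P + m * G\<close> is monotone too
  and \<open>ln P\<close> converges; then so does \<open>s3\<close>, a combination of convergent
  functions. A limit of \<open>x\<close> other than 0 would make \<open>G\<close> unbounded.\<close>

lemma taub_case:
  assumes "0 < \<delta>" "\<forall>\<^sub>F t in at_top. \<delta> \<le> P t"
  obtains p where "0 < p" "(P \<longlongrightarrow> p) at_top" "(s3 \<longlongrightarrow> 2) at_top" "(Om \<longlongrightarrow> 0) at_top" "(n3 \<longlongrightarrow> 0) at_top"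
    "\<forall>\<^sub>F t in at_top. n1 t = n2 t \<and> s1 t = s2 t"
proof -
  define \<delta>' where "\<delta>' = min \<delta> 1"
  have \<delta>: "0 < \<delta>'" "\<delta>' \<le> 1" using assms by (auto simp: \<delta>'_def)
  have P: "\<forall>\<^sub>F t in at_top. \<delta>' \<le> P t" using assms(2) by eventually_elim (simp add: \<delta>'_def)
  have err_le: "\<forall>\<^sub>F t in at_top. err t \<le> \<eta>" if "0 < \<eta>" for \<eta>
    using P err_eventually_small[OF \<delta> that] by eventually_elim auto
  have pos_ev: "\<forall>\<^sub>F t in at_top. 0 < err t"
    using eventually_gt_at_top[of 0] by eventually_elim (rule pos(4))
  have err0: "(err \<longlongrightarrow> 0) at_top"
  proof (rule tendstoI)
    fix e :: real assume "0 < e"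
    then have "\<forall>\<^sub>F t in at_top. err t \<le> e / 2" by (intro err_le) auto
    then show "\<forall>\<^sub>F t in at_top. dist (err t) 0 < e" using pos_ev
      by eventually_elim (use \<open>0 < e\<close> in \<open>auto simp: dist_real_def\<close>)
  qed
  have "0 < \<mu> * (1 - \<mu>) / 24" using mu_pos mu_less by simp
  from P err_le[OF this] eventually_gt_at_top[of 0]
  have "\<forall>\<^sub>F t in at_top. small t \<and> \<delta>' \<le> P t"
    by eventually_elim (simp add: small_def)
  then obtain T where T: "\<And>t. T \<le> t \<Longrightarrow> small t \<and> \<delta>' \<le> P t" unfolding eventually_at_top_linorder by blast
  obtain B where B: "\<And>t. T \<le> t \<Longrightarrow> P t \<le> B" by (rule P_bounded[OF T \<delta>]) (use that in auto)
  have B0: "0 < B" using B[of T] T[of T] \<delta> by auto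
  have rho: "rho t = 0" if "T \<le> t" for t
    by (rule rho_eventually_zero[OF T \<delta> B err0 that])
  have T0: "0 < t" if "T \<le> t" for t using T[OF that] small_pos by blast
  \<comment> \<open>One unit more than the 8 in \<open>lrs_rate\<close>; the surplus
    \<open>- err\<close> in \<open>G'\<close> later covers the error in the derivative of
    \<open>ln P\<close>.\<close>
  define k where "k = K 9 \<delta>'"
  have k: "0 \<le> k" using mu_pos \<delta> by (simp add: k_def K_def)
  define G where "G t = ln (P t) - s3 t + k * E t" for t
  define G' where "G' t = (2 * s3 t - 2 * q t) - ((2 - q t) * s3 t
     + (n3 t * (2 * n3 t - n1 t - n2 t) - (n1 t - n2 t)\<^sup>2) / 3) + k * E_rate t" for t
  have D_lnP: "((\<lambda>t. ln (P t)) has_real_derivative H t * (2 * s3 t - 2 * q t)) (at t)" if "T \<le> t" for t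
    using pos(2)[OF T0[OF that]]
    by (auto intro!: derivative_eq_intros D_P T0[OF that])
  have D_G: "(G has_real_derivative H t * G' t) (at t)" if "T \<le> t" for t
    unfolding G_def[abs_def] G'_def
    by (rule derivative_eq_intros D_lnP D_s3 D_E refl that T0[OF that] | simp add: algebra_simps)+
  have G'_le: "G' t \<le> - 4 * \<mu> * \<bar>x t\<bar> - err t" if t: "T \<le> t" for t
  proof -
    have s: "small t" "\<delta>' \<le> P t" using T t by auto
    have "9 * err t + k * E_rate t \<le> 0" unfolding k_def by (intro absorb[OF s \<delta>]) auto
    then show ?thesis using lrs_rate(1)[OF s(1) rho[OF t]] unfolding G'_def by linarith
  qed
  have ET: "E t \<le> E T" if "T \<le> t" for t using E_antimono[OF that] T by blast
  have lnP: "ln \<delta>' \<le> ln (P t)" "ln (P t) \<le> ln B" if "T \<le> t" for t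
    using T[OF that] B[OF that] \<delta> by (auto intro!: ln_mono)
  have s3b: "\<bar>s3 t\<bar> \<le> 3" if "T \<le> t" for t
    using bounds(3)[of t] err_small(1)[of t] T[OF that] by auto
  have kE: "0 \<le> k * E t" if "T \<le> t" for t using k E_pos[OF T0[OF that]] by simp
  have x0: "0 \<le> 4 * \<mu> * \<bar>x t\<bar>" for t using mu_pos by simp
  obtain LG where LG: "(G \<longlongrightarrow> LG) at_top"
  proof (rule nonincreasing_tendsto[of T G "ln \<delta>' - 3"])
    show "G t \<le> G s" if "T \<le> s" "s \<le> t" for s t
    proof (rule nonincreasing_if_deriv_nonpos[OF that(2)])
      show "(G has_real_derivative H u * G' u) (at u)" if "s \<le> u" "u \<le> t" for u
        using D_G that \<open>T \<le> s\<close> by simp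
      show "H u * G' u \<le> 0" if "s \<le> u" "u \<le> t" for u
        using G'_le[of u] x0[of u] pos(4)[of u] H_pos[of u] T0[of u] that \<open>T \<le> s\<close>
        by (intro mult_nonneg_nonpos) auto
    qed
    show "ln \<delta>' - 3 \<le> G t" if "T \<le> t" for t
      using lnP[OF that] s3b[OF that] kE[OF that] unfolding G_def by (simp add: abs_le_iff)
  qed (rule that)
  \<comment> \<open>\<open>9 / (4 * \<mu>)\<close> is the ratio of the coefficients of
    \<open>\<bar>x\<bar>\<close> in the two rates of \<open>lrs_rate\<close>; the added 1 makes
    \<open>m * err\<close> cover the error term.\<close>
  define m where "m = 9 / (4 * \<mu>) + 1"
  have m: "0 < m" using mu_pos by (simp add: m_def add_pos_pos)
  obtain LF where LF: "((\<lambda>t. ln (P t) + m * G t) \<longlongrightarrow> LF) at_top"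
  proof (rule nonincreasing_tendsto[of T "\<lambda>t. ln (P t) + m * G t" "ln \<delta>' + m * (ln \<delta>' - 3)"])
    show "ln (P t) + m * G t \<le> ln (P s) + m * G s" if "T \<le> s" "s \<le> t" for s t
    proof (rule nonincreasing_if_deriv_nonpos[OF that(2)])
      fix u assume u: "s \<le> u" "u \<le> t"
      then have Tu: "T \<le> u" using that by simp
      show "((\<lambda>t. ln (P t) + m * G t) has_real_derivative H u * (2 * s3 u - 2 * q u + m * G' u)) (at u)"
        by (rule derivative_eq_intros D_lnP D_G refl Tu | simp add: algebra_simps)+
      have "m * G' u \<le> m * (- 4 * \<mu> * \<bar>x u\<bar> - err u)" using G'_le[OF Tu] m by (intro mult_left_mono) auto
      also have "\<dots> = - 9 * \<bar>x u\<bar> - 4 * \<mu> * \<bar>x u\<bar> - m * err u" unfolding m_def using mu_pos by (simp add: field_simps)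
      also have "\<dots> \<le> - 9 * \<bar>x u\<bar> - err u"
      proof -
        have "1 * err u \<le> m * err u" using pos(4)[OF T0[OF Tu]] mu_pos by (intro mult_right_mono) (auto simp: m_def)
        then show ?thesis using x0[of u] by linarith
      qed
      finally have "2 * s3 u - 2 * q u + m * G' u \<le> 0"
        using lrs_rate(2)[OF _ rho[OF Tu]] T[OF Tu] by (simp add: abs_le_iff)
      then show "H u * (2 * s3 u - 2 * q u + m * G' u) \<le> 0" using H_pos[OF T0[OF Tu]] by (intro mult_nonneg_nonpos) auto
    qed
    show "ln \<delta>' + m * (ln \<delta>' - 3) \<le> ln (P t) + m * G t" if "T \<le> t" for t
    proof -
      have "ln \<delta>' - 3 \<le> G t"
        using lnP[OF that] s3b[OF that] kE[OF that] unfolding G_def by (simp add: abs_le_iff)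
      then show ?thesis using lnP[OF that] m by (intro add_mono mult_left_mono) auto
    qed
  qed (rule that)
  obtain LE where LE: "(E \<longlongrightarrow> LE) at_top"
    by (rule nonincreasing_tendsto[of T E 0]) (use that E_antimono T E_pos[OF T0] in \<open>auto simp: less_imp_le\<close>)
  have "((\<lambda>t. (ln (P t) + m * G t) - m * G t) \<longlongrightarrow> LF - m * LG) at_top" by (intro tendsto_intros LF LG)
  then have lnP_lim: "((\<lambda>t. ln (P t)) \<longlongrightarrow> LF - m * LG) at_top" by simp
  then have "((\<lambda>t. exp (ln (P t))) \<longlongrightarrow> exp (LF - m * LG)) at_top" by (intro tendsto_intros)
  moreover have "\<forall>\<^sub>F t in at_top. exp (ln (P t)) = P t"
    using eventually_gt_at_top[of 0] by eventually_elim (simp add: pos)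
  ultimately have P_lim: "(P \<longlongrightarrow> exp (LF - m * LG)) at_top" by (rule Lim_transform_eventually)
  have "((\<lambda>t. ln (P t) + k * E t - G t) \<longlongrightarrow> LF - m * LG + k * LE - LG) at_top"
    by (intro tendsto_intros lnP_lim LE LG)
  then have s3_lim: "(s3 \<longlongrightarrow> LF - m * LG + k * LE - LG) at_top" (is "(_ \<longlongrightarrow> ?s) _") by (simp add: G_def)
  define X where "X = 1 - ?s / 2"
  have x_lim: "(x \<longlongrightarrow> X) at_top" unfolding x_def[abs_def] X_def by (intro tendsto_intros s3_lim) simp
  \<comment> \<open>Otherwise \<open>G\<close> would fall at a definite speed, as \<open>H\<close>
    is bounded below.\<close>
  have X: "X = 0"
  proof (rule ccontr)
    assume "X \<noteq> 0"
    have "((\<lambda>t. \<bar>x t\<bar>) \<longlongrightarrow> \<bar>X\<bar>) at_top" by (intro tendsto_intros x_lim)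
    then have "\<forall>\<^sub>F t in at_top. \<bar>X\<bar> / 2 < \<bar>x t\<bar> \<and> T \<le> t"
      using \<open>X \<noteq> 0\<close> by (intro eventually_conj order_tendstoD eventually_ge_at_top) auto
    then obtain T2 where T2: "\<And>t. T2 \<le> t \<Longrightarrow> \<bar>X\<bar> / 2 < \<bar>x t\<bar> \<and> T \<le> t" unfolding eventually_at_top_linorder by blast
    define h where "h = 1 / (2 + B)"
    have h: "0 < h" using B0 by (simp add: h_def)
    show False
    proof (rule trapped_below_unbounded[of T2 G "\<lambda>t. H t * G' t" "G T2 + 1" "h * (2 * \<mu> * \<bar>X\<bar>)" "ln \<delta>' - 3"])
      show "(G has_real_derivative H t * G' t) (at t)" if "T2 \<le> t" for t using D_G T2 that by blast
      show "H t * G' t \<le> - (h * (2 * \<mu> * \<bar>X\<bar>))" if "T2 \<le> t" for t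
      proof -
        have Tt: "T \<le> t" using T2 that by blast
        have "\<mu> * (\<bar>X\<bar> / 2) \<le> \<mu> * \<bar>x t\<bar>" using T2[OF that] mu_pos by (intro mult_left_mono) auto
        then have "2 * \<mu> * \<bar>X\<bar> \<le> - G' t" using G'_le[OF Tt] pos(4)[OF T0[OF Tt]] by simp
        then have "h * (2 * \<mu> * \<bar>X\<bar>) \<le> H t * (- G' t)"
          using H_lower_bound[OF _ B[OF Tt]] T[OF Tt] H_pos[OF T0[OF Tt]] mu_pos
          by (intro mult_mono) (auto simp: h_def)
        then show ?thesis by simp
      qed
      show "0 < h * (2 * \<mu> * \<bar>X\<bar>)" using h mu_pos \<open>X \<noteq> 0\<close> by simp
      show "ln \<delta>' - 3 \<le> G t" if "T2 \<le> t" for t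
      proof -
        have "T \<le> t" using T2 that by blast
        then show ?thesis using lnP[of t] s3b[of t] kE[of t] unfolding G_def by (simp add: abs_le_iff)
      qed
    qed simp
  qed
  have evT: "\<forall>\<^sub>F t in at_top. T \<le> t" by (rule eventually_ge_at_top)
  have n3_lim: "(n3 \<longlongrightarrow> 0) at_top"
  proof (rule tendsto_sandwich[OF _ _ tendsto_const err0])
    show "\<forall>\<^sub>F t in at_top. 0 \<le> n3 t" using evT by eventually_elim (use n_pos(3) T0 less_imp_le in blast)
    show "\<forall>\<^sub>F t in at_top. n3 t \<le> err t" using evT
    proof eventually_elim
      case (elim t)
      show ?case using mult_left_mono[of 1 "1 + S t + n3 t" "n3 t"] n_pos[OF T0[OF elim]] pos(1)[OF T0[OF elim]]
        by (simp add: err_def)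
    qed
  qed
  have xi_lim: "(xi \<longlongrightarrow> 0) at_top"
  proof (rule Lim_null_comparison)
    show "\<forall>\<^sub>F t in at_top. norm (xi t) \<le> err t / 6" using evT by eventually_elim (use xi_abs T0 in auto)
    show "((\<lambda>t. err t / 6) \<longlongrightarrow> 0) at_top" by (rule tendsto_divide_zero[OF err0])
  qed
  have "((\<lambda>t. 2 * x t - (x t)\<^sup>2 - xi t) \<longlongrightarrow> 2 * 0 - 0\<^sup>2 - 0) at_top"
    using x_lim xi_lim unfolding X by (intro tendsto_intros)
  moreover have "\<forall>\<^sub>F t in at_top. 2 * x t - (x t)\<^sup>2 - xi t = Om t" using evT
  proof eventually_elim
    case (elim t)
    then show ?case using x_eq[OF T0[OF elim]] rho[OF elim] unfolding rho_def by simp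
  qed
  ultimately have "(Om \<longlongrightarrow> 2 * 0 - 0\<^sup>2 - 0) at_top" by (rule Lim_transform_eventually)
  then have Om_lim: "(Om \<longlongrightarrow> 0) at_top" by simp
  have s32: "(s3 \<longlongrightarrow> 2) at_top"
  proof -
    have "?s = 2" using X by (simp add: X_def)
    then show ?thesis using s3_lim by simp
  qed
  have eq: "\<forall>\<^sub>F t in at_top. n1 t = n2 t \<and> s1 t = s2 t"
    using evT by eventually_elim (use rho in \<open>auto simp: rho_def d_def v_def sum_power2_eq_zero_iff\<close>)
  show ?thesis
    by (rule that[OF _ P_lim s32 Om_lim n3_lim eq]) simp
qed

lemma taub_limits:
  assumes "0 < \<delta>" "\<forall>\<^sub>F t in at_top. \<delta> \<le> P t"
  obtains h where "0 < h" "h < 1" "(H \<longlongrightarrow> h) at_top"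
    "(s1 \<longlongrightarrow> - 1) at_top" "(s2 \<longlongrightarrow> - 1) at_top" "(s3 \<longlongrightarrow> 2) at_top"
    "(n1 \<longlongrightarrow> sqrt 6 * sqrt (1 - h\<^sup>2) / h) at_top" "(n2 \<longlongrightarrow> sqrt 6 * sqrt (1 - h\<^sup>2) / h) at_top" "(n3 \<longlongrightarrow> 0) at_top"
proof -
  obtain p where p: "0 < p" "(P \<longlongrightarrow> p) at_top" "(s3 \<longlongrightarrow> 2) at_top" "(Om \<longlongrightarrow> 0) at_top" "(n3 \<longlongrightarrow> 0) at_top"
    "\<forall>\<^sub>F t in at_top. n1 t = n2 t \<and> s1 t = s2 t"
    by (rule taub_case[OF assms]) (rule that)
  \<comment> \<open>The limit of the constraint, \<open>h^2 * (1 + p / 6) = 1\<close>.\<close>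
  define h where "h = sqrt (6 / (6 + p))"
  have h2: "h\<^sup>2 = 6 / (6 + p)" using p(1) by (simp add: h_def)
  have h: "0 < h" "h < 1" using p(1) by (simp_all add: h_def)
  have "sqrt 6 * sqrt (1 - h\<^sup>2) = sqrt p * h"
    unfolding h_def h2[unfolded h_def] real_sqrt_mult[symmetric] using p(1) by (simp add: field_simps)
  then have r: "sqrt 6 * sqrt (1 - h\<^sup>2) / h = sqrt p" using h by simp
  have s: "((\<lambda>t. - s3 t / 2) \<longlongrightarrow> - 2 / 2) at_top" by (intro tendsto_intros p(3)) simp
  have ev: "\<forall>\<^sub>F t in at_top. 0 < t \<and> n1 t = n2 t \<and> s1 t = s2 t"
    using p(6) eventually_gt_at_top[of 0] by eventually_elim simp
  have s12: "\<forall>\<^sub>F t in at_top. - s3 t / 2 = s1 t" "\<forall>\<^sub>F t in at_top. - s3 t / 2 = s2 t"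
    using ev by (eventually_elim, use s_sum in force)+
  have sp: "((\<lambda>t. sqrt (P t)) \<longlongrightarrow> sqrt p) at_top" by (intro tendsto_intros p(2))
  have n12: "\<forall>\<^sub>F t in at_top. sqrt (P t) = n1 t" "\<forall>\<^sub>F t in at_top. sqrt (P t) = n2 t"
    using ev by (eventually_elim, use n_pos in \<open>force simp: P_def\<close>)+
  note n1 = Lim_transform_eventually[OF sp n12(1)] and n2 = Lim_transform_eventually[OF sp n12(2)]
  have "((\<lambda>t. sqrt (1 / (1 + (n1 t * n2 t + n2 t * n3 t + n3 t * n1 t) / 6)))
      \<longlongrightarrow> sqrt (1 / (1 + (sqrt p * sqrt p + sqrt p * 0 + 0 * sqrt p) / 6))) at_top"
    by (intro tendsto_intros n1 n2 p(5)) (use p(1) in \<open>simp_all add: add_pos_pos\<close>)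
  also have "sqrt (1 / (1 + (sqrt p * sqrt p + sqrt p * 0 + 0 * sqrt p) / 6)) = h"
    using p(1) by (simp add: h_def field_simps)
  finally have "((\<lambda>t. sqrt (1 / (1 + (n1 t * n2 t + n2 t * n3 t + n3 t * n1 t) / 6))) \<longlongrightarrow> h) at_top" .
  then have H: "(H \<longlongrightarrow> h) at_top"
  proof (rule Lim_transform_eventually)
    show "\<forall>\<^sub>F t in at_top. sqrt (1 / (1 + (n1 t * n2 t + n2 t * n3 t + n3 t * n1 t) / 6)) = H t"
      using eventually_gt_at_top[of 0]
    proof eventually_elim
      case (elim t)
      have "(H t)\<^sup>2 = 1 / (1 + (n1 t * n2 t + n2 t * n3 t + n3 t * n1 t) / 6)"
        using H_eq[OF elim] by (metis nonzero_eq_divide_eq mult_zero_right zero_neq_one)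
      then show ?case using H_pos[OF elim] by (metis real_sqrt_unique less_imp_le)
    qed
  qed
  show ?thesis
    using that[OF h H Lim_transform_eventually[OF s s12(1), simplified] Lim_transform_eventually[OF s s12(2), simplified] p(3)]
      n1 n2 p(5) unfolding r by blast
qed

end

section \<open>Vanishing pairs: decay or persistence of matter\<close>

text \<open>To lose its size, \<open>a\<close> would have to pass through
  \<open>3 / 4 * \<eta>\<close>. There another component is at least \<open>\<eta>\<close>, and its
  product with \<open>a\<close> exceeds \<open>\<eta>^2 / 4\<close>.\<close>

lemma persistent_large_component:
  fixes a b c :: "real \<Rightarrow> real"
  assumes cont: "continuous_on {T..t} a" and t: "T \<le> t"
    and large: "\<And>u. T \<le> u \<Longrightarrow> \<eta> \<le> a u \<or> \<eta> \<le> b u \<or> \<eta> \<le> c u"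
    and ab: "\<And>u. T \<le> u \<Longrightarrow> a u * b u < \<eta>\<^sup>2 / 4" and ac: "\<And>u. T \<le> u \<Longrightarrow> a u * c u < \<eta>\<^sup>2 / 4"
    and \<eta>: "0 < \<eta>" and init: "\<eta> \<le> a T"
  shows "\<eta> \<le> a t"
proof (rule ccontr)
  assume n: "\<not> \<eta> \<le> a t"
  have other: "a u < \<eta> / 2" if u: "T \<le> u" "a u < \<eta>" for u
  proof (rule ccontr)
    assume h: "\<not> a u < \<eta> / 2"
    have "\<eta> / 2 * \<eta> \<le> a u * b u \<or> \<eta> / 2 * \<eta> \<le> a u * c u"
      using large[OF u(1)]
    proof (elim disjE)
      assume "\<eta> \<le> b u"
      then have "\<eta> / 2 * \<eta> \<le> a u * b u" by (rule mult_mono[rotated]) (use h \<eta> in auto)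
      then show ?thesis ..
    next
      assume "\<eta> \<le> c u"
      then have "\<eta> / 2 * \<eta> \<le> a u * c u" by (rule mult_mono[rotated]) (use h \<eta> in auto)
      then show ?thesis ..
    qed (use u in simp)
    moreover have "0 < \<eta> * \<eta>" using \<eta> by simp
    ultimately show False using ab[OF u(1)] ac[OF u(1)] unfolding power2_eq_square by auto
  qed
  obtain u where u: "T \<le> u" "u \<le> t" "a u = 3 / 4 * \<eta>"
    using IVT2'[of a t "3 / 4 * \<eta>" T] other[OF t] n init \<eta> t cont by auto
  then show False using other[of u] \<eta> by simp
qed

text \<open>\<open>n powr \<alpha>\<close> serves as a smooth switch that is 0 at
  \<open>n = 0\<close> and near 1 elsewhere. Weighting \<open>n^2\<close> with it costs at most
  \<open>\<alpha>\<close>, uniformly in \<open>n\<close>.\<close>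

lemma square_powr_gap:
  fixes n \<alpha> :: real
  assumes "0 < n" "0 < \<alpha>"
  shows "n\<^sup>2 - n powr \<alpha> * n\<^sup>2 \<le> \<alpha>"
proof -
  have "1 + \<alpha> * ln n \<le> n powr \<alpha>"
    using exp_ge_add_one_self[of "\<alpha> * ln n"] assms by (simp add: powr_def)
  moreover have "1 - 1 / n \<le> ln n"
    using ln_le_minus_one[of "1 / n"] assms by (simp add: ln_div)
  then have "\<alpha> * (1 - 1 / n) \<le> \<alpha> * ln n" using assms by (intro mult_left_mono) auto
  ultimately have "1 - n powr \<alpha> \<le> \<alpha> * (1 / n - 1)" by (simp add: algebra_simps)
  then have "n\<^sup>2 * (1 - n powr \<alpha>) \<le> n\<^sup>2 * (\<alpha> * (1 / n - 1))" by (rule mult_left_mono) simp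
  also have "\<dots> = \<alpha> * (n - n\<^sup>2)" using assms by (simp add: power2_eq_square field_simps)
  also have "\<dots> \<le> \<alpha> * 1"
  proof (intro mult_left_mono)
    have "0 \<le> (n - 1)\<^sup>2 + n" using assms by (simp add: add_nonneg_nonneg)
    then show "n - n\<^sup>2 \<le> 1" by (simp add: power2_eq_square algebra_simps del: zero_le_square)
  qed (use assms in simp)
  finally show ?thesis by (simp add: algebra_simps)
qed

lemma powr_le_4: "0 < n \<Longrightarrow> n \<le> 4 \<Longrightarrow> 0 < \<alpha> \<Longrightarrow> \<alpha> \<le> 1 \<Longrightarrow> n powr \<alpha> \<le> (4::real)"
  using powr_mono2[of \<alpha> n 4] powr_mono[of \<alpha> 1 4] by simp

text \<open>Trades the square of a competing component for a power of a product, and products tend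
  to 0.\<close>

lemma powr_square_le:
  fixes n u \<alpha> :: real
  assumes "0 < n" "0 < u" "u \<le> 4" "0 < \<alpha>" "\<alpha> \<le> 1"
  shows "n powr \<alpha> * u\<^sup>2 \<le> 16 * (n * u) powr \<alpha>"
proof -
  have "u\<^sup>2 = u powr \<alpha> * u powr (2 - \<alpha>)" using assms by (simp flip: powr_add powr_numeral)
  moreover have "u powr (2 - \<alpha>) \<le> 4 powr (2 - \<alpha>)" using assms by (intro powr_mono2) auto
  moreover have "4 powr (2 - \<alpha>) \<le> 4 powr (2::real)" using assms by (intro powr_mono) auto
  ultimately have "u\<^sup>2 \<le> u powr \<alpha> * 16" using assms by simp
  then have "n powr \<alpha> * u\<^sup>2 \<le> n powr \<alpha> * (u powr \<alpha> * 16)" by (rule mult_left_mono) simp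
  then show ?thesis using assms by (simp add: powr_mult mult_ac)
qed

text \<open>The main term is \<open>n powr \<alpha> * n^2 * (a / 6 + 2 / 3)\<close>: its
  \<open>a / 6\<close> stems from the \<open>n^2 / 6\<close> in \<open>2 - q\<close>, and
  \<open>a \<ge> - 2 - 2 * p\<close> keeps the bracket above \<open>1 / 3\<close> up to
  \<open>p\<close>. Everything else is small with \<open>p\<close>, \<open>Om\<close>,
  \<open>\<alpha>\<close> or one of the products.\<close>

lemma bounce_estimate:
  fixes n u w a q Om p m \<alpha> k :: real
  assumes pos: "0 < n" "0 < u" "0 < w" and le: "n \<le> 4" "u \<le> 4" "w \<le> 4"
    and \<alpha>: "0 < \<alpha>" "\<alpha> \<le> 1" and a: "\<bar>a\<bar> \<le> 2 + 2 * p" and p: "p \<le> 1 / 20"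
    and p_eq: "p = (n * u + u * w + w * n) / 6" and m: "m = (n\<^sup>2 + u\<^sup>2 + w\<^sup>2) / 12"
    and q: "2 - q = 2 * m - 2 * p + k * Om" "0 \<le> q" "q \<le> 5" and k: "0 \<le> k" "k \<le> 2" and Om: "0 \<le> Om"
  shows "n\<^sup>2 / 3 - 100 * \<alpha> - 60 * p - 20 * Om - 16 * (n * u) powr \<alpha> - 16 * (n * w) powr \<alpha>
     \<le> n powr \<alpha> * ((2 - q) * a + (n * (2 * n - u - w) - (u - w)\<^sup>2) / 3 - \<alpha> * ((q + 2 * a) * a))"
proof -
  define z where "z = n powr \<alpha>"
  have z: "0 \<le> z" "z \<le> 4" using powr_le_4 pos le \<alpha> by (auto simp: z_def)
  have p0: "0 \<le> p" using pos by (simp add: p_eq add_nonneg_nonneg)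
  have a1: "\<bar>a\<bar> \<le> 21 / 10" using a p by simp
  have n2: "n\<^sup>2 \<le> 16" using le pos power_mono[of n 4 2] by simp
  have zu: "z * u\<^sup>2 \<le> 16 * (n * u) powr \<alpha>" "z * w\<^sup>2 \<le> 16 * (n * w) powr \<alpha>"
    unfolding z_def using powr_square_le pos le \<alpha> by auto
  have zn: "n\<^sup>2 - z * n\<^sup>2 \<le> \<alpha>" unfolding z_def by (rule square_powr_gap) (use pos \<alpha> in auto)
  have id: "z * ((2 - q) * a + (n * (2 * n - u - w) - (u - w)\<^sup>2) / 3 - \<alpha> * ((q + 2 * a) * a))
     = z * n\<^sup>2 * (a / 6 + 2 / 3) + z * (u\<^sup>2 + w\<^sup>2) * (a / 6) - 2 * (z * p * a) + k * (z * Om * a)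
       - z * (n * (u + w)) / 3 - z * (u - w)\<^sup>2 / 3 - \<alpha> * (z * ((q + 2 * a) * a))"
    unfolding q m by (simp add: power2_eq_square field_simps)
  have "z * n\<^sup>2 * (1 / 3 - p / 3) \<le> z * n\<^sup>2 * (a / 6 + 2 / 3)" using a z by (intro mult_left_mono) auto
  moreover have "z * n\<^sup>2 * p \<le> 64 * p" using z n2 p0 mult_mono[of z 4 "n\<^sup>2" 16] by (intro mult_right_mono) auto
  moreover have "z * n\<^sup>2 * (1 / 3 - p / 3) = z * n\<^sup>2 / 3 - z * n\<^sup>2 * p / 3" by (simp add: algebra_simps)
  ultimately have 1: "n\<^sup>2 / 3 - \<alpha> / 3 - 22 * p \<le> z * n\<^sup>2 * (a / 6 + 2 / 3)" using zn p0 by linarith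
  have "\<bar>z * (u\<^sup>2 + w\<^sup>2) * (a / 6)\<bar> \<le> z * (u\<^sup>2 + w\<^sup>2) * (2 / 5)"
    unfolding abs_mult using a1 z by (intro mult_mono) auto
  then have 2: "- (2 / 5 * (z * u\<^sup>2) + 2 / 5 * (z * w\<^sup>2)) \<le> z * (u\<^sup>2 + w\<^sup>2) * (a / 6)"
    by (simp add: abs_le_iff algebra_simps)
  have "\<bar>z * p * a\<bar> \<le> 4 * p * (21 / 10)" unfolding abs_mult using a1 z p0 by (intro mult_mono) auto
  then have 3: "2 * (z * p * a) \<le> 17 * p" using p0 by (simp add: abs_le_iff)
  have "\<bar>k * (z * Om * a)\<bar> \<le> 2 * (4 * Om * (21 / 10))" unfolding abs_mult using a1 z Om k by (intro mult_mono) auto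
  then have 4: "- 17 * Om \<le> k * (z * Om * a)" using Om by (simp add: abs_le_iff)
  have "n * (u + w) \<le> 6 * p" using pos by (simp add: p_eq algebra_simps)
  then have 5: "z * (n * (u + w)) \<le> 4 * (6 * p)" by (rule mult_mono[OF z(2)]) (use pos in auto)
  have "(u - w)\<^sup>2 \<le> u\<^sup>2 + w\<^sup>2" using pos by (simp add: power2_eq_square algebra_simps)
  then have "z * (u - w)\<^sup>2 \<le> z * (u\<^sup>2 + w\<^sup>2)" using z by (intro mult_left_mono) auto
  then have 6: "z * (u - w)\<^sup>2 \<le> z * u\<^sup>2 + z * w\<^sup>2" by (simp add: algebra_simps)
  have "\<bar>z * ((q + 2 * a) * a)\<bar> \<le> 4 * ((5 + 2 * (21 / 10)) * (21 / 10))"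
  proof -
    have "\<bar>q + 2 * a\<bar> \<le> 5 + 2 * (21 / 10)" using a1 q(2,3) by linarith
    then show ?thesis unfolding abs_mult using a1 z by (intro mult_mono) auto
  qed
  then have "z * ((q + 2 * a) * a) \<le> 80" by (simp add: abs_le_iff)
  then have 7: "\<alpha> * (z * ((q + 2 * a) * a)) \<le> \<alpha> * 80" using \<alpha> by (intro mult_left_mono) auto
  have 8: "0 \<le> z * u\<^sup>2" "0 \<le> z * w\<^sup>2" using z by simp_all
  show ?thesis unfolding z_def[symmetric] id using 1 2 3 4 5 6 7 8 zu \<alpha> p0 Om by linarith
qed

locale bianchi_small = bianchi +
  assumes n12: "((\<lambda>t. n1 t * n2 t) \<longlongrightarrow> 0) at_top"
    and n23: "((\<lambda>t. n2 t * n3 t) \<longlongrightarrow> 0) at_top"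
    and n31: "((\<lambda>t. n3 t * n1 t) \<longlongrightarrow> 0) at_top"
begin

lemma rotate_small: "bianchi_small \<mu> H q Om s2 s3 s1 n2 n3 n1"
  using rotate n12 n23 n31 by (simp add: bianchi_small_def bianchi_small_axioms_def)

definition pi' where "pi' t = (n1 t * n2 t + n2 t * n3 t + n3 t * n1 t) / 6"
definition A where "A t = ((s1 t)\<^sup>2 + (s2 t)\<^sup>2 + (s3 t)\<^sup>2) / 6"
definition m where "m t = ((n1 t)\<^sup>2 + (n2 t)\<^sup>2 + (n3 t)\<^sup>2) / 12"
definition \<kappa> where "\<kappa> = 2 - 2 * \<mu>"
definition tame where "tame t \<longleftrightarrow> 0 < t \<and> pi' t \<le> 1 / 20"

lemma kappa: "0 < \<kappa>" "\<kappa> < 2" using mu_pos mu_less by (simp_all add: \<kappa>_def)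

lemma pi'_tendsto: "(pi' \<longlongrightarrow> 0) at_top"
proof -
  have "((\<lambda>t. (n1 t * n2 t + n2 t * n3 t + n3 t * n1 t) / 6) \<longlongrightarrow> (0 + 0 + 0) / 6) at_top"
    by (intro tendsto_intros n12 n23 n31) simp
  then show ?thesis by (simp add: pi'_def[abs_def])
qed

lemma pi'_pos: "0 < t \<Longrightarrow> 0 < pi' t"
  using n_pos[of t] by (simp add: pi'_def add_pos_pos)

lemma A_m_nonneg: "0 \<le> A t" "0 \<le> m t" by (simp_all add: A_def m_def)

lemma constraint': "0 < t \<Longrightarrow> A t + m t + Om t = 1 + pi' t"
  using Om_eq[of t] by (simp add: A_def m_def pi'_def)

lemma q_A: "0 < t \<Longrightarrow> q t = 2 * A t + 2 * \<mu> * Om t"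
  using q_eq[of t] by (simp add: A_def)

lemma two_minus_q': "0 < t \<Longrightarrow> 2 - q t = 2 * m t - 2 * pi' t + \<kappa> * Om t"
  using constraint'[of t] q_A[of t] unfolding \<kappa>_def by (simp add: algebra_simps)

lemma Om_rate_eq: "0 < t \<Longrightarrow> 4 * \<mu> - 2 * q t = - 2 * \<kappa> + 4 * m t - 4 * pi' t + 2 * \<kappa> * Om t"
  using two_minus_q'[of t] unfolding \<kappa>_def by (simp add: algebra_simps)

lemma eventually_tame: "\<forall>\<^sub>F t in at_top. tame t"
proof -
  have "\<forall>\<^sub>F t in at_top. pi' t < 1 / 20" by (rule order_tendstoD(2)[OF pi'_tendsto]) simp
  then show ?thesis using eventually_gt_at_top[of 0] by eventually_elim (simp add: tame_def)
qed

lemma H_tendsto: "(H \<longlongrightarrow> 1) at_top"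
proof -
  have "((\<lambda>t. sqrt (1 / (1 + pi' t))) \<longlongrightarrow> sqrt (1 / (1 + 0))) at_top"
    by (intro tendsto_intros pi'_tendsto) simp
  moreover have "\<forall>\<^sub>F t in at_top. sqrt (1 / (1 + pi' t)) = H t"
    using eventually_gt_at_top[of 0]
  proof eventually_elim
    case (elim t)
    have "(H t)\<^sup>2 * (1 + pi' t) = 1" using H_eq[OF elim] by (simp add: pi'_def)
    then have "1 / (1 + pi' t) = (H t)\<^sup>2" using pi'_pos[OF elim] by (simp add: field_simps)
    then show ?case using H_pos[OF elim] by simp
  qed
  ultimately show ?thesis by (simp add: Lim_transform_eventually)
qed

lemma s_le:
  assumes "0 < t"
  shows "(s1 t)\<^sup>2 \<le> 4 * A t" "(s2 t)\<^sup>2 \<le> 4 * A t" "(s3 t)\<^sup>2 \<le> 4 * A t"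
proof -
  have "a\<^sup>2 \<le> 4 * ((a\<^sup>2 + b\<^sup>2 + c\<^sup>2) / 6)" if "a + b + c = 0" for a b c :: real
  proof -
    have a: "a = - b - c" using that by simp
    have "0 \<le> (b - c)\<^sup>2" by simp
    then show ?thesis unfolding a by (simp add: power2_eq_square algebra_simps del: zero_le_square)
  qed
  from this[of "s1 t" "s2 t" "s3 t"] this[of "s2 t" "s3 t" "s1 t"] this[of "s3 t" "s1 t" "s2 t"]
  show "(s1 t)\<^sup>2 \<le> 4 * A t" "(s2 t)\<^sup>2 \<le> 4 * A t" "(s3 t)\<^sup>2 \<le> 4 * A t"
    using s_sum[OF assms] by (simp_all add: A_def algebra_simps)
qed

lemma tame_bounds:
  assumes "tame t"
  shows "A t \<le> 21 / 20" "m t \<le> 21 / 20" "Om t \<le> 21 / 20" "0 \<le> q t" "q t \<le> 5"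
    "\<bar>s1 t\<bar> \<le> 2 + 2 * pi' t" "\<bar>s2 t\<bar> \<le> 2 + 2 * pi' t" "\<bar>s3 t\<bar> \<le> 2 + 2 * pi' t"
    "n1 t \<le> 4" "n2 t \<le> 4" "n3 t \<le> 4" "1 / 2 \<le> H t" "H t \<le> 1"
proof -
  have t: "0 < t" and p: "pi' t \<le> 1 / 20" using assms by (auto simp: tame_def)
  note c = constraint'[OF t] and nn = A_m_nonneg[of t] and O = Om_nonneg[OF t] and p0 = pi'_pos[OF t]
  show A: "A t \<le> 21 / 20" and m: "m t \<le> 21 / 20" and "Om t \<le> 21 / 20" using c nn O p by auto
  show "0 \<le> q t" by (rule q_nonneg[OF t])
  have "\<mu> * Om t \<le> 1 * (21 / 20)" using mu_pos mu_less O \<open>Om t \<le> 21 / 20\<close> by (intro mult_mono) auto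
  then show "q t \<le> 5" using q_A[OF t] A by simp
  have s: "\<bar>y\<bar> \<le> 2 + 2 * pi' t" if "y\<^sup>2 \<le> 4 * A t" for y
  proof (rule power2_le_imp_le)
    have "\<bar>y\<bar>\<^sup>2 \<le> 4 * (1 + pi' t)" using that c nn O by simp
    also have "\<dots> \<le> (2 + 2 * pi' t)\<^sup>2" using p0 by (simp add: power2_eq_square algebra_simps)
    finally show "\<bar>y\<bar>\<^sup>2 \<le> (2 + 2 * pi' t)\<^sup>2" .
  qed (use p0 in simp)
  show "\<bar>s1 t\<bar> \<le> 2 + 2 * pi' t" "\<bar>s2 t\<bar> \<le> 2 + 2 * pi' t" "\<bar>s3 t\<bar> \<le> 2 + 2 * pi' t"
    using s s_le[OF t] by auto
  have n: "y \<le> 4" if "y\<^sup>2 \<le> 12 * m t" for y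
  proof (rule power2_le_imp_le)
    show "y\<^sup>2 \<le> 4\<^sup>2" using that m by simp
  qed simp
  show "n1 t \<le> 4" "n2 t \<le> 4" "n3 t \<le> 4" by (rule n, simp add: m_def)+
  have H: "(H t)\<^sup>2 * (1 + pi' t) = 1" using H_eq[OF t] by (simp add: pi'_def)
  then have H2: "(H t)\<^sup>2 = 1 / (1 + pi' t)" using p0 by (simp add: field_simps)
  have "(1 / 2)\<^sup>2 \<le> 1 / (1 + pi' t)" "1 / (1 + pi' t) \<le> 1\<^sup>2"
    using p p0 by (simp_all add: power2_eq_square field_simps)
  then have "(1 / 2)\<^sup>2 \<le> (H t)\<^sup>2" "(H t)\<^sup>2 \<le> 1\<^sup>2" by (simp_all only: H2)
  then show "1 / 2 \<le> H t" "H t \<le> 1"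
    using H_pos[OF t] by (auto intro: power2_le_imp_le simp del: one_power2)
qed

text \<open>The derivative of \<open>ln Om\<close> is \<open>- 2 \<kappa> + 4 m\<close> up to small terms, and \<open>4 m\<close> is not small during a
  transition in which one \<open>n\<^sub>i\<close> is of order 1.  In such a transition the derivative of \<open>B\<close> is about
  \<open>n\<^sub>i\<^sup>2 / 3 = 4 m\<close>, so that \<open>ln Om - B\<close> decreases at a uniform rate.\<close>

definition B where "B \<alpha> t = n1 t powr \<alpha> * s1 t + n2 t powr \<alpha> * s2 t + n3 t powr \<alpha> * s3 t"
definition B_rate where "B_rate \<alpha> t =
    n1 t powr \<alpha> * ((2 - q t) * s1 t + (n1 t * (2 * n1 t - n2 t - n3 t) - (n2 t - n3 t)\<^sup>2) / 3 - \<alpha> * ((q t + 2 * s1 t) * s1 t))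
  + n2 t powr \<alpha> * ((2 - q t) * s2 t + (n2 t * (2 * n2 t - n3 t - n1 t) - (n3 t - n1 t)\<^sup>2) / 3 - \<alpha> * ((q t + 2 * s2 t) * s2 t))
  + n3 t powr \<alpha> * ((2 - q t) * s3 t + (n3 t * (2 * n3 t - n1 t - n2 t) - (n1 t - n2 t)\<^sup>2) / 3 - \<alpha> * ((q t + 2 * s3 t) * s3 t))"

lemma D_powr:
  assumes "0 < t"
  shows "((\<lambda>t. n1 t powr \<alpha>) has_real_derivative H t * (- \<alpha> * n1 t powr \<alpha> * (q t + 2 * s1 t))) (at t)"
    "((\<lambda>t. n2 t powr \<alpha>) has_real_derivative H t * (- \<alpha> * n2 t powr \<alpha> * (q t + 2 * s2 t))) (at t)"
    "((\<lambda>t. n3 t powr \<alpha>) has_real_derivative H t * (- \<alpha> * n3 t powr \<alpha> * (q t + 2 * s3 t))) (at t)"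
  using DERIV_fun_powr[OF D_n1[OF assms] n_pos(1)[OF assms], of \<alpha>]
    DERIV_fun_powr[OF D_n2[OF assms] n_pos(2)[OF assms], of \<alpha>]
    DERIV_fun_powr[OF D_n3[OF assms] n_pos(3)[OF assms], of \<alpha>] n_pos[OF assms]
  by (auto elim!: DERIV_cong simp: powr_diff field_simps)

lemma D_B: "0 < t \<Longrightarrow> (B \<alpha> has_real_derivative H t * B_rate \<alpha> t) (at t)"
  unfolding B_def[abs_def] B_rate_def
  by (rule derivative_eq_intros D_powr D_s1 D_s2 D_s3 refl | assumption | simp add: algebra_simps)+

lemma B_abs:
  assumes "tame t" "0 < \<alpha>" "\<alpha> \<le> 1"
  shows "\<bar>B \<alpha> t\<bar> \<le> 26"
proof -
  have t: "0 < t" and p: "pi' t \<le> 1 / 20" using assms by (auto simp: tame_def)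
  note b = tame_bounds[OF assms(1)] and n = n_pos[OF t]
  have "\<bar>y powr \<alpha> * a\<bar> \<le> 4 * (21 / 10)" if "0 < y" "y \<le> 4" "\<bar>a\<bar> \<le> 2 + 2 * pi' t" for y a
    unfolding abs_mult using powr_le_4[OF that(1,2) assms(2,3)] that(3) p by (intro mult_mono) auto
  note z = this[OF n(1) b(9) b(6)] this[OF n(2) b(10) b(7)] this[OF n(3) b(11) b(8)]
  show ?thesis unfolding B_def using z by linarith
qed

definition pp where "pp \<alpha> t = 180 * pi' t
  + 32 * (n1 t * n2 t) powr \<alpha> + 32 * (n2 t * n3 t) powr \<alpha> + 32 * (n3 t * n1 t) powr \<alpha>"

lemma pp_tendsto: "0 < \<alpha> \<Longrightarrow> (pp \<alpha> \<longlongrightarrow> 0) at_top"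
proof -
  assume \<alpha>: "0 < \<alpha>"
  have nn: "\<forall>\<^sub>F t in at_top. 0 \<le> n1 t * n2 t" "\<forall>\<^sub>F t in at_top. 0 \<le> n2 t * n3 t" "\<forall>\<^sub>F t in at_top. 0 \<le> n3 t * n1 t"
    using eventually_gt_at_top[of 0] by (eventually_elim, use n_pos in \<open>simp add: less_imp_le\<close>)+
  have "(pp \<alpha> \<longlongrightarrow> 180 * 0 + 32 * 0 + 32 * 0 + 32 * 0) at_top"
    unfolding pp_def[abs_def]
    using tendsto_zero_powrI[OF n12 tendsto_const[of \<alpha>] nn(1) \<alpha>]
      tendsto_zero_powrI[OF n23 tendsto_const[of \<alpha>] nn(2) \<alpha>]
      tendsto_zero_powrI[OF n31 tendsto_const[of \<alpha>] nn(3) \<alpha>]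
    by (intro tendsto_intros pi'_tendsto) auto
  then show ?thesis by simp
qed

lemma B_rate_ge:
  assumes "tame t" "0 < \<alpha>" "\<alpha> \<le> 1"
  shows "4 * m t - 300 * \<alpha> - 60 * Om t - pp \<alpha> t \<le> B_rate \<alpha> t"
proof -
  have t: "0 < t" and p: "pi' t \<le> 1 / 20" using assms by (auto simp: tame_def)
  note b = tame_bounds[OF assms(1)] and n = n_pos[OF t] and q2 = two_minus_q'[OF t] and O = Om_nonneg[OF t]
  have k: "0 \<le> \<kappa>" "\<kappa> \<le> 2" using kappa by auto
  have e: "pi' t = (n2 t * n3 t + n3 t * n1 t + n1 t * n2 t) / 6" "pi' t = (n3 t * n1 t + n1 t * n2 t + n2 t * n3 t) / 6"
    "m t = ((n2 t)\<^sup>2 + (n3 t)\<^sup>2 + (n1 t)\<^sup>2) / 12" "m t = ((n3 t)\<^sup>2 + (n1 t)\<^sup>2 + (n2 t)\<^sup>2) / 12"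
    by (simp_all add: pi'_def m_def)
  have c: "n2 t * n1 t = n1 t * n2 t" "n3 t * n2 t = n2 t * n3 t" "n1 t * n3 t = n3 t * n1 t" by simp_all
  note z1 = bounce_estimate[OF n(1) n(2) n(3) b(9) b(10) b(11) assms(2,3) b(6) p pi'_def m_def q2 b(4,5) k O]
  note z2 = bounce_estimate[OF n(2) n(3) n(1) b(10) b(11) b(9) assms(2,3) b(7) p e(1) e(3) q2 b(4,5) k O]
  note z3 = bounce_estimate[OF n(3) n(1) n(2) b(11) b(9) b(10) assms(2,3) b(8) p e(2) e(4) q2 b(4,5) k O]
  have m4: "4 * m t = (n1 t)\<^sup>2 / 3 + (n2 t)\<^sup>2 / 3 + (n3 t)\<^sup>2 / 3" by (simp add: m_def)
  show ?thesis unfolding B_rate_def m4 pp_def using z1 z2 z3 unfolding c by linarith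
qed

text \<open>\<open>Om * exp (- B \<alpha>)\<close> is comparable to \<open>Om\<close> because
  \<open>B\<close> is bounded, and it decays as long as \<open>Om \<le> w\<close>. A single
  sufficiently small late value of \<open>Om\<close> therefore starts an exponential decay that
  never stops.\<close>

lemma Om_dichotomy: "(Om \<longlongrightarrow> 0) at_top \<or> (\<exists>\<omega>>0. \<forall>\<^sub>F t in at_top. \<omega> \<le> Om t)"
proof (rule disjCI)
  assume n: "\<not> (\<exists>\<omega>>0. \<forall>\<^sub>F t in at_top. \<omega> \<le> Om t)"
  \<comment> \<open>Budget: of the decay rate \<open>2 * \<kappa>\<close>, the term
    \<open>300 * \<alpha>\<close> takes \<open>\<kappa> / 2\<close>, \<open>pp\<close> at most
    \<open>\<kappa> / 4\<close>, and the terms in \<open>Om\<close> at most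
    \<open>64 * w < \<kappa> / 4\<close>. The rate \<open>\<kappa>\<close> is left.\<close>
  define \<alpha> where "\<alpha> = \<kappa> / 600"
  have \<alpha>: "0 < \<alpha>" "\<alpha> \<le> 1" using kappa by (auto simp: \<alpha>_def)
  have "\<forall>\<^sub>F t in at_top. tame t \<and> pp \<alpha> t < \<kappa> / 4"
    using kappa by (intro eventually_conj eventually_tame order_tendstoD(2)[OF pp_tendsto[OF \<alpha>(1)]]) auto
  then obtain T where T: "\<And>t. T \<le> t \<Longrightarrow> tame t \<and> pp \<alpha> t < \<kappa> / 4"
    unfolding eventually_at_top_linorder by blast
  define w where "w = \<kappa> / 260"
  have w: "0 < w" using kappa by (simp add: w_def)
  define f where "f t = Om t * exp (- B \<alpha> t)" for t
  define f' where "f' t = H t * (f t * (4 * \<mu> - 2 * q t - B_rate \<alpha> t))" for t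
  have t0: "0 < t" if "T \<le> t" for t using T[OF that] by (simp add: tame_def)
  have D_f: "(f has_real_derivative f' t) (at t)" if "T \<le> t" for t
    unfolding f_def[abs_def] f'_def
    by (rule derivative_eq_intros D_Om D_B refl t0[OF that] | simp add: algebra_simps)+
  have f0: "0 \<le> f t" if "T \<le> t" for t using Om_nonneg[OF t0[OF that]] by (simp add: f_def)
  have Om_f: "Om t \<le> f t * exp 26" "f t \<le> Om t * exp 26" if "T \<le> t" for t
  proof -
    have B: "\<bar>B \<alpha> t\<bar> \<le> 26" using B_abs[OF _ \<alpha>] T[OF that] by blast
    have "Om t = f t * exp (B \<alpha> t)" by (simp add: f_def exp_minus)
    also have "\<dots> \<le> f t * exp 26" using B f0[OF that] by (intro mult_left_mono) auto
    finally show "Om t \<le> f t * exp 26" .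
    show "f t \<le> Om t * exp 26" unfolding f_def using B Om_nonneg[OF t0[OF that]] by (intro mult_left_mono) auto
  qed
  have f'_le: "f' t \<le> - (\<kappa> / 2) * f t" if t: "T \<le> t" and O: "Om t \<le> w" for t
  proof -
    have "4 * \<mu> - 2 * q t - B_rate \<alpha> t \<le> - 2 * \<kappa> + 2 * \<kappa> * Om t + 300 * \<alpha> + 60 * Om t + pp \<alpha> t"
      using Om_rate_eq[OF t0[OF t]] B_rate_ge[OF _ \<alpha>, of t] T[OF t] pi'_pos[OF t0[OF t]] by linarith
    also have "\<kappa> * Om t \<le> 2 * Om t" using kappa Om_nonneg[OF t0[OF t]] by (intro mult_right_mono) auto
    then have "- 2 * \<kappa> + 2 * \<kappa> * Om t + 300 * \<alpha> + 60 * Om t + pp \<alpha> t \<le> - \<kappa>"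
      using O T[OF t] kappa unfolding w_def \<alpha>_def by simp
    finally have "f t * (4 * \<mu> - 2 * q t - B_rate \<alpha> t) \<le> f t * (- \<kappa>)" using f0[OF t] by (intro mult_left_mono) auto
    then have "H t * (f t * (4 * \<mu> - 2 * q t - B_rate \<alpha> t)) \<le> H t * (f t * (- \<kappa>))"
      by (rule mult_left_mono) (use H_pos[OF t0[OF t]] in simp)
    also have "\<dots> = - (H t * (f t * \<kappa>))" by simp
    also have "\<dots> \<le> - (1 / 2 * (f t * \<kappa>))"
      using mult_right_mono[of "1 / 2" "H t" "f t * \<kappa>"] tame_bounds(12)[of t] T[OF t] f0[OF t] kappa by simp
    finally show ?thesis unfolding f'_def by (simp add: mult.commute)
  qed
  have "\<not> (\<forall>\<^sub>F t in at_top. w * exp (- 53) \<le> Om t)" using n w by auto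
  \<comment> \<open>Passing between \<open>Om\<close> and \<open>f\<close> costs a factor
    \<open>exp 26\<close>. Starting at \<open>w * exp (- 53)\<close> gives
    \<open>f \<le> w * exp (- 27)\<close>, strictly below the level \<open>w * exp (- 26)\<close>
    that still guarantees \<open>Om \<le> w\<close>.\<close>
  then obtain s where s: "T \<le> s" "Om s < w * exp (- 53)"
    unfolding eventually_at_top_linorder by (meson linear not_le)
  have fs: "f s \<le> w * exp (- 27)"
  proof -
    have "f s \<le> Om s * exp 26" by (rule Om_f[OF s(1)])
    also have "\<dots> \<le> w * exp (- 53) * exp 26" using s by (intro mult_right_mono) auto
    also have "\<dots> = w * exp (- 27)" by (simp flip: exp_add add: mult.assoc)
    finally show ?thesis .
  qed
  have below: "f t \<le> w * exp (- 27)" if "s \<le> t" for t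
  proof (rule stays_below_band[of s f f' _ "w * exp (- 26)"])
    show "f' t \<le> 0" if "s \<le> t" "f t \<le> w * exp (- 26)" for t
    proof -
      have tT: "T \<le> t" using that s by simp
      have "Om t \<le> w * exp (- 26) * exp 26"
        by (rule order_trans[OF Om_f(1)[OF tT] mult_right_mono[OF that(2)]]) simp
      also have "\<dots> = w" by (simp flip: exp_add add: mult.assoc)
      finally have "Om t \<le> w" .
      moreover have "0 \<le> \<kappa> / 2 * f t" using kappa f0[OF tT] by simp
      ultimately show ?thesis using f'_le[OF tT] by simp
    qed
  qed (use D_f s fs w that in auto)
  have decay: "f t \<le> f s * exp (- (\<kappa> / 2) * (t - s))" if t: "s \<le> t" for t
  proof -
    have "f t * exp (\<kappa> / 2 * t) \<le> f s * exp (\<kappa> / 2 * s)"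
    proof (rule nonincreasing_if_deriv_nonpos[OF t])
      fix u assume u: "s \<le> u" "u \<le> t"
      then have uT: "T \<le> u" using s by simp
      show "((\<lambda>t. f t * exp (\<kappa> / 2 * t)) has_real_derivative (f' u + \<kappa> / 2 * f u) * exp (\<kappa> / 2 * u)) (at u)"
        by (rule derivative_eq_intros D_f uT refl | simp add: algebra_simps)+
      have "Om u \<le> w * exp (- 27) * exp 26"
        by (rule order_trans[OF Om_f(1)[OF uT] mult_right_mono[OF below[OF u(1)]]]) simp
      also have "\<dots> = w * exp (- 1)" by (simp flip: exp_add add: mult.assoc)
      also have "\<dots> \<le> w" using w by simp
      finally have "f' u + \<kappa> / 2 * f u \<le> 0" using f'_le[OF uT] by simp
      then show "(f' u + \<kappa> / 2 * f u) * exp (\<kappa> / 2 * u) \<le> 0" by (intro mult_nonpos_nonneg) auto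
    qed
    then have "f t \<le> f s * exp (\<kappa> / 2 * s) / exp (\<kappa> / 2 * t)" by (simp add: field_simps)
    also have "\<dots> = f s * exp (- (\<kappa> / 2) * (t - s))"
    proof -
      have "- (\<kappa> / 2) * (t - s) = \<kappa> / 2 * s - \<kappa> / 2 * t" by (simp add: field_simps)
      then show ?thesis by (simp only: exp_diff times_divide_eq_right)
    qed
    finally show ?thesis .
  qed
  show "(Om \<longlongrightarrow> 0) at_top"
  proof (rule tendsto_sandwich[OF _ _ tendsto_const])
    show "\<forall>\<^sub>F t in at_top. 0 \<le> Om t" using eventually_gt_at_top[of 0] by eventually_elim (rule Om_nonneg)
    show "\<forall>\<^sub>F t in at_top. Om t \<le> f s * exp (- (\<kappa> / 2) * (t - s)) * exp 26"
      using eventually_ge_at_top[of s]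
    proof eventually_elim
      case (elim t)
      have "Om t \<le> f t * exp 26" using Om_f(1)[of t] elim s by simp
      also have "\<dots> \<le> f s * exp (- (\<kappa> / 2) * (t - s)) * exp 26" using decay[OF elim] by (rule mult_right_mono) simp
      finally show ?case .
    qed
    show "((\<lambda>t. f s * exp (- (\<kappa> / 2) * (t - s)) * exp 26) \<longlongrightarrow> 0) at_top"
      using kappa by real_asymp
  qed
qed

end

section \<open>Approach to the Friedmann point\<close>

lemma le_one_if_powr_le_one:
  fixes y \<alpha> :: real
  assumes "0 < \<alpha>" "y powr \<alpha> \<le> 1"
  shows "y \<le> 1"
proof (rule ccontr)
  assume "\<not> y \<le> 1"
  then have "1 powr \<alpha> < y powr \<alpha>" using assms by (intro powr_less_mono2) auto
  then show False using assms by simp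
qed

context bianchi_small
begin

text \<open>A small exponent weakens the coupling to the shear: every term of the derivative carries
  the factor \<open>\<alpha>\<close>.\<close>

definition N where "N \<alpha> t = n1 t powr \<alpha> + n2 t powr \<alpha> + n3 t powr \<alpha>"
definition N_rate where "N_rate \<alpha> t = - \<alpha> * n1 t powr \<alpha> * (q t + 2 * s1 t)
   - \<alpha> * n2 t powr \<alpha> * (q t + 2 * s2 t) - \<alpha> * n3 t powr \<alpha> * (q t + 2 * s3 t)"
definition A_rate where "A_rate t = 2 * (2 - q t) * A t
   + (s1 t * ((n1 t * (2 * n1 t - n2 t - n3 t) - (n2 t - n3 t)\<^sup>2) / 3)
    + s2 t * ((n2 t * (2 * n2 t - n3 t - n1 t) - (n3 t - n1 t)\<^sup>2) / 3)
    + s3 t * ((n3 t * (2 * n3 t - n1 t - n2 t) - (n1 t - n2 t)\<^sup>2) / 3)) / 3"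

lemma D_N: "0 < t \<Longrightarrow> (N \<alpha> has_real_derivative H t * N_rate \<alpha> t) (at t)"
  unfolding N_def[abs_def] N_rate_def
  by (rule derivative_eq_intros D_powr refl | assumption | simp add: algebra_simps)+

lemma D_A: "0 < t \<Longrightarrow> (A has_real_derivative H t * A_rate t) (at t)"
proof -
  assume t: "0 < t"
  have "((\<lambda>t. ((s1 t)\<^sup>2 + (s2 t)\<^sup>2 + (s3 t)\<^sup>2) / 6) has_real_derivative
    (2 * s1 t * (H t * ((2 - q t) * s1 t + (n1 t * (2 * n1 t - n2 t - n3 t) - (n2 t - n3 t)\<^sup>2) / 3))
     + 2 * s2 t * (H t * ((2 - q t) * s2 t + (n2 t * (2 * n2 t - n3 t - n1 t) - (n3 t - n1 t)\<^sup>2) / 3))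
     + 2 * s3 t * (H t * ((2 - q t) * s3 t + (n3 t * (2 * n3 t - n1 t - n2 t) - (n1 t - n2 t)\<^sup>2) / 3))) / 6) (at t)"
    by (rule derivative_eq_intros D_s1 D_s2 D_s3 refl t | simp)+
  moreover have "(2 * a * (h * (r * a + x)) + 2 * b * (h * (r * b + y)) + 2 * c * (h * (r * c + z))) / 6
     = h * (2 * r * ((a\<^sup>2 + b\<^sup>2 + c\<^sup>2) / 6) + (a * x + b * y + c * z) / 3)" for a b c x y z h r :: real
    by (simp add: power2_eq_square field_simps)
  ultimately show ?thesis unfolding A_def[abs_def] A_rate_def by simp
qed

lemma curvature_bound:
  fixes n u w a p M :: real
  assumes "0 < n" "0 < u" "0 < w" "p = (n * u + u * w + w * n) / 6" "M = (n\<^sup>2 + u\<^sup>2 + w\<^sup>2) / 12" "\<bar>a\<bar> \<le> 21 / 10"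
  shows "- (26 * M + 10 * p) \<le> a * ((n * (2 * n - u - w) - (u - w)\<^sup>2) / 3)"
proof -
  have nn: "0 \<le> n * u" "0 \<le> u * w" "0 \<le> w * n" "0 \<le> n\<^sup>2" "0 \<le> u\<^sup>2" "0 \<le> w\<^sup>2" using assms by auto
  have e: "(n * (2 * n - u - w) - (u - w)\<^sup>2) / 3 = (2 * n\<^sup>2 - n * u - w * n - u\<^sup>2 - w\<^sup>2 + 2 * (u * w)) / 3"
    by (simp add: power2_eq_square algebra_simps)
  define X where "X = 2 * n\<^sup>2 - n * u - w * n - u\<^sup>2 - w\<^sup>2 + 2 * (u * w)"
  have "n\<^sup>2 + u\<^sup>2 + w\<^sup>2 = 12 * M" "n * u + u * w + w * n = 6 * p" using assms(4,5) by simp_all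
  then have "\<bar>X\<bar> \<le> 24 * M + 12 * p" unfolding X_def using nn by linarith
  then have "\<bar>(n * (2 * n - u - w) - (u - w)\<^sup>2) / 3\<bar> \<le> 8 * M + 4 * p"
    unfolding e X_def[symmetric] by simp
  from mult_mono[OF assms(6) this]
  have "\<bar>a * ((n * (2 * n - u - w) - (u - w)\<^sup>2) / 3)\<bar> \<le> 21 / 10 * (8 * M + 4 * p)"
    unfolding abs_mult by simp
  moreover have "0 \<le> M" unfolding assms(5) by simp
  moreover have "0 \<le> p" unfolding assms(4) using nn by simp
  ultimately show ?thesis by (simp add: abs_le_iff)
qed

text \<open>In the presence of matter \<open>2 - q\<close> is at least \<open>\<kappa> * w\<close>
  up to \<open>pi'\<close>, so the shear grows; curvature opposes this only in proportion to
  \<open>m\<close>.\<close>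

lemma A_rate_ge:
  assumes "tame t" "0 \<le> w" "w \<le> Om t"
  shows "2 * \<kappa> * w * A t - 26 * m t - 15 * pi' t \<le> A_rate t"
proof -
  have t: "0 < t" and p: "pi' t \<le> 1 / 20" using assms by (auto simp: tame_def)
  note b = tame_bounds[OF assms(1)] and n = n_pos[OF t] and p0 = pi'_pos[OF t] and A0 = A_m_nonneg[of t]
  have e: "pi' t = (n2 t * n3 t + n3 t * n1 t + n1 t * n2 t) / 6" "pi' t = (n3 t * n1 t + n1 t * n2 t + n2 t * n3 t) / 6"
    "m t = ((n2 t)\<^sup>2 + (n3 t)\<^sup>2 + (n1 t)\<^sup>2) / 12" "m t = ((n3 t)\<^sup>2 + (n1 t)\<^sup>2 + (n2 t)\<^sup>2) / 12"
    by (simp_all add: pi'_def m_def)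
  have a: "\<bar>s1 t\<bar> \<le> 21 / 10" "\<bar>s2 t\<bar> \<le> 21 / 10" "\<bar>s3 t\<bar> \<le> 21 / 10" using b(6-8) p by auto
  note z = curvature_bound[OF n(1) n(2) n(3) pi'_def m_def a(1)]
    curvature_bound[OF n(2) n(3) n(1) e(1) e(3) a(2)] curvature_bound[OF n(3) n(1) n(2) e(2) e(4) a(3)]
  have "\<kappa> * w \<le> \<kappa> * Om t" using assms kappa by (intro mult_left_mono) auto
  then have "\<kappa> * w - 2 * pi' t \<le> 2 - q t" using two_minus_q'[OF t] A0 by linarith
  then have "(\<kappa> * w - 2 * pi' t) * A t \<le> (2 - q t) * A t" using A0 by (intro mult_right_mono) auto
  then have "\<kappa> * w * A t - 2 * (pi' t * A t) \<le> (2 - q t) * A t" by (simp add: left_diff_distrib)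
  moreover have "pi' t * A t \<le> pi' t * (21 / 20)" using b(1) p0 by (intro mult_left_mono) auto
  moreover have "2 * (2 - q t) * A t = 2 * ((2 - q t) * A t)" "2 * \<kappa> * w * A t = 2 * (\<kappa> * w * A t)" by simp_all
  ultimately have "2 * \<kappa> * w * A t - 5 * pi' t \<le> 2 * (2 - q t) * A t" using p0 by linarith
  moreover have "- c \<le> (x + y + z) / 3" if "- c \<le> x" "- c \<le> y" "- c \<le> z" for c x y z :: real
    using that by simp
  note this[OF z]
  ultimately show ?thesis unfolding A_rate_def using p0 by linarith
qed

text \<open>\<open>N\<close> is damped because \<open>q \<ge> q0\<close>, and the shear grows; so
  both parts of \<open>N - \<epsilon> * A\<close> decrease. The condition on \<open>\<alpha>\<close>
  lets half of the shear growth pay for the coupling of \<open>N\<close> to the shear, the one on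
  \<open>\<epsilon>\<close> lets part of the damping pay for the curvature term in
  \<open>A_rate\<close>.\<close>

lemma friedmann_rate:
  assumes "tame t" "0 < w" "w \<le> Om t" and \<alpha>: "0 < \<alpha>" "\<alpha> \<le> 1" "16 * \<alpha> \<le> \<kappa> * \<mu> * w\<^sup>2"
    and \<epsilon>: "0 < \<epsilon>" "\<epsilon> \<le> 1 / 2" "9 * \<epsilon>\<^sup>2 \<le> \<alpha> * \<mu> * w" and N: "N \<alpha> t \<le> 2 * \<epsilon>"
  shows "N_rate \<alpha> t - \<epsilon> * A_rate t \<le> - \<alpha> * \<mu> * w * N \<alpha> t - \<epsilon> * \<kappa> * w * A t + 15 * pi' t"
proof -
  have t: "0 < t" and p: "pi' t \<le> 1 / 20" using assms by (auto simp: tame_def)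
  note b = tame_bounds[OF assms(1)] and n = n_pos[OF t] and p0 = pi'_pos[OF t] and A0 = A_m_nonneg[of t]
  define q0 where "q0 = 2 * \<mu> * w"
  have q0: "0 < q0" using mu_pos assms by (simp add: q0_def)
  have "\<mu> * w \<le> \<mu> * Om t" using mu_pos assms by (intro mult_left_mono) auto
  then have q: "q0 \<le> q t" using q_A[OF t] A0 by (simp add: q0_def)
  \<comment> \<open>Young's inequality splits \<open>2 * \<bar>a\<bar>\<close> into a quarter of
    \<open>q0\<close> and a multiple of \<open>A / q0\<close>.\<close>
  have per: "- \<alpha> * y powr \<alpha> * (q t + 2 * a) \<le> \<alpha> * (y powr \<alpha> * (- (3 / 4) * q0 + 16 * A t / q0))"
    if "a\<^sup>2 \<le> 4 * A t" for a y
  proof -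
    have "0 \<le> (q0 / 2 - 2 * \<bar>a\<bar>)\<^sup>2" by simp
    then have "2 * (q0 * \<bar>a\<bar>) \<le> q0\<^sup>2 / 4 + 4 * a\<^sup>2"
      by (simp add: power2_eq_square algebra_simps del: zero_le_square)
    then have "2 * (q0 * \<bar>a\<bar>) \<le> q0\<^sup>2 / 4 + 16 * A t" using that by linarith
    then have "2 * \<bar>a\<bar> \<le> q0 / 4 + 16 * A t / q0" using q0 by (simp add: field_simps power2_eq_square)
    then have "- (q t + 2 * a) \<le> - (3 / 4) * q0 + 16 * A t / q0" using q by linarith
    then have "\<alpha> * y powr \<alpha> * (- (q t + 2 * a)) \<le> \<alpha> * y powr \<alpha> * (- (3 / 4) * q0 + 16 * A t / q0)"
      using \<alpha> by (intro mult_left_mono) auto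
    moreover have "- \<alpha> * y powr \<alpha> * (q t + 2 * a) = \<alpha> * y powr \<alpha> * (- (q t + 2 * a))" by (simp add: algebra_simps)
    ultimately show ?thesis by (simp only: mult.assoc)
  qed
  \<comment> \<open>As \<open>y \<le> 1\<close> and \<open>2 - \<alpha> \<ge> \<alpha>\<close>, the
    square is at most \<open>(y powr \<alpha>)^2\<close>; so \<open>m\<close> is of second order in
    \<open>N\<close>.\<close>
  have nle: "y\<^sup>2 \<le> 2 * \<epsilon> * y powr \<alpha>" if y: "0 < y" "y powr \<alpha> \<le> N \<alpha> t" for y
  proof -
    have ya: "y powr \<alpha> \<le> 2 * \<epsilon>" using y N by simp
    have y1: "y \<le> 1" by (rule le_one_if_powr_le_one[OF \<alpha>(1)]) (use ya \<epsilon> in simp)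
    have "y powr 2 = y powr \<alpha> * y powr (2 - \<alpha>)" by (simp flip: powr_add)
    then have "y\<^sup>2 = y powr \<alpha> * y powr (2 - \<alpha>)" using y(1) by simp
    also have "\<dots> \<le> y powr \<alpha> * y powr \<alpha>" using y(1) y1 \<alpha> by (intro mult_left_mono powr_mono') auto
    also have "\<dots> \<le> y powr \<alpha> * (2 * \<epsilon>)" using ya by (intro mult_left_mono) auto
    finally show ?thesis by (simp add: mult.commute)
  qed
  have m: "m t \<le> \<epsilon> * N \<alpha> t / 6"
  proof -
    have "(n1 t)\<^sup>2 \<le> 2 * \<epsilon> * n1 t powr \<alpha>" "(n2 t)\<^sup>2 \<le> 2 * \<epsilon> * n2 t powr \<alpha>" "(n3 t)\<^sup>2 \<le> 2 * \<epsilon> * n3 t powr \<alpha>"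
      by (rule nle; use n in \<open>simp add: N_def\<close>)+
    then show ?thesis by (simp add: m_def N_def algebra_simps)
  qed
  have N0: "0 \<le> N \<alpha> t" by (simp add: N_def)
  have "N_rate \<alpha> t \<le> \<alpha> * (N \<alpha> t * (- (3 / 4) * q0 + 16 * A t / q0))"
  proof -
    define c where "c = - (3 / 4) * q0 + 16 * A t / q0"
    have "\<alpha> * (N \<alpha> t * c) = \<alpha> * (n1 t powr \<alpha> * c) + \<alpha> * (n2 t powr \<alpha> * c) + \<alpha> * (n3 t powr \<alpha> * c)"
      by (simp add: N_def algebra_simps)
    then show ?thesis
      using per[OF s_le(1)[OF t], of "n1 t"] per[OF s_le(2)[OF t], of "n2 t"] per[OF s_le(3)[OF t], of "n3 t"]
      unfolding N_rate_def c_def[symmetric] by linarith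
  qed
  also have "\<dots> = - (3 / 4) * (\<alpha> * q0 * N \<alpha> t) + 16 * \<alpha> * A t / q0 * N \<alpha> t" by (simp add: algebra_simps)
  also have "16 * \<alpha> * A t / q0 * N \<alpha> t \<le> 16 * \<alpha> * A t / q0 * (2 * \<epsilon>)"
    using N \<alpha> A0 q0 by (intro mult_left_mono) auto
  also have "16 * \<alpha> * A t / q0 * (2 * \<epsilon>) \<le> \<epsilon> * \<kappa> * w * A t"
  proof -
    have "16 * \<alpha> * (2 * \<epsilon> * A t) \<le> \<kappa> * \<mu> * w\<^sup>2 * (2 * \<epsilon> * A t)" using \<alpha>(3) \<epsilon> A0 by (intro mult_right_mono) auto
    also have "\<dots> = \<epsilon> * \<kappa> * w * A t * q0" by (simp add: q0_def power2_eq_square)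
    finally show ?thesis using q0 by (simp add: field_simps)
  qed
  finally have 1: "N_rate \<alpha> t \<le> - (3 / 4) * (\<alpha> * q0 * N \<alpha> t) + \<epsilon> * \<kappa> * w * A t" by simp
  have "\<epsilon> * (2 * \<kappa> * w * A t - 26 * m t - 15 * pi' t) \<le> \<epsilon> * A_rate t"
    using A_rate_ge[OF assms(1) _ assms(3)] assms(2) \<epsilon> by (intro mult_left_mono) auto
  then have 2: "2 * (\<epsilon> * \<kappa> * w * A t) - 26 * (\<epsilon> * m t) - 15 * (\<epsilon> * pi' t) \<le> \<epsilon> * A_rate t"
    by (simp add: algebra_simps)
  have "\<epsilon> * m t \<le> \<epsilon> * (\<epsilon> * N \<alpha> t / 6)" using m \<epsilon> by (intro mult_left_mono) auto
  then have "26 * (\<epsilon> * m t) \<le> 26 / 6 * (\<epsilon>\<^sup>2 * N \<alpha> t)" by (simp add: power2_eq_square algebra_simps)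
  moreover have "9 * \<epsilon>\<^sup>2 * N \<alpha> t \<le> \<alpha> * \<mu> * w * N \<alpha> t" using \<epsilon>(3) N0 by (intro mult_right_mono) auto
  moreover have "\<alpha> * q0 * N \<alpha> t = 2 * (\<alpha> * \<mu> * w * N \<alpha> t)" by (simp add: q0_def)
  moreover have "\<epsilon> * pi' t \<le> pi' t" using \<epsilon> p0 by (intro mult_left_le_one_le) auto
  moreover have "0 \<le> \<epsilon>\<^sup>2 * N \<alpha> t" using N0 by simp
  ultimately show ?thesis using 1 2 by linarith
qed

text \<open>\<open>N - \<epsilon> * A\<close> decreases at a definite rate wherever it is away from
  0 and \<open>N \<le> 2 * \<epsilon>\<close>. After a late time with small \<open>N\<close> it
  cannot rise above \<open>\<theta>\<close>, and once below \<open>- \<theta>\<close> it would fall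
  without bound. So it tends to 0, and two values of \<open>\<epsilon>\<close> separate
  \<open>N\<close> from \<open>A\<close>.\<close>

lemma friedmann_case:
  assumes w: "0 < w" "\<forall>\<^sub>F t in at_top. w \<le> Om t"
    and \<alpha>: "0 < \<alpha>" "\<alpha> \<le> 1" "16 * \<alpha> \<le> \<kappa> * \<mu> * w\<^sup>2"
    and N: "\<not> (\<exists>\<nu>>0. \<forall>\<^sub>F t in at_top. \<nu> \<le> N \<alpha> t)"
  shows "(N \<alpha> \<longlongrightarrow> 0) at_top" "(A \<longlongrightarrow> 0) at_top"
proof -
  have lim: "((\<lambda>t. N \<alpha> t - \<epsilon> * A t) \<longlongrightarrow> 0) at_top"
    if \<epsilon>: "0 < \<epsilon>" "\<epsilon> \<le> 1 / 2" "9 * \<epsilon>\<^sup>2 \<le> \<alpha> * \<mu> * w" for \<epsilon>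
  proof (rule tendstoI)
    fix e :: real assume e: "0 < e"
    define \<theta> where "\<theta> = min (e / 2) (\<epsilon> / 2)"
    have \<theta>: "0 < \<theta>" "\<theta> < e" "\<theta> \<le> \<epsilon> / 2" using e \<epsilon> by (auto simp: \<theta>_def)
    define k where "k = min (\<alpha> * \<mu> * w * \<theta>) (\<kappa> * w * \<theta>) / 2"
    have k: "0 < k" using \<alpha> mu_pos w \<theta> kappa by (simp add: k_def)
    have "\<forall>\<^sub>F t in at_top. tame t \<and> w \<le> Om t \<and> pi' t < k / 15"
      using k by (intro eventually_conj eventually_tame w(2) order_tendstoD(2)[OF pi'_tendsto]) auto
    then obtain T where T: "\<And>t. T \<le> t \<Longrightarrow> tame t \<and> w \<le> Om t \<and> pi' t < k / 15"
      unfolding eventually_at_top_linorder by blast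
    define f where "f t = N \<alpha> t - \<epsilon> * A t" for t
    define f' where "f' t = H t * (N_rate \<alpha> t - \<epsilon> * A_rate t)" for t
    have t0: "0 < t" if "T \<le> t" for t using T[OF that] by (simp add: tame_def)
    have D_f: "(f has_real_derivative f' t) (at t)" if "T \<le> t" for t
      unfolding f_def[abs_def] f'_def
      by (rule derivative_eq_intros D_N D_A refl t0[OF that] | simp add: algebra_simps)+
    have N0: "0 \<le> N \<alpha> t" for t by (simp add: N_def)
    have rate: "N_rate \<alpha> t - \<epsilon> * A_rate t \<le> - \<alpha> * \<mu> * w * N \<alpha> t - \<epsilon> * \<kappa> * w * A t + k"
      if "T \<le> t" "N \<alpha> t \<le> 2 * \<epsilon>" for t
      using friedmann_rate[OF _ w(1) _ \<alpha> \<epsilon> that(2)] T[OF that(1)] by fastforce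
    have A1: "\<epsilon> * A t \<le> 21 / 20 * \<epsilon>" if "T \<le> t" for t
      using tame_bounds(1)[of t] T[OF that] \<epsilon> by (simp add: mult.commute)
    have nonneg: "0 \<le> \<epsilon> * \<kappa> * w * A t" "0 \<le> \<alpha> * \<mu> * w * N \<alpha> t" for t
      using \<epsilon> kappa w A_m_nonneg[of t] \<alpha> mu_pos N0[of t] by auto
    obtain s where s: "T \<le> s" "N \<alpha> s < \<theta>"
      using N \<theta>(1) unfolding eventually_at_top_linorder by (meson linear not_le)
    \<comment> \<open>On the band, \<open>f \<le> 3 / 4 * \<epsilon>\<close> and
      \<open>\<epsilon> * A \<le> 21 / 20 * \<epsilon>\<close> give
      \<open>N \<le> 2 * \<epsilon>\<close>, the range in which the rate estimate holds.\<close>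
    have upper: "f t \<le> \<theta>" if "s \<le> t" for t
    proof (rule stays_below_band[of s f f' \<theta> "3 / 4 * \<epsilon>"])
      show "f s \<le> \<theta>"
        using s A_m_nonneg[of s] \<epsilon> mult_nonneg_nonneg[of \<epsilon> "A s"] unfolding f_def by linarith
      show "\<theta> < 3 / 4 * \<epsilon>" using \<theta> \<epsilon> by simp
      show "f' t \<le> 0" if t: "s \<le> t" "\<theta> \<le> f t" "f t \<le> 3 / 4 * \<epsilon>" for t
      proof -
        have tT: "T \<le> t" using t s by simp
        have "N \<alpha> t \<le> 2 * \<epsilon>" using t(3) A1[OF tT] \<epsilon> unfolding f_def by linarith
        note r = rate[OF tT this]
        have "\<theta> \<le> N \<alpha> t" using t(2) A_m_nonneg[of t] \<epsilon> mult_nonneg_nonneg[of \<epsilon> "A t"] unfolding f_def by linarith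
        then have "\<alpha> * \<mu> * w * \<theta> \<le> \<alpha> * \<mu> * w * N \<alpha> t" using \<alpha> mu_pos w by (intro mult_left_mono) auto
        moreover have "2 * k \<le> \<alpha> * \<mu> * w * \<theta>" by (simp add: k_def)
        ultimately have "N_rate \<alpha> t - \<epsilon> * A_rate t \<le> 0" using r nonneg(1)[of t] k by linarith
        then show ?thesis unfolding f'_def using H_pos[OF t0[OF tT]] by (intro mult_nonneg_nonpos) auto
      qed
    qed (use D_f s that in auto)
    have lower: "- \<theta> \<le> f t" if st: "s \<le> t" for t
    proof (rule ccontr)
      assume c: "\<not> - \<theta> \<le> f t"
      show False
      proof (rule trapped_below_unbounded[of t f f' "- \<theta>" "k / 2" "- (21 / 20 * \<epsilon>)"])
        show "(f has_real_derivative f' u) (at u)" if "t \<le> u" for u using D_f that s st by simp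
        show "f t < - \<theta>" using c by simp
        show "f' u \<le> - (k / 2)" if u: "t \<le> u" "f u < - \<theta>" for u
        proof -
          have uT: "T \<le> u" using u st s by simp
          have "N \<alpha> u \<le> 2 * \<epsilon>" using u(2) A1[OF uT] \<epsilon> \<theta> unfolding f_def by linarith
          note r = rate[OF uT this]
          have "\<theta> \<le> \<epsilon> * A u" using u(2) N0[of u] unfolding f_def by linarith
          then have "\<kappa> * w * \<theta> \<le> \<kappa> * w * (\<epsilon> * A u)" using kappa w by (intro mult_left_mono) auto
          then have "\<kappa> * w * \<theta> \<le> \<epsilon> * \<kappa> * w * A u" by (simp add: mult_ac)
          moreover have "2 * k \<le> \<kappa> * w * \<theta>" by (simp add: k_def)
          ultimately have "N_rate \<alpha> u - \<epsilon> * A_rate u \<le> - k" using r nonneg(2)[of u] by linarith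
          then have "H u * (N_rate \<alpha> u - \<epsilon> * A_rate u) \<le> H u * (- k)"
            by (rule mult_left_mono) (use H_pos[OF t0[OF uT]] in simp)
          moreover have "1 / 2 * k \<le> H u * k" using tame_bounds(12)[of u] T[OF uT] k by (intro mult_right_mono) auto
          ultimately show ?thesis unfolding f'_def by simp
        qed
        show "- (21 / 20 * \<epsilon>) \<le> f u" if "t \<le> u" for u
          using A1[of u] N0[of u] that st s unfolding f_def by simp
      qed (use k in simp)
    qed
    show "\<forall>\<^sub>F t in at_top. dist (N \<alpha> t - \<epsilon> * A t) 0 < e"
      using eventually_ge_at_top[of s]
    proof eventually_elim
      case (elim t)
      then show ?case using upper[OF elim] lower[OF elim] \<theta>(2) unfolding f_def by (simp add: dist_real_def)
    qed
  qed
  define \<epsilon> where "\<epsilon> = min (1 / 2) (\<alpha> * \<mu> * w / 9)"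
  have amw: "0 < \<alpha> * \<mu> * w" using \<alpha> mu_pos w by simp
  have \<epsilon>: "0 < \<epsilon>" "\<epsilon> \<le> 1 / 2" "9 * \<epsilon> \<le> \<alpha> * \<mu> * w" using amw by (auto simp: \<epsilon>_def)
  have "9 * \<epsilon>\<^sup>2 \<le> 9 * \<epsilon>" "9 * (\<epsilon> / 2)\<^sup>2 \<le> 9 * \<epsilon>"
    using \<epsilon> mult_left_le[of \<epsilon> \<epsilon>] by (auto simp: power2_eq_square)
  then have le: "9 * \<epsilon>\<^sup>2 \<le> \<alpha> * \<mu> * w" "9 * (\<epsilon> / 2)\<^sup>2 \<le> \<alpha> * \<mu> * w" using \<epsilon>(3) by linarith+
  have l1: "((\<lambda>t. N \<alpha> t - \<epsilon> * A t) \<longlongrightarrow> 0) at_top" by (rule lim[OF \<epsilon>(1,2) le(1)])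
  have l2: "((\<lambda>t. N \<alpha> t - \<epsilon> / 2 * A t) \<longlongrightarrow> 0) at_top" by (rule lim[OF _ _ le(2)]) (use \<epsilon> in auto)
  have "((\<lambda>t. 2 / \<epsilon> * ((N \<alpha> t - \<epsilon> / 2 * A t) - (N \<alpha> t - \<epsilon> * A t))) \<longlongrightarrow> 2 / \<epsilon> * (0 - 0)) at_top"
    by (intro tendsto_intros l1 l2)
  moreover have "(\<lambda>t. 2 / \<epsilon> * ((N \<alpha> t - \<epsilon> / 2 * A t) - (N \<alpha> t - \<epsilon> * A t))) = A"
    using \<epsilon> by (auto simp: field_simps)
  ultimately show A: "(A \<longlongrightarrow> 0) at_top" by simp
  have "((\<lambda>t. (N \<alpha> t - \<epsilon> * A t) + \<epsilon> * A t) \<longlongrightarrow> 0 + \<epsilon> * 0) at_top" by (intro tendsto_intros l1 A)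
  then show "(N \<alpha> \<longlongrightarrow> 0) at_top" by simp
qed

lemma N_tendsto_imp:
  assumes \<alpha>: "0 < \<alpha>" "\<alpha> \<le> 1" and N: "(N \<alpha> \<longlongrightarrow> 0) at_top"
  shows "(n1 \<longlongrightarrow> 0) at_top" "(n2 \<longlongrightarrow> 0) at_top" "(n3 \<longlongrightarrow> 0) at_top"
proof -
  have le: "y \<le> N \<alpha> t" if "0 < y" "y powr \<alpha> \<le> N \<alpha> t" "N \<alpha> t < 1" for y t
  proof -
    have "y \<le> 1" by (rule le_one_if_powr_le_one[OF \<alpha>(1)]) (use that in simp)
    then have "y powr 1 \<le> y powr \<alpha>" using that \<alpha> by (intro powr_mono') auto
    then show ?thesis using that by simp
  qed
  have ev: "\<forall>\<^sub>F t in at_top. N \<alpha> t < 1 \<and> 0 < t"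
    using order_tendstoD(2)[OF N, of 1] eventually_gt_at_top[of 0] by (auto intro: eventually_conj)
  have 0: "\<forall>\<^sub>F t in at_top. 0 \<le> n1 t \<and> 0 \<le> n2 t \<and> 0 \<le> n3 t"
    using ev by eventually_elim (use n_pos in \<open>simp add: less_imp_le\<close>)
  have 1: "\<forall>\<^sub>F t in at_top. n1 t \<le> N \<alpha> t \<and> n2 t \<le> N \<alpha> t \<and> n3 t \<le> N \<alpha> t"
    using ev by eventually_elim (intro conjI; rule le; use n_pos in \<open>simp add: N_def\<close>)
  show "(n1 \<longlongrightarrow> 0) at_top" "(n2 \<longlongrightarrow> 0) at_top" "(n3 \<longlongrightarrow> 0) at_top"
    by (rule tendsto_sandwich[OF _ _ tendsto_const N]; use 0 1 in \<open>auto elim: eventually_mono\<close>)+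
qed

end

lemma tendsto_zero_if_power2:
  fixes f :: "'a \<Rightarrow> real"
  assumes "((\<lambda>t. (f t)\<^sup>2) \<longlongrightarrow> 0) F"
  shows "(f \<longlongrightarrow> 0) F"
  using tendsto_real_sqrt[OF assms] by (auto intro: tendsto_rabs_zero_cancel)

section \<open>Convergence to the Collins--Stewart points\<close>

text \<open>\<open>\<sigma>\<close>, \<open>r\<close>, \<open>m\<close> stand for
  \<open>s1 / 2\<close>, \<open>(s2 - s3)^2 / 12\<close>, \<open>n1^2 / 12\<close>, and
  \<open>\<eta>\<close>, \<open>\<epsilon>\<close> collect what \<open>n2\<close> and
  \<open>n3\<close> contribute. In the first part the weights turn the rate times
  \<open>1 + h * \<sigma>\<close> into \<open>- c * (\<sigma> + h)^2 - 2 * \<kappa> * r\<close> up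
  to errors. In the second, expansion at the Collins--Stewart values gives \<open>(m - mc)^2\<close>
  the coefficient \<open>4 * (1 - h^2) \<ge> 3\<close>; one unit of it and the large constant 61 pay
  for the mixed terms.\<close>

lemma cs_lyapunov_rates:
  fixes h \<kappa> \<sigma> r m Om q \<eta> \<epsilon> e c a b mc :: real
  assumes h: "0 < h" "h < 1 / 2" and \<kappa>: "\<kappa> = 2 - 4 * h" and c: "c * (1 - h\<^sup>2) = 2 * \<kappa>" and a: "a = h * c / 8" and b: "b = 1 - a"
    and mc: "mc = h * \<kappa> / 4"
    and Om: "Om = 1 - \<sigma>\<^sup>2 - r - m - \<eta>" and q: "q = 2 * \<sigma>\<^sup>2 + 2 * r + 4 * h * Om"
    and nn: "0 \<le> r" "0 \<le> m" and bd: "\<bar>\<sigma>\<bar> \<le> 21 / 20" "r \<le> 21 / 20" "m \<le> 21 / 20"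
    and err: "\<bar>\<eta>\<bar> \<le> e" "\<bar>\<epsilon>\<bar> \<le> e"
  shows "a * (- 2 * (q + 4 * \<sigma>)) + b * (8 * h - 2 * q) - 2 * (h * ((2 - q) * \<sigma> + 4 * m + \<epsilon>) / (1 + h * \<sigma>))
      \<le> - \<kappa> * ((\<sigma> + h)\<^sup>2 + r) + 13 * e"
    and "2 * (m - mc)\<^sup>2 - 61 * ((\<sigma> + h)\<^sup>2 + r) - 12 * e
      \<le> ((2 - q) * \<sigma> + 4 * m + \<epsilon>) * (m - mc) + (\<sigma> + h) * (- 2 * m * (q + 4 * \<sigma>))"
proof -
  have k: "0 < \<kappa>" "\<kappa> < 2" using h \<kappa> by auto
  have e0: "0 \<le> e" using err by linarith
  have h2: "h\<^sup>2 < 1 / 4" using h by (simp add: power2_eq_square) (use mult_strict_mono[of h "1/2" h "1/2"] in simp)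
  define l where "l = 1 + h * \<sigma>"
  have "\<bar>h * \<sigma>\<bar> \<le> 1 / 2 * (21 / 20)" unfolding abs_mult using h bd by (intro mult_mono) auto
  then have l: "2 / 5 \<le> l" "l \<le> 8 / 5" unfolding l_def by linarith+
  have c2: "2 * \<kappa> \<le> c"
  proof -
    have "c * (1 - h\<^sup>2) \<ge> 0" using c k by simp
    then have "0 \<le> c" using h2 by (simp add: zero_le_mult_iff)
    then have "c * (1 - h\<^sup>2) \<le> c" by (intro mult_left_le) auto
    then show ?thesis using c by simp
  qed
  have q2: "2 - q = 2 * m + \<kappa> * Om + 2 * \<eta>" unfolding q \<kappa> Om by (simp add: algebra_simps)
  define x where "x = a * (- 2 * (q + 4 * \<sigma>)) + b * (8 * h - 2 * q) - 2 * (h * ((2 - q) * \<sigma> + 4 * m + \<epsilon>) / (1 + h * \<sigma>))"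
  have "l * x = l * (a * (- 2 * (q + 4 * \<sigma>)) + b * (8 * h - 2 * q)) - 2 * (h * ((2 - q) * \<sigma> + 4 * m + \<epsilon>))"
    unfolding x_def l_def[symmetric] using l by (simp add: right_diff_distrib)
  \<comment> \<open>\<open>a = h * c / 8\<close> turns \<open>8 * a * (\<sigma> + h)\<close> into
    \<open>c * l - c * (1 - h^2)\<close>; then \<open>c\<close> is fixed by letting the constant
    bracket vanish.\<close>
  also have "a * (- 2 * (q + 4 * \<sigma>)) + b * (8 * h - 2 * q) = 4 - 2 * q - c * l + (c * (1 - h\<^sup>2) - (4 - 8 * h))"
    unfolding b a l_def by (simp add: algebra_simps power2_eq_square)
  also have "c * (1 - h\<^sup>2) - (4 - 8 * h) = 0" using c \<kappa> by simp
  also have "l * (4 - 2 * q - c * l + 0) - 2 * (h * ((2 - q) * \<sigma> + 4 * m + \<epsilon>))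
      = - c * l\<^sup>2 + 2 * (2 - q) - 8 * h * m - 2 * h * \<epsilon>"
    unfolding l_def by (simp add: algebra_simps power2_eq_square)
  also have "\<dots> = - c * l\<^sup>2 + 2 * \<kappa> * (m + Om) + 4 * \<eta> - 2 * h * \<epsilon>"
    unfolding q2 by (simp add: \<kappa> algebra_simps)
  also have "\<dots> = - c * ((\<sigma> + h)\<^sup>2) - 2 * \<kappa> * r + 8 * h * \<eta> - 2 * h * \<epsilon>"
  proof -
    have "2 * \<kappa> * (m + Om) = c * (1 - h\<^sup>2) * (1 - \<sigma>\<^sup>2) - 2 * \<kappa> * r - 2 * \<kappa> * \<eta>"
      unfolding c Om by (simp add: algebra_simps)
    moreover have "- c * l\<^sup>2 + c * (1 - h\<^sup>2) * (1 - \<sigma>\<^sup>2) = - c * ((\<sigma> + h)\<^sup>2)"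
      unfolding l_def by (simp add: algebra_simps power2_eq_square)
    moreover have "4 * \<eta> - 2 * \<kappa> * \<eta> = 8 * h * \<eta>" unfolding \<kappa> by (simp add: algebra_simps)
    ultimately show ?thesis by linarith
  qed
  also have "\<dots> \<le> - (2 * \<kappa>) * ((\<sigma> + h)\<^sup>2 + r) + 5 * e"
  proof -
    have "2 * \<kappa> * (\<sigma> + h)\<^sup>2 \<le> c * (\<sigma> + h)\<^sup>2" using c2 by (intro mult_right_mono) auto
    moreover have "\<bar>h * \<eta>\<bar> \<le> 1 / 2 * e" "\<bar>h * \<epsilon>\<bar> \<le> 1 / 2 * e" unfolding abs_mult using h err by (intro mult_mono; simp)+
    ultimately show ?thesis by (simp add: algebra_simps abs_le_iff)
  qed
  finally have lx: "l * x \<le> - (2 * \<kappa>) * ((\<sigma> + h)\<^sup>2 + r) + 5 * e" .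
  define Y where "Y = (\<sigma> + h)\<^sup>2 + r"
  have Y: "0 \<le> Y" using nn by (simp add: Y_def)
  have "l * x \<le> l * (- \<kappa> * Y + 13 * e)"
  proof -
    have "l * (\<kappa> * Y) \<le> 2 * (\<kappa> * Y)" using l k Y by (intro mult_right_mono) auto
    moreover have "2 / 5 * (13 * e) \<le> l * (13 * e)" using l e0 by (intro mult_right_mono) auto
    ultimately show ?thesis using lx e0 unfolding Y_def[symmetric] by (simp add: algebra_simps)
  qed
  then have "x \<le> - \<kappa> * Y + 13 * e" using l by simp
  then show "a * (- 2 * (q + 4 * \<sigma>)) + b * (8 * h - 2 * q) - 2 * (h * ((2 - q) * \<sigma> + 4 * m + \<epsilon>) / (1 + h * \<sigma>))
      \<le> - \<kappa> * ((\<sigma> + h)\<^sup>2 + r) + 13 * e" by (simp add: x_def Y_def)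
  define y where "y = \<sigma> + h"
  define z where "z = m - mc"
  have mc0: "0 \<le> mc" "mc \<le> 1 / 4" unfolding mc using h k mult_mono[of h "1/2" \<kappa> 2] by auto
  have y: "\<bar>y\<bar> \<le> 8 / 5" using bd(1) h unfolding y_def by linarith
  have z: "\<bar>z\<bar> \<le> 6 / 5" using mc0 nn bd unfolding z_def by linarith
  define A1 where "A1 = 4 * h * m + \<kappa> * (1 - h\<^sup>2) + \<kappa> * \<sigma> * (h - \<sigma>)"
  define B1 where "B1 = 4 + \<kappa> * (\<sigma> - h)"
  \<comment> \<open>Both rates vanish at the Collins--Stewart point, so they are expanded in the
    deviations \<open>y\<close>, \<open>z\<close> and in \<open>r\<close>.\<close>
  have s': "(2 - q) * \<sigma> + 4 * m + \<epsilon> = 4 * (1 - h\<^sup>2) * z + y * A1 - \<kappa> * \<sigma> * r + 4 * h * \<sigma> * \<eta> + \<epsilon>"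
    unfolding q2 unfolding Om A1_def z_def y_def mc unfolding \<kappa>
    by (simp add: field_simps power2_eq_square)
  have m': "q + 4 * \<sigma> = - 4 * h * z + y * B1 + \<kappa> * r - 4 * h * \<eta>"
    unfolding q Om B1_def z_def y_def mc unfolding \<kappa> by (simp add: field_simps power2_eq_square)
  have A1: "\<bar>A1\<bar> \<le> 8"
  proof -
    have 1: "\<bar>4 * h * m\<bar> \<le> 2 * (21 / 20)" unfolding abs_mult using h nn bd by (intro mult_mono) auto
    have 2: "\<bar>\<kappa> * (1 - h\<^sup>2)\<bar> \<le> 2 * 1" unfolding abs_mult using k h2 by (intro mult_mono) auto
    have "\<bar>h - \<sigma>\<bar> \<le> 31 / 20" using h bd by linarith
    then have 3: "\<bar>\<kappa> * \<sigma> * (h - \<sigma>)\<bar> \<le> 2 * (21 / 20) * (31 / 20)"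
      unfolding abs_mult using k bd by (intro mult_mono) auto
    show ?thesis unfolding A1_def using 1 2 3 by linarith
  qed
  have B1: "\<bar>B1\<bar> \<le> 8"
  proof -
    have "\<bar>\<sigma> - h\<bar> \<le> 31 / 20" using h bd by linarith
    then have "\<bar>\<kappa> * (\<sigma> - h)\<bar> \<le> 2 * (31 / 20)" unfolding abs_mult using k by (intro mult_mono) auto
    then show ?thesis unfolding B1_def by linarith
  qed
  have id: "((2 - q) * \<sigma> + 4 * m + \<epsilon>) * (m - mc) + (\<sigma> + h) * (- 2 * m * (q + 4 * \<sigma>))
    = 4 * (1 - h\<^sup>2) * z\<^sup>2 + y * z * (A1 + 8 * h * m) - z * (\<kappa> * \<sigma>) * r + z * (4 * h * \<sigma> * \<eta> + \<epsilon>)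
      - y\<^sup>2 * (2 * m * B1) - y * (2 * m * \<kappa>) * r + y * (8 * h * m) * \<eta>"
    unfolding s' m' y_def[symmetric] z_def[symmetric] by (simp add: algebra_simps power2_eq_square)
  have 1: "3 * z\<^sup>2 \<le> 4 * (1 - h\<^sup>2) * z\<^sup>2" using h2 by (intro mult_right_mono) auto
  have "\<bar>8 * h * m\<bar> \<le> 4 * (21 / 20)" unfolding abs_mult using h nn bd by (intro mult_mono) auto
  then have 8: "\<bar>8 * h * m\<bar> \<le> 5" by simp
  have "\<bar>A1 + 8 * h * m\<bar> \<le> 13" using A1 8 by linarith
  then have "\<bar>y * z * (A1 + 8 * h * m)\<bar> \<le> \<bar>y\<bar> * \<bar>z\<bar> * 13" unfolding abs_mult by (intro mult_left_mono) auto
  moreover have "0 \<le> (\<bar>z\<bar> - 13 / 2 * \<bar>y\<bar>)\<^sup>2" by simp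
  then have "13 * (\<bar>y\<bar> * \<bar>z\<bar>) \<le> z\<^sup>2 + 169 / 4 * y\<^sup>2"
    by (simp add: power2_diff power_mult_distrib power2_eq_square algebra_simps del: zero_le_square)
  ultimately have 2: "- (z\<^sup>2 + 169 / 4 * y\<^sup>2) \<le> y * z * (A1 + 8 * h * m)" by (simp add: abs_le_iff)
  have "\<bar>z * (\<kappa> * \<sigma>)\<bar> \<le> 6 / 5 * (2 * (21 / 20))" unfolding abs_mult using z k bd by (intro mult_mono) auto
  then have 3: "z * (\<kappa> * \<sigma>) * r \<le> 3 * r" using nn by (intro mult_right_mono) auto
  have "\<bar>h * \<sigma> * \<eta>\<bar> \<le> 1 / 2 * (21 / 20) * e" unfolding abs_mult using h bd err by (intro mult_mono) auto
  then have "\<bar>4 * h * \<sigma> * \<eta> + \<epsilon>\<bar> \<le> 16 / 5 * e" using err e0 unfolding mult.assoc by linarith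
  then have "\<bar>z * (4 * h * \<sigma> * \<eta> + \<epsilon>)\<bar> \<le> 6 / 5 * (16 / 5 * e)" unfolding abs_mult using z by (intro mult_mono) auto
  then have 4: "- (4 * e) \<le> z * (4 * h * \<sigma> * \<eta> + \<epsilon>)" using e0 by linarith
  have "\<bar>2 * m * B1\<bar> \<le> 2 * (21 / 20) * 8" unfolding abs_mult using B1 nn bd by (intro mult_mono) auto
  then have "y\<^sup>2 * (2 * m * B1) \<le> y\<^sup>2 * 17" by (intro mult_left_mono) auto
  then have 5: "y\<^sup>2 * (2 * m * B1) \<le> 17 * y\<^sup>2" by simp
  have "\<bar>y * (2 * m * \<kappa>)\<bar> \<le> 8 / 5 * (2 * (21 / 20) * 2)" unfolding abs_mult using y k nn bd by (intro mult_mono) auto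
  then have "y * (2 * m * \<kappa>) \<le> 7" by (simp add: abs_le_iff)
  then have 6: "y * (2 * m * \<kappa>) * r \<le> 7 * r" using nn by (intro mult_right_mono) auto
  have "\<bar>y * (8 * h * m) * \<eta>\<bar> \<le> 8 / 5 * 5 * e" using y 8 err unfolding abs_mult[of "y * (8 * h * m)"] abs_mult[of y]
    by (intro mult_mono) auto
  then have 7: "- (8 * e) \<le> y * (8 * h * m) * \<eta>" by linarith
  have "61 * (y\<^sup>2 + r) = 61 * y\<^sup>2 + 61 * r" by simp
  then show "2 * (m - mc)\<^sup>2 - 61 * ((\<sigma> + h)\<^sup>2 + r) - 12 * e
      \<le> ((2 - q) * \<sigma> + 4 * m + \<epsilon>) * (m - mc) + (\<sigma> + h) * (- 2 * m * (q + 4 * \<sigma>))"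
    unfolding id unfolding y_def[symmetric] z_def[symmetric]
    using 1 2 3 4 5 6 7 nn e0 zero_le_power2[of y] by linarith
qed

text \<open>The maximum is a weighted AM-GM inequality combined with
  \<open>(1 + h \<sigma>)\<^sup>2 - (1 - h\<^sup>2) (1 - \<sigma>\<^sup>2) = (\<sigma> + h)\<^sup>2\<close>.\<close>

lemma cs_strict_maximum:
  fixes h a b \<sigma> r m Om :: real
  assumes h: "0 < h" "h < 1" and ab: "0 < a" "0 < b" "a + b = 1"
    and pos: "0 < m" "0 < Om" "0 \<le> r" "0 < 1 + h * \<sigma>" and Om: "Om = 1 - \<sigma>\<^sup>2 - r - m"
    and ne: "\<not> (\<sigma> = - h \<and> r = 0 \<and> m = a * (1 - h\<^sup>2))"
  shows "a * ln m + b * ln Om - 2 * ln (1 + h * \<sigma>)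
    < a * ln (a * (1 - h\<^sup>2)) + b * ln (b * (1 - h\<^sup>2)) - 2 * ln (1 - h\<^sup>2)"
proof -
  define k where "k = 1 - h\<^sup>2"
  have k: "0 < k" using h by (simp add: k_def power2_eq_square mult_less_cancel_left1) (use mult_strict_mono[of h 1 h 1] in simp)
  define l where "l = 1 + h * \<sigma>"
  have l: "0 < l" using pos by (simp add: l_def)
  \<comment> \<open>\<open>u\<close> and \<open>v\<close> are the ratios of \<open>m / l^2\<close>
    and \<open>Om / l^2\<close> to their values \<open>a / k\<close> and \<open>b / k\<close> at the
    maximum. The difference to be shown negative is \<open>a * ln u + b * ln v\<close>, and
    \<open>ln u \<le> u - 1\<close> reduces it to \<open>a * u + b * v \<le> 1\<close>.\<close>
  define u where "u = m * k / (a * l\<^sup>2)"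
  define v where "v = Om * k / (b * l\<^sup>2)"
  have uv: "0 < u" "0 < v" using pos ab k l by (simp_all add: u_def v_def)
  have lnu: "ln u = ln m + ln k - ln a - 2 * ln l" unfolding u_def using pos ab k l
    by (simp add: ln_div ln_mult ln_realpow)
  have lnv: "ln v = ln Om + ln k - ln b - 2 * ln l" unfolding v_def using pos ab k l
    by (simp add: ln_div ln_mult ln_realpow)
  have b: "b = 1 - a" using ab by simp
  have diff: "(a * ln m + b * ln Om - 2 * ln l) - (a * ln (a * k) + b * ln (b * k) - 2 * ln k) = a * ln u + b * ln v"
    unfolding lnu lnv using ab k by (simp add: ln_mult) (simp add: b algebra_simps)
  have "a * u + b * v = (m + Om) * k / l\<^sup>2" unfolding u_def v_def using ab l by (simp add: field_simps)
  also have "(m + Om) * k = l\<^sup>2 - (\<sigma> + h)\<^sup>2 - k * r" unfolding Om l_def k_def by (simp add: power2_eq_square algebra_simps)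
  finally have s: "a * u + b * v = (l\<^sup>2 - (\<sigma> + h)\<^sup>2 - k * r) / l\<^sup>2" .
  have nn: "0 \<le> (\<sigma> + h)\<^sup>2" "0 \<le> k * r" using k pos by simp_all
  then have le1: "a * u + b * v \<le> 1" unfolding s using l by (simp add: field_simps)
  have lu: "a * ln u \<le> a * (u - 1)" "b * ln v \<le> b * (v - 1)"
    using ln_le_minus_one[OF uv(1)] ln_le_minus_one[OF uv(2)] ab by (auto intro: mult_left_mono)
  have "a * ln u + b * ln v < 0"
  proof (rule ccontr)
    assume "\<not> a * ln u + b * ln v < 0"
    moreover have e: "a * (u - 1) + b * (v - 1) = a * u + b * v - 1" unfolding b by (simp add: algebra_simps)
    ultimately have eq: "a * u + b * v = 1" "a * ln u = a * (u - 1)" using lu le1 by linarith+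
    then have "ln u = u - 1" using ab by simp
    then have u1: "u = 1" using ln_eq_minus_one uv by blast
    have "(\<sigma> + h)\<^sup>2 + k * r = 0" using eq(1) l unfolding s by (simp add: field_simps)
    then have "(\<sigma> + h)\<^sup>2 = 0" "k * r = 0" using nn by linarith+
    then have sr: "\<sigma> = - h" "r = 0" using k by auto
    then have lk: "l = k" by (simp add: l_def k_def power2_eq_square)
    have "m * k = a * l\<^sup>2" using u1 ab l unfolding u_def by (simp add: field_simps)
    then have "m = a * k" using k unfolding lk by (simp add: power2_eq_square)
    then show False using ne sr by (simp add: k_def)
  qed
  then show ?thesis using diff unfolding k_def l_def by linarith
qed

context bianchi_small
begin

text \<open>\<open>L\<close> is almost nonincreasing and has a strict maximum at the Collins--Stewart point, but its
  derivative vanishes on all states with the right shear, whatever \<open>n\<^sub>1\<close> is.  Subtracting a small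
  multiple of \<open>Z\<close> makes it strictly decreasing elsewhere.  The constants \<open>ca\<close>, \<open>cb\<close> are the weights for
  which the maximum is attained at that point, where \<open>s\<^sub>1 / 2 = - hh\<close> and \<open>n\<^sub>1\<^sup>2 / 12 = mc\<close>.\<close>

definition hh where "hh = \<mu> / 2"
definition cc where "cc = 2 * \<kappa> / (1 - hh\<^sup>2)"
definition ca where "ca = hh * cc / 8"
definition cb where "cb = 1 - ca"
definition mc where "mc = hh * \<kappa> / 4"
definition L where "L t = ca * ln ((n1 t)\<^sup>2 / 12) + cb * ln (Om t) - 2 * ln (1 + hh * (s1 t / 2))"
definition Z where "Z t = (s1 t / 2 + hh) * ((n1 t)\<^sup>2 / 12 - mc)"
definition sr where "sr t = (2 - q t) * (s1 t / 2) + (n1 t * (2 * n1 t - n2 t - n3 t) - (n2 t - n3 t)\<^sup>2) / 6"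
definition L_rate where "L_rate t = ca * (- 2 * (q t + 2 * s1 t)) + cb * (4 * \<mu> - 2 * q t)
   - 2 * (hh * sr t / (1 + hh * (s1 t / 2)))"
definition Z_rate where "Z_rate t = sr t * ((n1 t)\<^sup>2 / 12 - mc)
   + (s1 t / 2 + hh) * (- 2 * ((n1 t)\<^sup>2 / 12) * (q t + 2 * s1 t))"
definition e1 where "e1 t = (n2 t)\<^sup>2 + (n3 t)\<^sup>2 + pi' t"
definition Y where "Y t = (s1 t / 2 + hh)\<^sup>2 + (s2 t - s3 t)\<^sup>2 / 12"

lemma hh: "0 < hh" "hh < 1 / 2" "\<kappa> = 2 - 4 * hh" "hh\<^sup>2 < 1 / 4"
proof -
  show "0 < hh" "hh < 1 / 2" "\<kappa> = 2 - 4 * hh" using mu_pos mu_less by (simp_all add: hh_def \<kappa>_def)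
  then show "hh\<^sup>2 < 1 / 4" using mult_strict_mono[of hh "1 / 2" hh "1 / 2"] by (simp add: power2_eq_square)
qed

lemma cc: "cc * (1 - hh\<^sup>2) = 2 * \<kappa>" "0 < ca" "0 < cb" "mc = ca * (1 - hh\<^sup>2)" "0 < mc"
proof -
  show c: "cc * (1 - hh\<^sup>2) = 2 * \<kappa>" using hh(4) by (simp add: cc_def)
  have "0 < cc" using hh(4) kappa by (simp add: cc_def)
  then show "0 < ca" using hh by (simp add: ca_def)
  have "cc * (3 / 4) \<le> cc * (1 - hh\<^sup>2)" using \<open>0 < cc\<close> hh(4) by (intro mult_left_mono) auto
  then have "cc \<le> 6" using c kappa by simp
  then have "hh * cc \<le> (1 / 2) * 6" using hh \<open>0 < cc\<close> by (intro mult_mono) auto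
  then show "0 < cb" by (simp add: cb_def ca_def)
  have "ca * (1 - hh\<^sup>2) = hh * (cc * (1 - hh\<^sup>2)) / 8" by (simp add: ca_def)
  then show "mc = ca * (1 - hh\<^sup>2)" unfolding c by (simp add: mc_def)
  show "0 < mc" using hh kappa by (simp add: mc_def)
qed

text \<open>Singles out \<open>n1\<close>: the last bracket of the first identity is the
  perturbation of the type II constraint by \<open>n2\<close> and \<open>n3\<close>.\<close>

lemma type_II_constraint:
  assumes "0 < t"
  shows "Om t = 1 - (s1 t / 2)\<^sup>2 - (s2 t - s3 t)\<^sup>2 / 12 - (n1 t)\<^sup>2 / 12 - (((n2 t)\<^sup>2 + (n3 t)\<^sup>2) / 12 - pi' t)"
    and "q t = 2 * (s1 t / 2)\<^sup>2 + 2 * ((s2 t - s3 t)\<^sup>2 / 12) + 4 * hh * Om t"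
    and "A t = (s1 t / 2)\<^sup>2 + (s2 t - s3 t)\<^sup>2 / 12"
proof -
  have s: "s1 t = - s2 t - s3 t" using s_sum[OF assms] by simp
  show A: "A t = (s1 t / 2)\<^sup>2 + (s2 t - s3 t)\<^sup>2 / 12"
    unfolding A_def s by (simp add: power2_eq_square field_simps)
  show "q t = 2 * (s1 t / 2)\<^sup>2 + 2 * ((s2 t - s3 t)\<^sup>2 / 12) + 4 * hh * Om t"
    using q_A[OF assms] A by (simp add: hh_def)
  have "m t = (n1 t)\<^sup>2 / 12 + ((n2 t)\<^sup>2 + (n3 t)\<^sup>2) / 12" by (simp add: m_def)
  then show "Om t = 1 - (s1 t / 2)\<^sup>2 - (s2 t - s3 t)\<^sup>2 / 12 - (n1 t)\<^sup>2 / 12 - (((n2 t)\<^sup>2 + (n3 t)\<^sup>2) / 12 - pi' t)"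
    using constraint'[OF assms] A by linarith
qed

lemma tame_small:
  assumes "tame t"
  shows "\<bar>s1 t / 2\<bar> \<le> 21 / 20" "(s2 t - s3 t)\<^sup>2 / 12 \<le> 21 / 20" "(n1 t)\<^sup>2 / 12 \<le> 21 / 20" "2 / 5 \<le> 1 + hh * (s1 t / 2)"
    "1 + hh * (s1 t / 2) \<le> 8 / 5"
proof -
  have t: "0 < t" and p: "pi' t \<le> 1 / 20" using assms by (auto simp: tame_def)
  note b = tame_bounds[OF assms]
  show s: "\<bar>s1 t / 2\<bar> \<le> 21 / 20" using b(6) p by simp
  show "(s2 t - s3 t)\<^sup>2 / 12 \<le> 21 / 20" using b(1) type_II_constraint(3)[OF t] zero_le_power2[of "s1 t / 2"] by linarith
  have "(n1 t)\<^sup>2 / 12 \<le> m t" by (simp add: m_def)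
  then show "(n1 t)\<^sup>2 / 12 \<le> 21 / 20" using b(2) by linarith
  have "\<bar>hh * (s1 t / 2)\<bar> \<le> 1 / 2 * (21 / 20)" unfolding abs_mult[of hh] using hh s by (intro mult_mono) auto
  then show "2 / 5 \<le> 1 + hh * (s1 t / 2)" "1 + hh * (s1 t / 2) \<le> 8 / 5" by linarith+
qed

lemma rates_le:
  assumes "tame t"
  shows "L_rate t \<le> - \<kappa> * Y t + 13 * e1 t"
    and "2 * ((n1 t)\<^sup>2 / 12 - mc)\<^sup>2 - 61 * Y t - 12 * e1 t \<le> Z_rate t"
proof -
  have t: "0 < t" and p: "pi' t \<le> 1 / 20" using assms by (auto simp: tame_def)
  note n = n_pos[OF t] and c = type_II_constraint[OF t] and ts = tame_small[OF assms] and p0 = pi'_pos[OF t]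
  define \<epsilon> where "\<epsilon> = - (n1 t * n2 t + n3 t * n1 t) / 6 - (n2 t - n3 t)\<^sup>2 / 6"
  have sr: "sr t = (2 - q t) * (s1 t / 2) + 4 * ((n1 t)\<^sup>2 / 12) + \<epsilon>"
    by (simp add: sr_def \<epsilon>_def power2_eq_square field_simps)
  have nn: "0 < n1 t * n2 t" "0 < n2 t * n3 t" "0 < n3 t * n1 t" using n by simp_all
  have sq: "0 \<le> (n2 t)\<^sup>2" "0 \<le> (n3 t)\<^sup>2" by simp_all
  have \<epsilon>: "\<bar>\<epsilon>\<bar> \<le> e1 t"
  proof -
    have "\<epsilon> = - (n1 t * n2 t) / 6 - n3 t * n1 t / 6 - (n2 t)\<^sup>2 / 6 - (n3 t)\<^sup>2 / 6 + n2 t * n3 t / 3"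
      by (simp add: \<epsilon>_def power2_eq_square field_simps)
    moreover have "0 \<le> (n2 t - n3 t)\<^sup>2" by simp
    then have "2 * (n2 t * n3 t) \<le> (n2 t)\<^sup>2 + (n3 t)\<^sup>2" by (simp add: power2_eq_square algebra_simps del: zero_le_square)
    moreover have "6 * pi' t = n1 t * n2 t + n2 t * n3 t + n3 t * n1 t" by (simp add: pi'_def)
    ultimately show ?thesis unfolding e1_def using nn sq p0 by linarith
  qed
  have \<eta>: "\<bar>((n2 t)\<^sup>2 + (n3 t)\<^sup>2) / 12 - pi' t\<bar> \<le> e1 t" unfolding e1_def add_divide_distrib using sq p0 by linarith
  have r0: "0 \<le> (s2 t - s3 t)\<^sup>2 / 12" "0 \<le> (n1 t)\<^sup>2 / 12" by simp_all
  note R = cs_lyapunov_rates[OF hh(1-3) cc(1) ca_def cb_def mc_def c(1) c(2) r0 ts(1-3) \<eta> \<epsilon>]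
  have mu: "4 * \<mu> = 8 * hh" by (simp add: hh_def)
  show "L_rate t \<le> - \<kappa> * Y t + 13 * e1 t" using R(1) unfolding L_rate_def Y_def sr mu by simp
  show "2 * ((n1 t)\<^sup>2 / 12 - mc)\<^sup>2 - 61 * Y t - 12 * e1 t \<le> Z_rate t"
    using R(2) unfolding Z_rate_def Y_def sr by simp
qed

lemma D_half_s1: "0 < t \<Longrightarrow> ((\<lambda>t. s1 t / 2) has_real_derivative H t * sr t) (at t)"
  using DERIV_cdivide[OF D_s1, of t 2] by (rule DERIV_cong) (simp_all add: sr_def field_simps)

lemma D_m1: "0 < t \<Longrightarrow> ((\<lambda>t. (n1 t)\<^sup>2 / 12) has_real_derivative H t * (- 2 * ((n1 t)\<^sup>2 / 12) * (q t + 2 * s1 t))) (at t)"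
  by (rule derivative_eq_intros D_n1 refl | assumption | simp add: power2_eq_square field_simps)+

lemma D_L: "tame t \<Longrightarrow> 0 < Om t \<Longrightarrow> (L has_real_derivative H t * L_rate t) (at t)"
proof -
  assume s: "tame t" and O: "0 < Om t"
  have t: "0 < t" using s by (simp add: tame_def)
  have l: "0 < 1 + hh * (s1 t / 2)" using tame_small(4)[OF s] by linarith
  have 1: "((\<lambda>t. ln ((n1 t)\<^sup>2 / 12)) has_real_derivative H t * (- 2 * (q t + 2 * s1 t))) (at t)"
    using n_pos[OF t] by (intro DERIV_cong[OF DERIV_chain2[OF DERIV_ln_divide D_m1[OF t]]]) (simp_all add: algebra_simps)
  have 2: "((\<lambda>t. ln (Om t)) has_real_derivative H t * (4 * \<mu> - 2 * q t)) (at t)"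
    using O by (intro DERIV_cong[OF DERIV_chain2[OF DERIV_ln_divide D_Om[OF t]]]) simp_all
  have 3: "((\<lambda>t. ln (1 + hh * (s1 t / 2))) has_real_derivative H t * (hh * sr t / (1 + hh * (s1 t / 2)))) (at t)"
    by (rule DERIV_cong[OF DERIV_chain2[OF DERIV_ln_divide[OF l] DERIV_add[OF DERIV_const DERIV_cmult[OF D_half_s1[OF t]]]]]) simp
  show ?thesis unfolding L_def[abs_def] L_rate_def
    by (rule derivative_eq_intros 1 2 3 refl | simp only: ring_distribs)+ (simp add: algebra_simps)
qed

lemma D_Z: "0 < t \<Longrightarrow> (Z has_real_derivative H t * Z_rate t) (at t)"
  unfolding Z_def[abs_def] Z_rate_def
  by (rule DERIV_cong[OF DERIV_mult[OF DERIV_add[OF D_half_s1 DERIV_const] DERIV_diff[OF D_m1 DERIV_const]]])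
    (simp_all add: algebra_simps)

text \<open>If \<open>Q\<close> did not tend to 0, the orbit would have a limit point at which the
  limit of \<open>L\<close> lies below its maximum \<open>Lc\<close> by a gap, so
  \<open>V = L - lam * Z\<close> would be below \<open>y < Lc\<close> at some late time. Below
  \<open>y\<close>, \<open>Q\<close> is bounded away from 0, since \<open>Q\<close> tending to 0
  would take \<open>V\<close> to \<open>Lc\<close>. Hence \<open>V\<close> would fall at a definite
  speed forever, against the lower bound provided by \<open>n1 \<ge> \<eta>\<close> and
  \<open>Om \<ge> w\<close>.\<close>

lemma collins_stewart_case:
  assumes \<eta>: "0 < \<eta>" "\<forall>\<^sub>F t in at_top. \<eta> \<le> n1 t" and w: "0 < w" "\<forall>\<^sub>F t in at_top. w \<le> Om t"
  shows "(n2 \<longlongrightarrow> 0) at_top" "(n3 \<longlongrightarrow> 0) at_top"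
    "((\<lambda>t. Y t + ((n1 t)\<^sup>2 / 12 - mc)\<^sup>2) \<longlongrightarrow> 0) at_top"
proof -
  have ev: "\<forall>\<^sub>F t in at_top. tame t \<and> \<eta> \<le> n1 t \<and> w \<le> Om t"
    using eventually_tame \<eta>(2) w(2) by eventually_elim auto
  show n2: "(n2 \<longlongrightarrow> 0) at_top"
  proof (rule tendsto_sandwich[OF _ _ tendsto_const])
    show "\<forall>\<^sub>F t in at_top. 0 \<le> n2 t" using ev by eventually_elim (use n_pos in \<open>auto simp: tame_def less_imp_le\<close>)
    show "\<forall>\<^sub>F t in at_top. n2 t \<le> n1 t * n2 t / \<eta>" using ev
    proof eventually_elim
      case (elim t)
      then have "\<eta> * n2 t \<le> n1 t * n2 t" using n_pos(2)[of t] by (intro mult_right_mono) (auto simp: tame_def)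
      then show ?case using \<eta> by (simp add: field_simps)
    qed
    show "((\<lambda>t. n1 t * n2 t / \<eta>) \<longlongrightarrow> 0) at_top" by (rule tendsto_divide_zero[OF n12])
  qed
  show n3: "(n3 \<longlongrightarrow> 0) at_top"
  proof (rule tendsto_sandwich[OF _ _ tendsto_const])
    show "\<forall>\<^sub>F t in at_top. 0 \<le> n3 t" using ev by eventually_elim (use n_pos in \<open>auto simp: tame_def less_imp_le\<close>)
    show "\<forall>\<^sub>F t in at_top. n3 t \<le> n3 t * n1 t / \<eta>" using ev
    proof eventually_elim
      case (elim t)
      then have "n3 t * \<eta> \<le> n3 t * n1 t" using n_pos(3)[of t] by (intro mult_left_mono) (auto simp: tame_def)
      then show ?case using \<eta> by (simp add: field_simps)
    qed
    show "((\<lambda>t. n3 t * n1 t / \<eta>) \<longlongrightarrow> 0) at_top" by (rule tendsto_divide_zero[OF n31])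
  qed
  have "(e1 \<longlongrightarrow> 0\<^sup>2 + 0\<^sup>2 + 0) at_top" unfolding e1_def[abs_def] by (intro tendsto_intros n2 n3 pi'_tendsto)
  then have e1: "(e1 \<longlongrightarrow> 0) at_top" by simp
  have "((\<lambda>t. ((n2 t)\<^sup>2 + (n3 t)\<^sup>2) / 12 - pi' t) \<longlongrightarrow> (0\<^sup>2 + 0\<^sup>2) / 12 - 0) at_top"
    by (intro tendsto_intros n2 n3 pi'_tendsto) simp
  then have eta: "((\<lambda>t. ((n2 t)\<^sup>2 + (n3 t)\<^sup>2) / 12 - pi' t) \<longlongrightarrow> 0) at_top" by simp
  define Q where "Q t = Y t + ((n1 t)\<^sup>2 / 12 - mc)\<^sup>2" for t
  have Q0: "0 \<le> Q t" for t by (simp add: Q_def Y_def)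
  define lim where "lim \<sigma> r m = ca * ln m + cb * ln (1 - \<sigma>\<^sup>2 - r - m) - 2 * ln (1 + hh * \<sigma>)" for \<sigma> r m
  \<comment> \<open>The lower bounds on \<open>n1\<close>, \<open>Om\<close> and
    \<open>1 + hh * (s1 / 2)\<close> pass to the limit and keep the arguments of the logarithms
    positive there.\<close>
  have L_lim: "(\<lambda>k. L (X k)) \<longlonglongrightarrow> lim \<sigma> r m \<and> w \<le> 1 - \<sigma>\<^sup>2 - r - m \<and> 0 < m \<and> 0 < 1 + hh * \<sigma>"
    if X: "filterlim X at_top sequentially" and s: "(\<lambda>k. s1 (X k) / 2) \<longlonglongrightarrow> \<sigma>"
      and r: "(\<lambda>k. (s2 (X k) - s3 (X k))\<^sup>2 / 12) \<longlonglongrightarrow> r" and m: "(\<lambda>k. (n1 (X k))\<^sup>2 / 12) \<longlonglongrightarrow> m"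
    for X :: "nat \<Rightarrow> real" and \<sigma> r m
  proof -
    have evX: "\<forall>\<^sub>F k in sequentially. tame (X k) \<and> \<eta> \<le> n1 (X k) \<and> w \<le> Om (X k)"
      using ev X by (rule eventually_compose_filterlim)
    have "(\<lambda>k. 1 - (s1 (X k) / 2)\<^sup>2 - (s2 (X k) - s3 (X k))\<^sup>2 / 12 - (n1 (X k))\<^sup>2 / 12
        - (((n2 (X k))\<^sup>2 + (n3 (X k))\<^sup>2) / 12 - pi' (X k))) \<longlonglongrightarrow> 1 - \<sigma>\<^sup>2 - r - m - 0"
      by (intro tendsto_intros s r m filterlim_compose[OF eta X])
    moreover have "\<forall>\<^sub>F k in sequentially. 1 - (s1 (X k) / 2)\<^sup>2 - (s2 (X k) - s3 (X k))\<^sup>2 / 12 - (n1 (X k))\<^sup>2 / 12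
        - (((n2 (X k))\<^sup>2 + (n3 (X k))\<^sup>2) / 12 - pi' (X k)) = Om (X k)"
      using evX by eventually_elim (use type_II_constraint(1) in \<open>auto simp: tame_def\<close>)
    ultimately have O: "(\<lambda>k. Om (X k)) \<longlonglongrightarrow> 1 - \<sigma>\<^sup>2 - r - m" by (simp add: Lim_transform_eventually)
    have Ow: "w \<le> 1 - \<sigma>\<^sup>2 - r - m"
      by (rule tendsto_lowerbound[OF O]) (use evX in \<open>auto elim: eventually_mono\<close>)
    have mp: "\<eta>\<^sup>2 / 12 \<le> m"
    proof (rule tendsto_lowerbound[OF m])
      show "\<forall>\<^sub>F k in sequentially. \<eta>\<^sup>2 / 12 \<le> (n1 (X k))\<^sup>2 / 12"
        using evX by eventually_elim (use \<eta> in \<open>auto intro!: divide_right_mono power_mono\<close>)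
    qed simp
    have lp: "2 / 5 \<le> 1 + hh * \<sigma>"
    proof (rule tendsto_lowerbound)
      show "(\<lambda>k. 1 + hh * (s1 (X k) / 2)) \<longlonglongrightarrow> 1 + hh * \<sigma>" by (intro tendsto_intros s)
      show "\<forall>\<^sub>F k in sequentially. 2 / 5 \<le> 1 + hh * (s1 (X k) / 2)"
        using evX by eventually_elim (use tame_small(4) in auto)
    qed simp
    have "0 < \<eta>\<^sup>2 / 12" using \<eta> by simp
    then have pos: "m \<noteq> 0" "1 - \<sigma>\<^sup>2 - r - m \<noteq> 0" "1 + hh * \<sigma> \<noteq> 0" "0 < m" using mp Ow w lp by linarith+
    have "(\<lambda>k. L (X k)) \<longlonglongrightarrow> lim \<sigma> r m"
      unfolding L_def lim_def by (intro tendsto_intros s m O pos)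
    then show ?thesis using Ow pos lp by auto
  qed
  define Lc where "Lc = lim (- hh) 0 mc"
  have Lc: "Lc = ca * ln (ca * (1 - hh\<^sup>2)) + cb * ln (cb * (1 - hh\<^sup>2)) - 2 * ln (1 - hh\<^sup>2)"
  proof -
    have "1 - hh\<^sup>2 - ca * (1 - hh\<^sup>2) = cb * (1 - hh\<^sup>2)" by (simp add: cb_def algebra_simps)
    moreover have "1 - hh * hh = 1 - hh\<^sup>2" by (simp add: power2_eq_square)
    ultimately show ?thesis unfolding Lc_def lim_def cc(4) by simp
  qed
  show "((\<lambda>t. Y t + ((n1 t)\<^sup>2 / 12 - mc)\<^sup>2) \<longlongrightarrow> 0) at_top"
  proof (rule ccontr)
    assume "\<not> ((\<lambda>t. Y t + ((n1 t)\<^sup>2 / 12 - mc)\<^sup>2) \<longlongrightarrow> 0) at_top"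
    then have "\<not> (Q \<longlongrightarrow> 0) at_top" by (simp add: Q_def[abs_def])
    then obtain \<epsilon> where \<epsilon>: "0 < \<epsilon>" "\<not> (\<forall>\<^sub>F t in at_top. Q t < \<epsilon>)"
      unfolding tendsto_iff dist_real_def using Q0 by auto
    obtain T where T: "\<And>t. T \<le> t \<Longrightarrow> tame t \<and> \<eta> \<le> n1 t \<and> w \<le> Om t"
      using ev unfolding eventually_at_top_linorder by blast
    have "\<exists>t. max T (real k) \<le> t \<and> \<epsilon> \<le> Q t" for k
      using \<epsilon>(2) unfolding eventually_at_top_linorder by (meson not_le)
    then obtain X0 where X0: "\<And>k::nat. max T (real k) \<le> X0 k" "\<And>k. \<epsilon> \<le> Q (X0 k)" by metis
    have X0_lim: "filterlim X0 at_top sequentially"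
      by (rule filterlim_at_top_mono[OF filterlim_real_sequentially]) (use X0(1) in \<open>auto intro: always_eventually\<close>)
    define K where "K = {-2..2::real} \<times> {-6..6::real} \<times> {0..4::real}"
    have cK: "compact K" unfolding K_def by (intro compact_Times compact_Icc)
    have inK: "(s1 (X0 k) / 2, s2 (X0 k) - s3 (X0 k), n1 (X0 k)) \<in> K" for k
    proof -
      have s: "tame (X0 k)" "0 < X0 k" using T X0(1)[of k] by (auto simp: tame_def)
      have p: "pi' (X0 k) \<le> 1 / 20" using s by (simp add: tame_def)
      show ?thesis unfolding K_def using tame_bounds(6-9)[OF s(1)] n_pos(1)[OF s(2)] p by (auto simp: abs_le_iff)
    qed
    obtain l r where lr: "strict_mono r"
        "((\<lambda>k. (s1 (X0 k) / 2, s2 (X0 k) - s3 (X0 k), n1 (X0 k))) \<circ> r) \<longlonglongrightarrow> l"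
      using cK[unfolded compact_def, rule_format, of "\<lambda>k. (s1 (X0 k) / 2, s2 (X0 k) - s3 (X0 k), n1 (X0 k))"] inK
      by auto
    obtain \<sigma> \<rho> \<nu> where l: "l = (\<sigma>, \<rho>, \<nu>)" by (cases l) auto
    define X where "X = X0 \<circ> r"
    have X_lim: "filterlim X at_top sequentially"
      unfolding X_def comp_def by (rule filterlim_compose[OF X0_lim filterlim_subseq[OF lr(1)]])
    have conv: "(\<lambda>k. (s1 (X k) / 2, s2 (X k) - s3 (X k), n1 (X k))) \<longlonglongrightarrow> (\<sigma>, \<rho>, \<nu>)"
      using lr(2) by (simp add: X_def comp_def l)
    have s: "(\<lambda>k. s1 (X k) / 2) \<longlonglongrightarrow> \<sigma>" using tendsto_fst[OF conv] by simp
    have d: "(\<lambda>k. s2 (X k) - s3 (X k)) \<longlonglongrightarrow> \<rho>" using tendsto_fst[OF tendsto_snd[OF conv]] by simp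
    have n: "(\<lambda>k. n1 (X k)) \<longlonglongrightarrow> \<nu>" using tendsto_snd[OF tendsto_snd[OF conv]] by simp
    have r: "(\<lambda>k. (s2 (X k) - s3 (X k))\<^sup>2 / 12) \<longlonglongrightarrow> \<rho>\<^sup>2 / 12" by (intro tendsto_intros d) simp
    have m: "(\<lambda>k. (n1 (X k))\<^sup>2 / 12) \<longlonglongrightarrow> \<nu>\<^sup>2 / 12" by (intro tendsto_intros n) simp
    note LX = L_lim[OF X_lim s r m]
    have "(\<lambda>k. Q (X k)) \<longlonglongrightarrow> (\<sigma> + hh)\<^sup>2 + \<rho>\<^sup>2 / 12 + (\<nu>\<^sup>2 / 12 - mc)\<^sup>2"
      unfolding Q_def Y_def by (intro tendsto_intros s r m)
    then have "\<epsilon> \<le> (\<sigma> + hh)\<^sup>2 + \<rho>\<^sup>2 / 12 + (\<nu>\<^sup>2 / 12 - mc)\<^sup>2"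
      by (rule tendsto_lowerbound) (use X0(2) in \<open>auto simp: X_def\<close>)
    then have ne: "\<not> (\<sigma> = - hh \<and> \<rho>\<^sup>2 / 12 = 0 \<and> \<nu>\<^sup>2 / 12 = ca * (1 - hh\<^sup>2))"
      using \<epsilon>(1) unfolding cc(4) by auto
    have "lim \<sigma> (\<rho>\<^sup>2 / 12) (\<nu>\<^sup>2 / 12) < Lc"
      unfolding lim_def Lc
      by (rule cs_strict_maximum[OF hh(1) _ cc(2,3) _ _ _ _ _ refl ne]) (use LX w hh in \<open>auto simp: cb_def\<close>)
    define gap where "gap = Lc - lim \<sigma> (\<rho>\<^sup>2 / 12) (\<nu>\<^sup>2 / 12)"
    have gap: "0 < gap" using \<open>lim \<sigma> (\<rho>\<^sup>2 / 12) (\<nu>\<^sup>2 / 12) < Lc\<close> by (simp add: gap_def)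
    \<comment> \<open>\<open>61 * lam \<le> \<kappa> / 2\<close> leaves half of the decay of
      \<open>L\<close> in \<open>Y\<close>; with \<open>\<bar>Z\<bar> \<le> 4\<close> the second
      bound keeps \<open>lam * Z\<close> within a quarter of the gap.\<close>
    define lam where "lam = min (\<kappa> / 122) (gap / 16)"
    have lam: "0 < lam" "lam \<le> \<kappa> / 122" "lam \<le> gap / 16" using kappa gap by (auto simp: lam_def)
    define V where "V t = L t - lam * Z t" for t
    have Zb: "\<bar>Z t\<bar> \<le> 4" if "tame t" for t
    proof -
      have "mc \<le> 1" using hh kappa mult_mono[of hh 1 \<kappa> 2] by (simp add: mc_def)
      then have 1: "\<bar>(n1 t)\<^sup>2 / 12 - mc\<bar> \<le> 2" using tame_small(3)[OF that] cc(5) zero_le_power2[of "n1 t"] by linarith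
      have 2: "\<bar>s1 t / 2 + hh\<bar> \<le> 2" using tame_small(1)[OF that] hh by linarith
      have "\<bar>s1 t / 2 + hh\<bar> * \<bar>(n1 t)\<^sup>2 / 12 - mc\<bar> \<le> 2 * 2" using 1 2 by (intro mult_mono) auto
      then show ?thesis by (simp add: Z_def abs_mult)
    qed
    have lamZ: "\<bar>lam * Z t\<bar> \<le> gap / 4" if "tame t" for t
    proof -
      have "\<bar>lam * Z t\<bar> \<le> gap / 16 * 4" unfolding abs_mult using lam Zb[OF that] by (intro mult_mono) auto
      then show ?thesis by simp
    qed
    \<comment> \<open>Above the starting value of \<open>V\<close>, since there
      \<open>L < Lc - 3 / 4 * gap\<close> and \<open>lam * Z\<close> contributes at most
      \<open>gap / 4\<close>.\<close>
    define y where "y = Lc - gap / 2"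
    define V' where "V' t = H t * (L_rate t - lam * Z_rate t)" for t
    have V'_le: "V' t \<le> - (lam / 2) * Q t + 25 * e1 t" if "tame t" for t
    proof -
      have t: "0 < t" using that by (simp add: tame_def)
      define z2 where "z2 = ((n1 t)\<^sup>2 / 12 - mc)\<^sup>2"
      have Y0: "0 \<le> Y t" by (simp add: Y_def)
      have e0: "0 \<le> e1 t" using pi'_pos[OF t] by (simp add: e1_def add_nonneg_nonneg)
      have "lam * (2 * z2 - 61 * Y t - 12 * e1 t) \<le> lam * Z_rate t"
        using rates_le(2)[OF that] lam unfolding z2_def by (intro mult_left_mono) auto
      then have "2 * (lam * z2) - 61 * (lam * Y t) - 12 * (lam * e1 t) \<le> lam * Z_rate t" by (simp add: algebra_simps)
      moreover have "61 * (lam * Y t) \<le> \<kappa> / 2 * Y t" using mult_right_mono[OF lam(2) Y0] by simp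
      moreover have "lam * e1 t \<le> 1 * e1 t" using lam kappa e0 by (intro mult_right_mono) auto
      moreover have "lam * Y t \<le> \<kappa> / 2 * Y t" using lam kappa Y0 by (intro mult_right_mono) auto
      moreover have "L_rate t \<le> - (\<kappa> / 2 * Y t) - (\<kappa> / 2 * Y t) + 13 * e1 t" using rates_le(1)[OF that] by (simp add: field_simps)
      moreover have "0 \<le> lam * z2" "0 \<le> lam * Y t" using lam Y0 by (simp_all add: z2_def)
      ultimately have "L_rate t - lam * Z_rate t \<le> - (lam * (Y t + z2)) + 25 * e1 t" unfolding distrib_left by linarith
      then have "V' t \<le> H t * (- (lam * Q t) + 25 * e1 t)"
        unfolding V'_def Q_def z2_def using H_pos[OF t] by (intro mult_left_mono) auto
      also have "\<dots> = - (H t * (lam * Q t)) + H t * (25 * e1 t)" by (simp add: algebra_simps)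
      also have "\<dots> \<le> - (1 / 2 * (lam * Q t)) + 1 * (25 * e1 t)"
        using tame_bounds(12,13)[OF that] lam Q0[of t] e0 by (intro add_mono mult_right_mono le_imp_neg_le) auto
      finally show ?thesis by simp
    qed
    have "\<exists>\<delta>>0. \<exists>T1. \<forall>t\<ge>T1. V t < y \<longrightarrow> \<delta> \<le> Q t"
    proof (rule ccontr)
      assume "\<not> ?thesis"
      then have "\<exists>t. max T (real k) \<le> t \<and> V t < y \<and> Q t < 1 / (real k + 1)" for k
        by (metis not_le of_nat_0_le_iff add_nonneg_pos zero_less_one divide_pos_pos)
      then obtain X1 where X1: "\<And>k::nat. max T (real k) \<le> X1 k \<and> V (X1 k) < y \<and> Q (X1 k) < 1 / (real k + 1)" by metis
      have X1_lim: "filterlim X1 at_top sequentially"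
        by (rule filterlim_at_top_mono[OF filterlim_real_sequentially]) (use X1 in \<open>auto intro: always_eventually\<close>)
      have Q1: "(\<lambda>k. Q (X1 k)) \<longlonglongrightarrow> 0"
      proof (rule tendsto_sandwich[OF _ _ tendsto_const])
        show "(\<lambda>k. 1 / (real k + 1)) \<longlonglongrightarrow> 0" by real_asymp
        show "\<forall>\<^sub>F k in sequentially. Q (X1 k) \<le> 1 / (real k + 1)" using X1 by (auto intro!: always_eventually less_imp_le)
      qed (use Q0 in auto)
      have sqz: "f \<longlonglongrightarrow> 0" if "\<And>k. (f k)\<^sup>2 \<le> Q (X1 k)" for f :: "nat \<Rightarrow> real"
      proof -
        have "(\<lambda>k. (f k)\<^sup>2) \<longlonglongrightarrow> 0"
          by (rule tendsto_sandwich[OF _ _ tendsto_const Q1]) (use that in auto)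
        from tendsto_real_sqrt[OF this] show ?thesis by (simp add: tendsto_rabs_zero_iff)
      qed
      have "(\<lambda>k. s1 (X1 k) / 2 + hh) \<longlonglongrightarrow> 0" by (rule sqz) (simp add: Q_def Y_def)
      from tendsto_diff[OF this tendsto_const[of hh]] have s: "(\<lambda>k. s1 (X1 k) / 2) \<longlonglongrightarrow> - hh" by simp
      have "(\<lambda>k. (n1 (X1 k))\<^sup>2 / 12 - mc) \<longlonglongrightarrow> 0" by (rule sqz) (simp add: Q_def Y_def)
      from tendsto_add[OF this tendsto_const[of mc]] have m: "(\<lambda>k. (n1 (X1 k))\<^sup>2 / 12) \<longlonglongrightarrow> mc" by simp
      have r: "(\<lambda>k. (s2 (X1 k) - s3 (X1 k))\<^sup>2 / 12) \<longlonglongrightarrow> 0"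
        by (rule tendsto_sandwich[OF _ _ tendsto_const Q1]) (auto simp: Q_def Y_def)
      have LX1: "(\<lambda>k. L (X1 k)) \<longlonglongrightarrow> Lc" using L_lim[OF X1_lim s r m] by (simp add: Lc_def)
      have "(\<lambda>k. Z (X1 k)) \<longlonglongrightarrow> (- hh + hh) * (mc - mc)" unfolding Z_def by (intro tendsto_intros s m)
      then have "(\<lambda>k. V (X1 k)) \<longlonglongrightarrow> Lc - lam * ((- hh + hh) * (mc - mc))" unfolding V_def by (intro tendsto_intros LX1)
      then have "Lc - lam * ((- hh + hh) * (mc - mc)) \<le> y"
        by (rule tendsto_upperbound) (use X1 in \<open>auto intro!: always_eventually less_imp_le\<close>)
      then show False using gap by (simp add: y_def)
    qed
    then obtain \<delta> T1 where \<delta>: "0 < \<delta>" "\<And>t. T1 \<le> t \<Longrightarrow> V t < y \<Longrightarrow> \<delta> \<le> Q t" by blast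
    define c where "c = lam * \<delta> / 4"
    have c: "0 < c" using lam \<delta> by (simp add: c_def)
    have "\<forall>\<^sub>F t in at_top. e1 t < c / 25" using c by (intro order_tendstoD(2)[OF e1]) simp
    then obtain T2 where T2: "\<And>t. T2 \<le> t \<Longrightarrow> e1 t < c / 25" unfolding eventually_at_top_linorder by blast
    define T3 where "T3 = max T (max T1 T2)"
    have "\<forall>\<^sub>F k in sequentially. T3 \<le> X k" using X_lim by (auto simp: filterlim_at_top)
    moreover have "\<forall>\<^sub>F k in sequentially. L (X k) < Lc - 3 / 4 * gap"
    proof (rule order_tendstoD(2)[OF conjunct1[OF LX]])
      show "lim \<sigma> (\<rho>\<^sup>2 / 12) (\<nu>\<^sup>2 / 12) < Lc - 3 / 4 * gap" using gap gap_def by linarith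
    qed
    ultimately have "\<forall>\<^sub>F k in sequentially. T3 \<le> X k \<and> L (X k) < Lc - 3 / 4 * gap" by (rule eventually_conj)
    then obtain k where k: "T3 \<le> X k" "L (X k) < Lc - 3 / 4 * gap"
      using eventually_happens'[OF sequentially_bot] by blast
    have tm: "tame t" "w \<le> Om t" "\<eta> \<le> n1 t" "T1 \<le> t" "T2 \<le> t" if "X k \<le> t" for t
      using T[of t] k that by (auto simp: T3_def)
    show False
    proof (rule trapped_below_unbounded[of "X k" V V' y c "ca * ln (\<eta>\<^sup>2 / 12) + cb * ln w - 2 * ln 2 - gap / 4"])
      show "(V has_real_derivative V' t) (at t)" if "X k \<le> t" for t
      proof -
        have t: "0 < t" "0 < Om t" using tm[OF that] w by (auto simp: tame_def)
        show ?thesis unfolding V_def[abs_def] V'_def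
          by (rule DERIV_cong[OF DERIV_diff[OF D_L[OF tm(1)[OF that] t(2)] DERIV_cmult[OF D_Z[OF t(1)]]]])
            (simp add: algebra_simps)
      qed
      show "V (X k) < y" unfolding V_def y_def using k(2) lamZ[OF tm(1)[OF order_refl]] by linarith
      show "V' t \<le> - c" if t: "X k \<le> t" "V t < y" for t
      proof -
        have "lam / 2 * \<delta> \<le> lam / 2 * Q t" using \<delta>(2)[OF tm(4)[OF t(1)] t(2)] lam by (intro mult_left_mono) auto
        then show ?thesis using V'_le[OF tm(1)[OF t(1)]] T2[OF tm(5)[OF t(1)]] unfolding c_def by simp
      qed
      show "ca * ln (\<eta>\<^sup>2 / 12) + cb * ln w - 2 * ln 2 - gap / 4 \<le> V t" if t: "X k \<le> t" for t
      proof -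
        note s = tm[OF t]
        have "ln (\<eta>\<^sup>2 / 12) \<le> ln ((n1 t)\<^sup>2 / 12)" using \<eta> s by (intro ln_mono divide_right_mono power_mono) auto
        then have 1: "ca * ln (\<eta>\<^sup>2 / 12) \<le> ca * ln ((n1 t)\<^sup>2 / 12)" using cc by (intro mult_left_mono) auto
        have "ln w \<le> ln (Om t)" using w s by (intro ln_mono) auto
        then have 2: "cb * ln w \<le> cb * ln (Om t)" using cc by (intro mult_left_mono) auto
        have 3: "ln (1 + hh * (s1 t / 2)) \<le> ln 2" using tame_small(4,5)[OF s(1)] by (intro ln_mono) auto
        show ?thesis unfolding V_def L_def using 1 2 3 lamZ[OF s(1)] by linarith
      qed
    qed (rule c)
  qed
qed

lemma collins_stewart_limits:
  assumes "0 < \<eta>" "\<forall>\<^sub>F t in at_top. \<eta> \<le> n1 t" "0 < w" "\<forall>\<^sub>F t in at_top. w \<le> Om t"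
  shows "(s1 \<longlongrightarrow> - \<mu>) at_top" "(s2 \<longlongrightarrow> \<mu> / 2) at_top" "(s3 \<longlongrightarrow> \<mu> / 2) at_top"
    "(n1 \<longlongrightarrow> sqrt (3 * \<mu> * (1 - \<mu>))) at_top" "(n2 \<longlongrightarrow> 0) at_top" "(n3 \<longlongrightarrow> 0) at_top"
proof -
  note cs = collins_stewart_case[OF assms]
  show "(n2 \<longlongrightarrow> 0) at_top" "(n3 \<longlongrightarrow> 0) at_top" by (rule cs)+
  have zero: "(f \<longlongrightarrow> 0) at_top" if "\<And>t. c * (f t)\<^sup>2 \<le> Y t + ((n1 t)\<^sup>2 / 12 - mc)\<^sup>2" "0 < c" for f c
  proof (rule tendsto_zero_if_power2, rule tendsto_sandwich[OF _ _ tendsto_const])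
    show "((\<lambda>t. (Y t + ((n1 t)\<^sup>2 / 12 - mc)\<^sup>2) / c) \<longlongrightarrow> 0) at_top"
      using tendsto_divide[OF cs(3) tendsto_const[of c]] that(2) by simp
    show "\<forall>\<^sub>F t in at_top. (f t)\<^sup>2 \<le> (Y t + ((n1 t)\<^sup>2 / 12 - mc)\<^sup>2) / c"
      using that by (simp add: pos_le_divide_eq mult.commute)
  qed simp
  have a: "((\<lambda>t. s1 t / 2 + hh) \<longlongrightarrow> 0) at_top" by (rule zero[of 1]) (simp_all add: Y_def)
  have b: "((\<lambda>t. s2 t - s3 t) \<longlongrightarrow> 0) at_top" by (rule zero[of "1 / 12"]) (simp_all add: Y_def)
  have c: "((\<lambda>t. (n1 t)\<^sup>2 / 12 - mc) \<longlongrightarrow> 0) at_top" by (rule zero[of 1]) (simp_all add: Y_def)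
  have "((\<lambda>t. 2 * (s1 t / 2 + hh) - 2 * hh) \<longlongrightarrow> 2 * 0 - 2 * hh) at_top" by (intro tendsto_intros a)
  then show s1: "(s1 \<longlongrightarrow> - \<mu>) at_top" by (simp add: hh_def)
  have ev: "\<forall>\<^sub>F t in at_top. (- s1 t + (s2 t - s3 t)) / 2 = s2 t" "\<forall>\<^sub>F t in at_top. (- s1 t - (s2 t - s3 t)) / 2 = s3 t"
    using eventually_gt_at_top[of 0] by (eventually_elim, use s_sum in force)+
  have "((\<lambda>t. (- s1 t + (s2 t - s3 t)) / 2) \<longlongrightarrow> (- (- \<mu>) + 0) / 2) at_top"
    by (intro tendsto_intros s1 b) simp
  from Lim_transform_eventually[OF this ev(1)] show "(s2 \<longlongrightarrow> \<mu> / 2) at_top" by simp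
  have "((\<lambda>t. (- s1 t - (s2 t - s3 t)) / 2) \<longlongrightarrow> (- (- \<mu>) - 0) / 2) at_top"
    by (intro tendsto_intros s1 b) simp
  from Lim_transform_eventually[OF this ev(2)] show "(s3 \<longlongrightarrow> \<mu> / 2) at_top" by simp
  have "((\<lambda>t. sqrt (12 * ((n1 t)\<^sup>2 / 12 - mc) + 12 * mc)) \<longlongrightarrow> sqrt (12 * 0 + 12 * mc)) at_top"
    by (intro tendsto_intros c)
  moreover have "\<forall>\<^sub>F t in at_top. sqrt (12 * ((n1 t)\<^sup>2 / 12 - mc) + 12 * mc) = n1 t"
    using eventually_gt_at_top[of 0] by eventually_elim (use n_pos in \<open>simp add: less_imp_le\<close>)
  ultimately have "(n1 \<longlongrightarrow> sqrt (12 * 0 + 12 * mc)) at_top" by (rule Lim_transform_eventually)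
  moreover have m: "12 * 0 + 12 * mc = 3 * \<mu> * (1 - \<mu>)" by (simp add: mc_def hh_def \<kappa>_def field_simps)
  ultimately show "(n1 \<longlongrightarrow> sqrt (3 * \<mu> * (1 - \<mu>))) at_top" by metis
qed

section \<open>Persistent matter: all \<open>n\<close> vanish, or one fixed component stays
  large\<close>

lemma large_component:
  assumes \<eta>: "0 < \<eta>" and large: "\<forall>\<^sub>F t in at_top. \<eta> \<le> n1 t \<or> \<eta> \<le> n2 t \<or> \<eta> \<le> n3 t"
  shows "(\<forall>\<^sub>F t in at_top. \<eta> \<le> n1 t) \<or> (\<forall>\<^sub>F t in at_top. \<eta> \<le> n2 t) \<or> (\<forall>\<^sub>F t in at_top. \<eta> \<le> n3 t)"
proof -
  have e: "0 < \<eta>\<^sup>2 / 4" using \<eta> by simp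
  note small = order_tendstoD(2)[OF n12 e] order_tendstoD(2)[OF n23 e] order_tendstoD(2)[OF n31 e]
  have "\<forall>\<^sub>F t in at_top. 0 < t \<and> (\<eta> \<le> n1 t \<or> \<eta> \<le> n2 t \<or> \<eta> \<le> n3 t)
      \<and> n1 t * n2 t < \<eta>\<^sup>2 / 4 \<and> n2 t * n3 t < \<eta>\<^sup>2 / 4 \<and> n3 t * n1 t < \<eta>\<^sup>2 / 4"
    using eventually_gt_at_top[of 0] large small by eventually_elim blast
  then obtain T where T: "\<And>t. T \<le> t \<Longrightarrow> 0 < t \<and> (\<eta> \<le> n1 t \<or> \<eta> \<le> n2 t \<or> \<eta> \<le> n3 t)
      \<and> n1 t * n2 t < \<eta>\<^sup>2 / 4 \<and> n2 t * n3 t < \<eta>\<^sup>2 / 4 \<and> n3 t * n1 t < \<eta>\<^sup>2 / 4"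
    unfolding eventually_at_top_linorder by blast
  have cont: "continuous_on {T..t} n1" "continuous_on {T..t} n2" "continuous_on {T..t} n3" for t
    by (intro continuous_at_imp_continuous_on ballI; rule DERIV_isCont, (rule D_n1 D_n2 D_n3), use T in auto)+
  consider "\<eta> \<le> n1 T" | "\<eta> \<le> n2 T" | "\<eta> \<le> n3 T" using T[of T] by blast
  then show ?thesis
  proof cases
    case 1
    have "\<eta> \<le> n1 t" if "T \<le> t" for t
      by (rule persistent_large_component[OF cont(1) that _ _ _ \<eta> 1, of n2 n3])
        (use T in \<open>auto simp: mult.commute\<close>)
    then show ?thesis unfolding eventually_at_top_linorder by blast
  next
    case 2
    have "\<eta> \<le> n2 t" if "T \<le> t" for t
      by (rule persistent_large_component[OF cont(2) that _ _ _ \<eta> 2, of n3 n1])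
        (use T in \<open>auto simp: mult.commute\<close>)
    then show ?thesis unfolding eventually_at_top_linorder by blast
  next
    case 3
    have "\<eta> \<le> n3 t" if "T \<le> t" for t
      by (rule persistent_large_component[OF cont(3) that _ _ _ \<eta> 3, of n1 n2])
        (use T in \<open>auto simp: mult.commute\<close>)
    then show ?thesis unfolding eventually_at_top_linorder by blast
  qed
qed

lemma matter_cases:
  assumes w: "0 < w" "\<forall>\<^sub>F t in at_top. w \<le> Om t"
  obtains (friedmann) "(s1 \<longlongrightarrow> 0) at_top" "(s2 \<longlongrightarrow> 0) at_top" "(s3 \<longlongrightarrow> 0) at_top"
      "(n1 \<longlongrightarrow> 0) at_top" "(n2 \<longlongrightarrow> 0) at_top" "(n3 \<longlongrightarrow> 0) at_top"
  | (large) \<eta> where "0 < \<eta>"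
      "(\<forall>\<^sub>F t in at_top. \<eta> \<le> n1 t) \<or> (\<forall>\<^sub>F t in at_top. \<eta> \<le> n2 t) \<or> (\<forall>\<^sub>F t in at_top. \<eta> \<le> n3 t)"
proof -
  define \<alpha> where "\<alpha> = min 1 (\<kappa> * \<mu> * w\<^sup>2 / 16)"
  have \<alpha>: "0 < \<alpha>" "\<alpha> \<le> 1" "16 * \<alpha> \<le> \<kappa> * \<mu> * w\<^sup>2" using kappa mu_pos w by (auto simp: \<alpha>_def)
  show thesis
  proof (cases "\<exists>\<nu>>0. \<forall>\<^sub>F t in at_top. \<nu> \<le> N \<alpha> t")
    case False
    note fr = friedmann_case[OF w \<alpha> False]
    have "((\<lambda>t. 4 * A t) \<longlongrightarrow> 4 * 0) at_top" by (intro tendsto_intros fr)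
    then have A: "((\<lambda>t. 4 * A t) \<longlongrightarrow> 0) at_top" by simp
    have s: "(f \<longlongrightarrow> 0) at_top" if "\<And>t. 0 < t \<Longrightarrow> (f t)\<^sup>2 \<le> 4 * A t" for f
    proof (rule tendsto_zero_if_power2, rule tendsto_sandwich[OF _ _ tendsto_const A])
      show "\<forall>\<^sub>F t in at_top. (f t)\<^sup>2 \<le> 4 * A t" using eventually_gt_at_top[of 0] by eventually_elim (rule that)
    qed simp
    show thesis
      by (rule friedmann[OF s s s N_tendsto_imp[OF \<alpha>(1,2) fr(1)]]; rule s_le)
  next
    case True
    then obtain \<nu> where \<nu>: "0 < \<nu>" "\<forall>\<^sub>F t in at_top. \<nu> \<le> N \<alpha> t" by blast
    define \<eta> where "\<eta> = (\<nu> / 3) powr (1 / \<alpha>)"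
    have \<eta>: "0 < \<eta>" using \<nu> by (simp add: \<eta>_def)
    have le: "\<eta> \<le> y" if "\<nu> / 3 \<le> y powr \<alpha>" "0 < y" for y
    proof -
      have "\<eta> \<le> (y powr \<alpha>) powr (1 / \<alpha>)" unfolding \<eta>_def using that \<nu>(1) \<alpha>(1) by (intro powr_mono2) auto
      also have "\<dots> = y" using that \<alpha>(1) by (simp add: powr_powr)
      finally show ?thesis .
    qed
    have "\<forall>\<^sub>F t in at_top. \<eta> \<le> n1 t \<or> \<eta> \<le> n2 t \<or> \<eta> \<le> n3 t"
      using \<nu>(2) eventually_gt_at_top[of 0]
    proof eventually_elim
      case (elim t)
      have "\<nu> / 3 \<le> n1 t powr \<alpha> \<or> \<nu> / 3 \<le> n2 t powr \<alpha> \<or> \<nu> / 3 \<le> n3 t powr \<alpha>"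
        using elim(1) unfolding N_def by linarith
      then show ?case using le n_pos[OF elim(2)] by blast
    qed
    from large[OF \<eta> large_component[OF \<eta> this]] show thesis .
  qed
qed

end

section \<open>From the dynamical system to the Hubble-normalised variables\<close>

lemma state_components:
  "Hc y = fst y" "Sig y 1 = fst (snd y)" "Sig y 2 = fst (snd (snd y))" "Sig y 3 = fst (snd (snd (snd y)))"
  "Nn y 1 = fst (snd (snd (snd (snd y))))" "Nn y 2 = fst (snd (snd (snd (snd (snd y)))))"
  "Nn y 3 = snd (snd (snd (snd (snd (snd y)))))"
  by (cases y; simp)+

lemma state_components_Suc_0:
  "Sig y (Suc 0) = fst (snd y)" "Nn y (Suc 0) = fst (snd (snd (snd (snd y))))"
  using state_components(2,5)[of y] by simp_all

lemma state_eq: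
  "y = (Hc y, Sig y 1, Sig y 2, Sig y 3, Nn y 1, Nn y 2, Nn y 3)"
  by (cases y) simp

lemma isCont_components:
  "isCont Hc y" "isCont (\<lambda>y. Sig y i) y" "isCont (\<lambda>y. Nn y i) y"
proof -
  have H: "Hc = fst" by (auto simp: state_components)
  \<comment> \<open>Every index other than 1 and 2 reads the third component, so three cases cover
    all \<open>i\<close>.\<close>
  have S: "(\<lambda>y. Sig y i) = (if i = 1 then (\<lambda>y. Sig y 1) else if i = 2 then (\<lambda>y. Sig y 2) else (\<lambda>y. Sig y 3))"
    by (auto simp: fun_eq_iff)
  have N: "(\<lambda>y. Nn y i) = (if i = 1 then (\<lambda>y. Nn y 1) else if i = 2 then (\<lambda>y. Nn y 2) else (\<lambda>y. Nn y 3))"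
    by (auto simp: fun_eq_iff)
  show "isCont Hc y" unfolding H by (intro continuous_intros)
  show "isCont (\<lambda>y. Sig y i) y" unfolding S by (auto simp: state_components state_components_Suc_0 intro!: continuous_intros)
  show "isCont (\<lambda>y. Nn y i) y" unfolding N by (auto simp: state_components state_components_Suc_0 intro!: continuous_intros)
qed

lemma isCont_field: "isCont (field w) y" "isCont Omega y" "isCont (qbar w) y"
proof -
  show O: "isCont Omega y" for y unfolding Omega_def[abs_def] Sigma2_def
    by (intro continuous_intros isCont_components) auto
  show q: "isCont (qbar w) y" for y unfolding qbar_def[abs_def] Sigma2_def
    by (intro continuous_intros isCont_components O) auto
  have F: "isCont Fbar y" unfolding Fbar_def[abs_def] by (intro continuous_intros isCont_components) auto
  have S3: "isCont (\<lambda>x. S3 x a b c) y" for a b c unfolding S3_def by (intro continuous_intros isCont_components) auto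
  show "isCont (field w) y" unfolding field_def[abs_def] mk_state_def
    by (simp, intro continuous_intros isCont_components q F S3)
qed

lemma omega_limit_if_tendsto:
  assumes "(x \<longlongrightarrow> p) at_top"
  shows "omega_limit x = {p}"
proof -
  have 1: "(\<lambda>n. x (s n)) \<longlonglongrightarrow> p" if "filterlim s at_top sequentially" for s :: "nat \<Rightarrow> real"
    using assms that by (rule filterlim_compose)
  have "p \<in> omega_limit x"
    unfolding omega_limit_def using 1 filterlim_real_sequentially by blast
  moreover have "r = p" if "r \<in> omega_limit x" for r
    using that 1 LIMSEQ_unique unfolding omega_limit_def by blast
  ultimately show ?thesis by blast
qed

locale orbit =
  fixes w :: real and x :: "real \<Rightarrow> state"
  assumes w: "- 1 / 3 < w" "w < 1" and orb: "is_orbit w x"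
begin

definition \<mu> where "\<mu> = (1 + 3 * w) / 4"
definition H where "H t = Hc (x t)"
definition s where "s i t = Sig (x t) i / H t"
definition n where "n i t = Nn (x t) i / H t"
definition Om where "Om t = Omega (x t) / (H t)\<^sup>2"
definition q where "q t = qbar w (x t) / (H t)\<^sup>2"

lemma in_B_IX: "0 \<le> t \<Longrightarrow> x t \<in> B_IX"
  using orb by (simp add: is_orbit_def)

lemma admissibleD:
  assumes "0 < t"
  shows "Sig (x t) 1 + Sig (x t) 2 + Sig (x t) 3 = 0"
    "(H t)\<^sup>2 + (Nn (x t) 1 * Nn (x t) 2 + Nn (x t) 1 * Nn (x t) 3 + Nn (x t) 2 * Nn (x t) 3) / 6 = 1"
    "0 \<le> Omega (x t)" "0 < Nn (x t) 1" "0 < Nn (x t) 2" "0 < Nn (x t) 3" "0 < H t"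
  using in_B_IX[of t] assms by (auto simp: B_IX_def admissible_def H_def)

text \<open>At time 0 the derivative is only one-sided; therefore the normalised system is stated
  for positive times.\<close>

lemma x_vderiv: "0 < t \<Longrightarrow> (x has_vector_derivative field w (x t)) (at t)"
proof -
  assume t: "0 < t"
  then have "(x has_vector_derivative field w (x t)) (at t within {0..})"
    using orb by (simp add: is_orbit_def)
  moreover have "at t within {0..} = at t" using t by (intro at_within_interior) (simp add: interior_real_atLeast)
  ultimately show ?thesis by simp
qed

section \<open>Equations for the normalised variables\<close>

lemma D_components:
  assumes t: "0 < t"
  shows "(H has_real_derivative qbar w (x t) * (1 - (H t)\<^sup>2) - Fbar (x t) * H t) (at t)"
    "((\<lambda>t. Sig (x t) 1) has_real_derivative Sig (x t) 1 * ((2 - qbar w (x t)) * H t - Fbar (x t)) + S3 (x t) 1 2 3) (at t)"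
    "((\<lambda>t. Sig (x t) 2) has_real_derivative Sig (x t) 2 * ((2 - qbar w (x t)) * H t - Fbar (x t)) + S3 (x t) 2 3 1) (at t)"
    "((\<lambda>t. Sig (x t) 3) has_real_derivative Sig (x t) 3 * ((2 - qbar w (x t)) * H t - Fbar (x t)) + S3 (x t) 3 1 2) (at t)"
    "((\<lambda>t. Nn (x t) 1) has_real_derivative - Nn (x t) 1 * (qbar w (x t) * H t + 2 * Sig (x t) 1 + Fbar (x t))) (at t)"
    "((\<lambda>t. Nn (x t) 2) has_real_derivative - Nn (x t) 2 * (qbar w (x t) * H t + 2 * Sig (x t) 2 + Fbar (x t))) (at t)"
    "((\<lambda>t. Nn (x t) 3) has_real_derivative - Nn (x t) 3 * (qbar w (x t) * H t + 2 * Sig (x t) 3 + Fbar (x t))) (at t)"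
proof -
  define F where "F = field w (x t)"
  note V = x_vderiv[OF t, folded F_def]
  note snd = bounded_linear.has_vector_derivative[OF bounded_linear_snd]
  note fst = bounded_linear.has_vector_derivative[OF bounded_linear_fst]
  note V1 = snd[OF V]
  note V2 = snd[OF V1]
  note V3 = snd[OF V2]
  note V4 = snd[OF V3]
  note V5 = snd[OF V4]
  note R = has_real_derivative_iff_has_vector_derivative
  note D = fst[OF V, folded R] fst[OF V1, folded R] fst[OF V2, folded R] fst[OF V3, folded R]
    fst[OF V4, folded R] fst[OF V5, folded R] snd[OF V5, folded R]
  have F: "F = (Hc F, Sig F 1, Sig F 2, Sig F 3, Nn F 1, Nn F 2, Nn F 3)" by (rule state_eq)
  have C: "Hc F = qbar w (x t) * (1 - (H t)\<^sup>2) - Fbar (x t) * H t"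
    "Sig F 1 = Sig (x t) 1 * ((2 - qbar w (x t)) * H t - Fbar (x t)) + S3 (x t) 1 2 3"
    "Sig F 2 = Sig (x t) 2 * ((2 - qbar w (x t)) * H t - Fbar (x t)) + S3 (x t) 2 3 1"
    "Sig F 3 = Sig (x t) 3 * ((2 - qbar w (x t)) * H t - Fbar (x t)) + S3 (x t) 3 1 2"
    "Nn F 1 = - Nn (x t) 1 * (qbar w (x t) * H t + 2 * Sig (x t) 1 + Fbar (x t))"
    "Nn F 2 = - Nn (x t) 2 * (qbar w (x t) * H t + 2 * Sig (x t) 2 + Fbar (x t))"
    "Nn F 3 = - Nn (x t) 3 * (qbar w (x t) * H t + 2 * Sig (x t) 3 + Fbar (x t))"
    by (simp_all add: F_def field_def mk_state_def H_def)
  have "H = (\<lambda>t. fst (x t))" by (auto simp: H_def state_components)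
  then have "(H has_real_derivative Hc F) (at t)" using D(1) by (simp add: state_components)
  then show "(H has_real_derivative qbar w (x t) * (1 - (H t)\<^sup>2) - Fbar (x t) * H t) (at t)" unfolding C(1) .
  have S: "((\<lambda>t. Sig (x t) 1) has_real_derivative Sig F 1) (at t)" "((\<lambda>t. Sig (x t) 2) has_real_derivative Sig F 2) (at t)"
    "((\<lambda>t. Sig (x t) 3) has_real_derivative Sig F 3) (at t)"
    using D(2-4) unfolding state_components by blast+
  have N: "((\<lambda>t. Nn (x t) 1) has_real_derivative Nn F 1) (at t)" "((\<lambda>t. Nn (x t) 2) has_real_derivative Nn F 2) (at t)"
    "((\<lambda>t. Nn (x t) 3) has_real_derivative Nn F 3) (at t)"
    using D(5-7) unfolding state_components by blast+
  show "((\<lambda>t. Sig (x t) 1) has_real_derivative Sig (x t) 1 * ((2 - qbar w (x t)) * H t - Fbar (x t)) + S3 (x t) 1 2 3) (at t)"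
    "((\<lambda>t. Sig (x t) 2) has_real_derivative Sig (x t) 2 * ((2 - qbar w (x t)) * H t - Fbar (x t)) + S3 (x t) 2 3 1) (at t)"
    "((\<lambda>t. Sig (x t) 3) has_real_derivative Sig (x t) 3 * ((2 - qbar w (x t)) * H t - Fbar (x t)) + S3 (x t) 3 1 2) (at t)"
    using S unfolding C by blast+
  show "((\<lambda>t. Nn (x t) 1) has_real_derivative - Nn (x t) 1 * (qbar w (x t) * H t + 2 * Sig (x t) 1 + Fbar (x t))) (at t)"
    "((\<lambda>t. Nn (x t) 2) has_real_derivative - Nn (x t) 2 * (qbar w (x t) * H t + 2 * Sig (x t) 2 + Fbar (x t))) (at t)"
    "((\<lambda>t. Nn (x t) 3) has_real_derivative - Nn (x t) 3 * (qbar w (x t) * H t + 2 * Sig (x t) 3 + Fbar (x t))) (at t)"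
    using N unfolding C by blast+
qed

lemma D_n:
  assumes t: "0 < t"
  shows "(n 1 has_real_derivative - H t * (n 1 t * (q t + 2 * s 1 t))) (at t)"
    "(n 2 has_real_derivative - H t * (n 2 t * (q t + 2 * s 2 t))) (at t)"
    "(n 3 has_real_derivative - H t * (n 3 t * (q t + 2 * s 3 t))) (at t)"
  unfolding n_def[abs_def] s_def q_def
  by (rule DERIV_cong[OF DERIV_divide[OF D_components(5)[OF t] D_components(1)[OF t]]]
      DERIV_cong[OF DERIV_divide[OF D_components(6)[OF t] D_components(1)[OF t]]]
      DERIV_cong[OF DERIV_divide[OF D_components(7)[OF t] D_components(1)[OF t]]];
    use admissibleD(7)[OF t] in \<open>simp add: field_simps power2_eq_square\<close>)+

lemma D_s:
  assumes t: "0 < t"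
  shows "(s 1 has_real_derivative H t * ((2 - q t) * s 1 t
      + (n 1 t * (2 * n 1 t - n 2 t - n 3 t) - (n 2 t - n 3 t)\<^sup>2) / 3)) (at t)"
    "(s 2 has_real_derivative H t * ((2 - q t) * s 2 t
      + (n 2 t * (2 * n 2 t - n 3 t - n 1 t) - (n 3 t - n 1 t)\<^sup>2) / 3)) (at t)"
    "(s 3 has_real_derivative H t * ((2 - q t) * s 3 t
      + (n 3 t * (2 * n 3 t - n 1 t - n 2 t) - (n 1 t - n 2 t)\<^sup>2) / 3)) (at t)"
proof -
  have H: "0 < H t" by (rule admissibleD(7)[OF t])
  \<comment> \<open>Quotient rule: the terms with \<open>F\<close> and those with
    \<open>Q * h^2\<close> cancel, leaving \<open>2 * a * h^2 - a * Q\<close> and the curvature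
    term.\<close>
  have c: "((a * ((2 - Q) * h - F) + S) * h - a * (Q * (1 - h\<^sup>2) - F * h)) / (h * h) = h * ((2 - Q / h\<^sup>2) * (a / h) + S / h\<^sup>2)"
    if "0 < h" for a Q h F S :: real
    using that by (simp add: field_simps power2_eq_square)
  have S3: "S3 (x t) a b c / (H t)\<^sup>2 = (n a t * (2 * n a t - n b t - n c t) - (n b t - n c t)\<^sup>2) / 3" for a b c
    using H by (simp add: S3_def n_def field_simps power2_eq_square)
  show "(s 1 has_real_derivative H t * ((2 - q t) * s 1 t
      + (n 1 t * (2 * n 1 t - n 2 t - n 3 t) - (n 2 t - n 3 t)\<^sup>2) / 3)) (at t)"
    unfolding S3[symmetric] unfolding s_def[abs_def] q_def
    by (rule DERIV_cong[OF DERIV_divide[OF D_components(2)[OF t] D_components(1)[OF t]]]; (rule c)?) (use H in auto)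
  show "(s 2 has_real_derivative H t * ((2 - q t) * s 2 t
      + (n 2 t * (2 * n 2 t - n 3 t - n 1 t) - (n 3 t - n 1 t)\<^sup>2) / 3)) (at t)"
    unfolding S3[symmetric] unfolding s_def[abs_def] q_def
    by (rule DERIV_cong[OF DERIV_divide[OF D_components(3)[OF t] D_components(1)[OF t]]]; (rule c)?) (use H in auto)
  show "(s 3 has_real_derivative H t * ((2 - q t) * s 3 t
      + (n 3 t * (2 * n 3 t - n 1 t - n 2 t) - (n 1 t - n 2 t)\<^sup>2) / 3)) (at t)"
    unfolding S3[symmetric] unfolding s_def[abs_def] q_def
    by (rule DERIV_cong[OF DERIV_divide[OF D_components(4)[OF t] D_components(1)[OF t]]]; (rule c)?) (use H in auto)
qed

lemma mu: "0 < \<mu>" "\<mu> < 1" using w by (simp_all add: \<mu>_def)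

lemma hubble_algebra:
  assumes t: "0 < t"
  shows "(H t)\<^sup>2 * (1 + (n 1 t * n 2 t + n 2 t * n 3 t + n 3 t * n 1 t) / 6) = 1"
    "Om t = 1 + (n 1 t * n 2 t + n 2 t * n 3 t + n 3 t * n 1 t) / 6
        - ((s 1 t)\<^sup>2 + (s 2 t)\<^sup>2 + (s 3 t)\<^sup>2) / 6 - ((n 1 t)\<^sup>2 + (n 2 t)\<^sup>2 + (n 3 t)\<^sup>2) / 12"
    "q t = ((s 1 t)\<^sup>2 + (s 2 t)\<^sup>2 + (s 3 t)\<^sup>2) / 3 + 2 * \<mu> * Om t"
    "s 1 t + s 2 t + s 3 t = 0"
proof -
  note a = admissibleD[OF t]
  show 1: "(H t)\<^sup>2 * (1 + (n 1 t * n 2 t + n 2 t * n 3 t + n 3 t * n 1 t) / 6) = 1"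
    using a(2,7) by (simp add: n_def field_simps power2_eq_square)
  have h: "(H t)\<^sup>2 * (y / (H t)\<^sup>2) = y" for y using a(7) by simp
  have "(H t)\<^sup>2 * Om t = (H t)\<^sup>2 * (1 + (n 1 t * n 2 t + n 2 t * n 3 t + n 3 t * n 1 t) / 6)
      - (H t)\<^sup>2 * (((s 1 t)\<^sup>2 + (s 2 t)\<^sup>2 + (s 3 t)\<^sup>2) / 6 + ((n 1 t)\<^sup>2 + (n 2 t)\<^sup>2 + (n 3 t)\<^sup>2) / 12)"
    unfolding 1 Om_def h unfolding Omega_def Sigma2_def s_def n_def power_divide using a(7)
    by (simp add: field_simps)
  also have "\<dots> = (H t)\<^sup>2 * (1 + (n 1 t * n 2 t + n 2 t * n 3 t + n 3 t * n 1 t) / 6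
        - ((s 1 t)\<^sup>2 + (s 2 t)\<^sup>2 + (s 3 t)\<^sup>2) / 6 - ((n 1 t)\<^sup>2 + (n 2 t)\<^sup>2 + (n 3 t)\<^sup>2) / 12)"
    by (simp add: right_diff_distrib distrib_left)
  finally show "Om t = 1 + (n 1 t * n 2 t + n 2 t * n 3 t + n 3 t * n 1 t) / 6
        - ((s 1 t)\<^sup>2 + (s 2 t)\<^sup>2 + (s 3 t)\<^sup>2) / 6 - ((n 1 t)\<^sup>2 + (n 2 t)\<^sup>2 + (n 3 t)\<^sup>2) / 12"
    using a(7) by simp
  show "q t = ((s 1 t)\<^sup>2 + (s 2 t)\<^sup>2 + (s 3 t)\<^sup>2) / 3 + 2 * \<mu> * Om t"
    unfolding q_def qbar_def Om_def Sigma2_def s_def \<mu>_def using a(7) by (simp add: power_divide field_simps)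
  show "s 1 t + s 2 t + s 3 t = 0"
    using a(1) unfolding s_def by (simp flip: add_divide_distrib)
qed

lemma H_le_1: "0 < t \<Longrightarrow> H t \<le> 1"
proof -
  assume t: "0 < t"
  note a = admissibleD[OF t]
  have "0 < (Nn (x t) 1 * Nn (x t) 2 + Nn (x t) 1 * Nn (x t) 3 + Nn (x t) 2 * Nn (x t) 3) / 6"
    by (intro divide_pos_pos add_pos_pos mult_pos_pos a) simp
  then have "(H t)\<^sup>2 \<le> 1" using a(2) by linarith
  then have "(H t)\<^sup>2 \<le> 1\<^sup>2" by simp
  then show ?thesis by (rule power2_le_imp_le) simp
qed

section \<open>Compactness of the orbit and its limit points\<close>

definition K :: "state set" where
  "K = {0..1} \<times> {-3..3} \<times> {-3..3} \<times> {-3..3} \<times> {0..4} \<times> {0..4} \<times> {0..4}"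

lemma compact_K: "compact K"
  unfolding K_def by (intro compact_Times compact_Icc)

lemma x_in_K: "0 < t \<Longrightarrow> x t \<in> K"
proof -
  assume t: "0 < t"
  note a = admissibleD[OF t]
  have O: "(Sig (x t) 1)\<^sup>2 / 6 + (Sig (x t) 2)\<^sup>2 / 6 + (Sig (x t) 3)\<^sup>2 / 6 + (Nn (x t) 1)\<^sup>2 / 12 + (Nn (x t) 2)\<^sup>2 / 12 + (Nn (x t) 3)\<^sup>2 / 12 \<le> 1"
    using a(3) unfolding Omega_def Sigma2_def by (simp add: add_divide_distrib)
  have sq: "y \<le> c" "- c \<le> y" if "y\<^sup>2 \<le> c\<^sup>2" "0 \<le> c" for y c :: real
    using abs_le_square_iff[of y c] that by auto
  have nn: "0 \<le> (Sig (x t) 1)\<^sup>2" "0 \<le> (Sig (x t) 2)\<^sup>2" "0 \<le> (Sig (x t) 3)\<^sup>2" "0 \<le> (Nn (x t) 1)\<^sup>2" "0 \<le> (Nn (x t) 2)\<^sup>2" "0 \<le> (Nn (x t) 3)\<^sup>2"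
    by simp_all
  have num: "(9::real) = 3\<^sup>2" "(16::real) = 4\<^sup>2" by simp_all
  have "(Sig (x t) 1)\<^sup>2 \<le> 9" "(Sig (x t) 2)\<^sup>2 \<le> 9" "(Sig (x t) 3)\<^sup>2 \<le> 9"
    using O nn by linarith+
  note s = this[unfolded num]
  have "(Nn (x t) 1)\<^sup>2 \<le> 16" "(Nn (x t) 2)\<^sup>2 \<le> 16" "(Nn (x t) 3)\<^sup>2 \<le> 16"
    using O nn by linarith+
  note n = this[unfolded num]
  have "(H t, Sig (x t) 1, Sig (x t) 2, Sig (x t) 3, Nn (x t) 1, Nn (x t) 2, Nn (x t) 3) \<in> K"
    unfolding K_def using H_le_1[OF t] a(4-7) sq[OF s(1)] sq[OF s(2)] sq[OF s(3)] sq[OF n(1)] sq[OF n(2)] sq[OF n(3)]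
    by simp
  then show ?thesis unfolding H_def state_eq[of "x t", symmetric] .
qed

text \<open>The field is bounded on the compact box, so the orbit is Lipschitz. Composed with
  continuous functions of the state this supplies the uniform continuity for Barbalat's
  lemma.\<close>

lemma x_uniformly_continuous: "uniformly_continuous_on {0<..} x"
proof -
  have cont: "continuous_on K (field w)" by (intro continuous_at_imp_continuous_on ballI isCont_field)
  have "bounded (field w ` K)" by (intro compact_imp_bounded compact_continuous_image cont compact_K)
  then obtain C where C: "\<And>y. y \<in> K \<Longrightarrow> norm (field w y) \<le> C" unfolding bounded_iff by blast
  have C0: "0 \<le> C" using C[OF x_in_K[of 1]] norm_ge_zero[of "field w (x 1)"] by linarith
  have "C-lipschitz_on {0<..} x"
  proof (rule bounded_derivative_imp_lipschitz)
    show "(x has_derivative (\<lambda>h. h *\<^sub>R field w (x t))) (at t within {0<..})" if "t \<in> {0<..}" for t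
      using x_vderiv[of t] that unfolding has_vector_derivative_def by (auto intro: has_derivative_at_withinI)
    show "onorm (\<lambda>h. h *\<^sub>R field w (x t)) \<le> C" if "t \<in> {0<..}" for t
    proof (rule onorm_le)
      fix h :: real
      show "norm (h *\<^sub>R field w (x t)) \<le> C * norm h"
        using mult_right_mono[OF C[OF x_in_K[of t]], of "norm h"] that by (simp add: mult.commute)
    qed
  qed (use C0 in auto)
  then show ?thesis by (rule lipschitz_on_uniformly_continuous)
qed

lemma uniformly_continuous_along:
  assumes "\<And>y. isCont (\<psi> :: state \<Rightarrow> real) y"
  shows "uniformly_continuous_on {0<..} (\<lambda>t. \<psi> (x t))"
proof -
  have "uniformly_continuous_on K \<psi>"
    by (intro compact_uniformly_continuous continuous_at_imp_continuous_on ballI assms compact_K)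
  then have "uniformly_continuous_on (x ` {0<..}) \<psi>"
    unfolding uniformly_continuous_on_def using x_in_K by (metis (no_types, lifting) greaterThan_iff imageE)
  with x_uniformly_continuous show ?thesis by (rule uniformly_continuous_on_compose)
qed

lemma omega_limit_if_frequently:
  assumes "\<exists>\<^sub>F t in at_top. c \<le> \<psi> (x t)" and cont: "\<And>y. isCont (\<psi> :: state \<Rightarrow> real) y"
  obtains p where "p \<in> omega_limit x" "c \<le> \<psi> p"
proof -
  have "\<exists>t. real k < t \<and> c \<le> \<psi> (x t)" for k
    using frequently_ex[OF frequently_eventually_conj[OF assms(1) eventually_gt_at_top[of "real k"]]] by blast
  then obtain f where f: "\<And>k. real k < f k" "\<And>k. c \<le> \<psi> (x (f k))" by metis
  have "0 < f k" for k using f(1)[of k] by linarith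
  then have "\<forall>k. x (f k) \<in> K" using x_in_K by blast
  then obtain p r where r: "strict_mono r" "((\<lambda>k. x (f k)) \<circ> r) \<longlonglongrightarrow> p"
    using compact_K[unfolded compact_def, rule_format, of "\<lambda>k. x (f k)"] by blast
  have "filterlim f at_top sequentially"
    by (rule filterlim_at_top_mono[OF filterlim_real_sequentially])
      (intro always_eventually allI less_imp_le f(1))
  then have "filterlim (f \<circ> r) at_top sequentially"
    unfolding comp_def by (rule filterlim_compose) (rule filterlim_subseq[OF r(1)])
  then have "p \<in> omega_limit x" using r(2) unfolding omega_limit_def comp_def by blast
  moreover have "(\<lambda>k. \<psi> (x (f (r k)))) \<longlonglongrightarrow> \<psi> p"
    using r(2) by (intro isCont_tendsto_compose[OF cont]) (simp add: comp_def)
  then have "c \<le> \<psi> p" by (rule LIMSEQ_le_const) (use f(2) in auto)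
  ultimately show ?thesis by (rule that)
qed

lemma omega_limit_value:
  assumes "p \<in> omega_limit x" "\<And>y. isCont (\<psi> :: state \<Rightarrow> real) y" "((\<lambda>t. \<psi> (x t)) \<longlongrightarrow> L) at_top"
  shows "\<psi> p = L"
proof -
  obtain f where f: "filterlim f at_top sequentially" "(\<lambda>k. x (f k)) \<longlonglongrightarrow> p"
    using assms(1) unfolding omega_limit_def by blast
  have "(\<lambda>k. \<psi> (x (f k))) \<longlonglongrightarrow> \<psi> p" by (rule isCont_tendsto_compose[OF assms(2) f(2)])
  moreover have "(\<lambda>k. \<psi> (x (f k))) \<longlonglongrightarrow> L" by (rule filterlim_compose[OF assms(3) f(1)])
  ultimately show ?thesis by (rule LIMSEQ_unique)
qed

lemma omega_limit_nonneg:
  assumes "p \<in> omega_limit x" "\<And>y. isCont (\<psi> :: state \<Rightarrow> real) y" "\<And>t. 0 < t \<Longrightarrow> 0 \<le> \<psi> (x t)"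
  shows "0 \<le> \<psi> p"
proof -
  obtain f where f: "filterlim f at_top sequentially" "(\<lambda>k. x (f k)) \<longlonglongrightarrow> p"
    using assms(1) unfolding omega_limit_def by blast
  have "\<forall>\<^sub>F k in sequentially. 0 \<le> \<psi> (x (f k))"
    using f(1)[unfolded filterlim_at_top_dense, rule_format, of 0] by eventually_elim (rule assms(3))
  with isCont_tendsto_compose[OF assms(2) f(2)] show ?thesis
    by (rule tendsto_lowerbound) simp
qed

lemma omega_limit_admissible:
  assumes p: "p \<in> omega_limit x"
  shows "admissible p" "0 \<le> Nn p i"
proof -
  have [simp]: "Sig p (Suc 0) = Sig p 1" "Nn p (Suc 0) = Nn p 1" by simp_all
  have "Sig p 1 + Sig p 2 + Sig p 3 = 0"
    by (rule omega_limit_value[OF p, of "\<lambda>y. Sig y 1 + Sig y 2 + Sig y 3"])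
      (intro continuous_intros isCont_components, rule tendsto_eventually,
       rule eventually_mono[OF eventually_gt_at_top[of 0]], rule admissibleD)
  moreover have "(Hc p)\<^sup>2 + (Nn p 1 * Nn p 2 + Nn p 1 * Nn p 3 + Nn p 2 * Nn p 3) / 6 = 1"
    by (rule omega_limit_value[OF p, of "\<lambda>y. (Hc y)\<^sup>2 + (Nn y 1 * Nn y 2 + Nn y 1 * Nn y 3 + Nn y 2 * Nn y 3) / 6"])
      (intro continuous_intros isCont_components, simp, rule tendsto_eventually,
       rule eventually_mono[OF eventually_gt_at_top[of 0]], rule admissibleD(2)[unfolded H_def])
  moreover have "0 \<le> Omega p"
    by (rule omega_limit_nonneg[OF p, of Omega]) (rule isCont_field, rule admissibleD(3))
  ultimately show "admissible p" unfolding admissible_def by blast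
  have "0 \<le> Nn (x t) i" if t: "0 < t" for t
    using admissibleD(4-6)[OF t] by (cases "x t") (auto split: if_splits)
  then show "0 \<le> Nn p i" by (intro omega_limit_nonneg[OF p, of "\<lambda>y. Nn y i"] isCont_components)
qed

lemma qbar_nonneg: "0 < t \<Longrightarrow> 0 \<le> Sigma2 (x t)" "0 < t \<Longrightarrow> 0 \<le> qbar w (x t)"
  using admissibleD(3)[of t] w by (simp_all add: qbar_def Sigma2_def)

section \<open>Vanishing of the volume\<close>

text \<open>The difference of the first two equations is
  \<open>3 * (a - b) * (a + b - c) = 0\<close>, and \<open>c = a + b\<close> in the third would give
  \<open>a * b = 0\<close>; so all three numbers are equal. Then each square is 4, and the last
  constraint would require \<open>h^2 = - 1\<close>.\<close>

lemma no_flat_curvature_equilibrium: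
  fixes a b c h :: real
  assumes pos: "0 < a" "0 < b" "0 < c"
    and eq: "a * (2 * a - b - c) = (b - c)\<^sup>2" "b * (2 * b - c - a) = (c - a)\<^sup>2" "c * (2 * c - a - b) = (a - b)\<^sup>2"
    and sq: "a\<^sup>2 + b\<^sup>2 + c\<^sup>2 = 12" and h: "h\<^sup>2 + (a * b + a * c + b * c) / 6 = 1"
  shows False
proof -
  have ne: "r \<noteq> p + q" if "r * (2 * r - p - q) = (p - q)\<^sup>2" "0 < p" "0 < q" for p q r :: real
  proof
    assume "r = p + q"
    with that(1) have "p * q = 0" by (simp add: power2_eq_square algebra_simps)
    with that show False by simp
  qed
  have "(a - b) * (a + b - c) = 0" using eq(1,2) by (simp add: power2_eq_square algebra_simps)
  then have ab: "a = b" using ne[OF eq(3) pos(1,2)] by auto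
  have "(b - c) * (b + c - a) = 0" using eq(2,3) by (simp add: power2_eq_square algebra_simps)
  then have bc: "b = c" using ne[OF eq(1) pos(2,3)] by auto
  have "c\<^sup>2 = 4" using sq unfolding ab bc by simp
  with h have "h\<^sup>2 = - 1" unfolding ab bc by (simp add: power2_eq_square)
  with zero_le_power2[of h] show False by linarith
qed

text \<open>\<open>g\<close> decreases. If its limit is 0, it squeezes the volume. Otherwise
  \<open>ln g\<close> converges, and Barbalat's lemma makes \<open>qbar\<close>, hence
  \<open>Omega\<close> and all shears, vanish; a second application makes the derivatives of the
  shears vanish. A limit point with positive volume would then be a shear-free vacuum state with
  \<open>S3 = 0\<close>, which is impossible.\<close>

lemma volume_tendsto: "((\<lambda>t. Nn (x t) 1 * Nn (x t) 2 * Nn (x t) 3) \<longlongrightarrow> 0) at_top"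
proof -
  define g where "g t = n 1 t * n 2 t * n 3 t" for t
  have n_pos: "0 < n 1 t" "0 < n 2 t" "0 < n 3 t" if "0 < t" for t
    using admissibleD[OF that] by (auto simp: n_def)
  have g_pos: "0 < g t" if "0 < t" for t using n_pos[OF that] by (simp add: g_def)
  have D_g: "(g has_real_derivative - (3 * (H t * q t)) * g t) (at t)" if t: "0 < t" for t
  proof (unfold g_def[abs_def], rule DERIV_cong[OF DERIV_mult[OF DERIV_mult[OF D_n(1)[OF t] D_n(2)[OF t]] D_n(3)[OF t]]])
    have s: "s 3 t = - s 1 t - s 2 t" using hubble_algebra(4)[OF t] by linarith
    show "(- H t * (n 1 t * (q t + 2 * s 1 t)) * n 2 t + - H t * (n 2 t * (q t + 2 * s 2 t)) * n 1 t) * n 3 t +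
      - H t * (n 3 t * (q t + 2 * s 3 t)) * (n 1 t * n 2 t) = - (3 * (H t * q t)) * (n 1 t * n 2 t * n 3 t)"
      unfolding s by (simp add: algebra_simps)
  qed
  have Hq: "qbar w (x t) \<le> H t * q t" "0 \<le> H t * q t" if t: "0 < t" for t
  proof -
    have e: "H t * q t = qbar w (x t) / H t" using admissibleD(7)[OF t] by (simp add: q_def power2_eq_square)
    show "0 \<le> H t * q t" unfolding e using admissibleD(7)[OF t] qbar_nonneg[OF t] by simp
    have "qbar w (x t) * H t \<le> qbar w (x t) * 1"
      by (intro mult_left_mono H_le_1 qbar_nonneg t)
    then show "qbar w (x t) \<le> H t * q t" unfolding e using admissibleD(7)[OF t] by (simp add: pos_le_divide_eq)
  qed
  have g_mono: "g u \<le> g t" if "1 \<le> t" "t \<le> u" for t u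
  proof (rule DERIV_nonpos_imp_nonincreasing[OF that(2)])
    fix z assume "t \<le> z" "z \<le> u"
    then have z: "0 < z" using that by linarith
    have "- (3 * (H z * q z)) * g z \<le> 0" using Hq(2)[OF z] g_pos[OF z] by (simp add: mult_nonneg_nonneg)
    then show "\<exists>y. (g has_real_derivative y) (at z) \<and> y \<le> 0" using D_g[OF z] by blast
  qed
  have g_ge: "0 \<le> g t" if "1 \<le> t" for t using g_pos[of t] that by simp
  obtain L where L: "(g \<longlongrightarrow> L) at_top" by (rule nonincreasing_tendsto[OF g_mono g_ge])
  have vol: "Nn (x t) 1 * Nn (x t) 2 * Nn (x t) 3 = g t * (H t)^3" if t: "0 < t" for t
    using admissibleD(7)[OF t] by (simp add: g_def n_def power3_eq_cube)
  have L0: "0 \<le> L" by (rule tendsto_lowerbound[OF L]) (use g_ge in \<open>auto simp: eventually_at_top_linorder\<close>)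
  show ?thesis
  proof (cases "L = 0")
    case True
    show ?thesis
    proof (rule tendsto_sandwich[OF _ _ tendsto_const L[unfolded True]])
      show "\<forall>\<^sub>F t in at_top. 0 \<le> Nn (x t) 1 * Nn (x t) 2 * Nn (x t) 3"
        using eventually_gt_at_top[of 0] by eventually_elim (use admissibleD in \<open>simp add: less_imp_le\<close>)
      show "\<forall>\<^sub>F t in at_top. Nn (x t) 1 * Nn (x t) 2 * Nn (x t) 3 \<le> g t"
        using eventually_gt_at_top[of 0]
      proof eventually_elim
        case (elim t)
        have "(H t)^3 \<le> 1" using H_le_1[OF elim] admissibleD(7)[OF elim] by (intro power_le_one) auto
        then have "g t * (H t)^3 \<le> g t * 1" using g_pos[OF elim] by (intro mult_left_mono) auto
        then show ?case using vol[OF elim] by simp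
      qed
    qed
  next
    case False
    with L0 have Lp: "0 < L" by simp
    \<comment> \<open>The derivative of \<open>ln g\<close> is \<open>- 3 * H * q\<close>, and
      \<open>H * q = qbar / H\<close> dominates \<open>qbar\<close> because
      \<open>H \<le> 1\<close>.\<close>
    have q0: "((\<lambda>t. qbar w (x t)) \<longlongrightarrow> 0) at_top"
    proof (rule barbalat)
      show "((\<lambda>t. ln (g t)) has_real_derivative - (3 * (H t * q t))) (at t)" if t: "0 < t" for t
        by (rule DERIV_cong[OF DERIV_chain2[OF DERIV_ln[OF g_pos[OF t]] D_g[OF t]]]) (use g_pos[OF t] in simp)
      show "\<bar>qbar w (x t)\<bar> \<le> \<bar>- (3 * (H t * q t))\<bar>" if t: "0 < t" for t
        using Hq[OF t] qbar_nonneg(2)[OF t] by simp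
      show "((\<lambda>t. ln (g t)) \<longlongrightarrow> ln L) at_top" using Lp by (intro tendsto_ln L) simp
    qed (rule uniformly_continuous_along[OF isCont_field(3)])
    have Om0: "((\<lambda>t. Omega (x t)) \<longlongrightarrow> 0) at_top"
    proof (rule tendsto_sandwich[OF _ _ tendsto_const])
      show "((\<lambda>t. 2 / (1 + 3 * w) * qbar w (x t)) \<longlongrightarrow> 0) at_top"
        using tendsto_mult[OF tendsto_const q0, of "2 / (1 + 3 * w)"] by simp
      show "\<forall>\<^sub>F t in at_top. Omega (x t) \<le> 2 / (1 + 3 * w) * qbar w (x t)"
        using eventually_gt_at_top[of 0]
      proof eventually_elim
        case (elim t)
        have "(1 + 3 * w) / 2 * Omega (x t) \<le> qbar w (x t)" using qbar_nonneg(1)[OF elim] by (simp add: qbar_def)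
        then have "2 / (1 + 3 * w) * ((1 + 3 * w) / 2 * Omega (x t)) \<le> 2 / (1 + 3 * w) * qbar w (x t)"
          using w by (intro mult_left_mono) auto
        then show ?case using w by simp
      qed
      show "\<forall>\<^sub>F t in at_top. 0 \<le> Omega (x t)"
        using eventually_gt_at_top[of 0] by eventually_elim (rule admissibleD)
    qed
    have Sig0: "((\<lambda>t. Sig (x t) i) \<longlongrightarrow> 0) at_top" if i: "i \<in> {1, 2, 3}" for i
    proof (rule tendsto_rabs_zero_cancel, rule tendsto_sandwich[OF _ _ tendsto_const])
      show "((\<lambda>t. sqrt (3 * qbar w (x t))) \<longlongrightarrow> 0) at_top"
        using tendsto_real_sqrt[OF tendsto_mult[OF tendsto_const[of 3] q0]] by simp
      show "\<forall>\<^sub>F t in at_top. \<bar>Sig (x t) i\<bar> \<le> sqrt (3 * qbar w (x t))"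
        using eventually_gt_at_top[of 0]
      proof eventually_elim
        case (elim t)
        have "2 * Sigma2 (x t) \<le> qbar w (x t)" using admissibleD(3)[OF elim] w by (simp add: qbar_def)
        then have "(Sig (x t) 1)\<^sup>2 + (Sig (x t) 2)\<^sup>2 + (Sig (x t) 3)\<^sup>2 \<le> 3 * qbar w (x t)" by (simp add: Sigma2_def)
        then have "(Sig (x t) i)\<^sup>2 \<le> 3 * qbar w (x t)"
          using i zero_le_power2[of "Sig (x t) 1"] zero_le_power2[of "Sig (x t) 2"] zero_le_power2[of "Sig (x t) 3"]
          by (elim insertE emptyE; hypsubst; linarith)
        then have "sqrt ((Sig (x t) i)\<^sup>2) \<le> sqrt (3 * qbar w (x t))" by (rule real_sqrt_le_mono)
        then show ?case by simp
      qed
    qed simp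
    have cont_rate: "isCont (\<lambda>y. Sig (field w y) i) y" for i y
      by (rule isCont_o2[OF isCont_field(1) isCont_components(2)])
    \<comment> \<open>The derivative of each shear is a continuous function of the state, so
      Barbalat's lemma applies to the shear itself.\<close>
    have rate: "((\<lambda>t. Sig (field w (x t)) i) \<longlongrightarrow> 0) at_top" if i: "i \<in> {1, 2, 3}" for i
    proof (rule barbalat[OF _ order_refl Sig0[OF i] uniformly_continuous_along[OF cont_rate]])
      fix t :: real assume t: "0 < t"
      note D = D_components(2-4)[OF t]
      have "Sig (field w (x t)) 1 = Sig (x t) 1 * ((2 - qbar w (x t)) * H t - Fbar (x t)) + S3 (x t) 1 2 3"
        "Sig (field w (x t)) 2 = Sig (x t) 2 * ((2 - qbar w (x t)) * H t - Fbar (x t)) + S3 (x t) 2 3 1"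
        "Sig (field w (x t)) 3 = Sig (x t) 3 * ((2 - qbar w (x t)) * H t - Fbar (x t)) + S3 (x t) 3 1 2"
        by (simp_all add: field_def mk_state_def H_def)
      note D = D[folded this]
      show "((\<lambda>t. Sig (x t) i) has_real_derivative Sig (field w (x t)) i) (at t)"
        using i D by blast
    qed
    show ?thesis
    proof (rule ccontr)
      assume "\<not> ?thesis"
      then obtain e where e: "0 < e" "\<not> (\<forall>\<^sub>F t in at_top. dist (Nn (x t) 1 * Nn (x t) 2 * Nn (x t) 3) 0 < e)"
        unfolding tendsto_iff by blast
      then have "\<exists>\<^sub>F t in at_top. e \<le> \<bar>Nn (x t) 1 * Nn (x t) 2 * Nn (x t) 3\<bar>"
        by (simp add: not_eventually dist_real_def not_less)
      then obtain p where p: "p \<in> omega_limit x" "e \<le> \<bar>Nn p 1 * Nn p 2 * Nn p 3\<bar>"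
      proof (rule omega_limit_if_frequently[where \<psi> = "\<lambda>y. \<bar>Nn y 1 * Nn y 2 * Nn y 3\<bar>"])
        show "isCont (\<lambda>y. \<bar>Nn y 1 * Nn y 2 * Nn y 3\<bar>) y" for y by (intro continuous_intros isCont_components)
      qed
      have S: "Sig p i = 0" "Sig (field w p) i = 0" if "i \<in> {1, 2, 3}" for i
        using omega_limit_value[OF p(1) isCont_components(2) Sig0[OF that]]
          omega_limit_value[OF p(1) cont_rate rate[OF that]] by simp_all
      note S = S[of 1, simplified] S[of 2, simplified] S[of 3, simplified]
      have S3: "S3 p 1 2 3 = 0" "S3 p 2 3 1 = 0" "S3 p 3 1 2 = 0"
        using S by (simp_all add: field_def mk_state_def)
      have "Omega p = 0" by (rule omega_limit_value[OF p(1) isCont_field(2) Om0])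
      then have O: "(Nn p 1)\<^sup>2 + (Nn p 2)\<^sup>2 + (Nn p 3)\<^sup>2 = 12" using S by (simp add: Omega_def Sigma2_def)
      have "Nn p 1 * Nn p 2 * Nn p 3 \<noteq> 0" using p(2) e(1) by linarith
      then have ne: "Nn p 1 \<noteq> 0" "Nn p 2 \<noteq> 0" "Nn p 3 \<noteq> 0" by fastforce+
      have "0 < Nn p 1" "0 < Nn p 2" "0 < Nn p 3"
        using omega_limit_admissible(2)[OF p(1), of 1] omega_limit_admissible(2)[OF p(1), of 2]
          omega_limit_admissible(2)[OF p(1), of 3] ne by linarith+
      then show False
        by (rule no_flat_curvature_equilibrium[OF _ _ _ _ _ _ O, where h = "Hc p"])
          (use S3 omega_limit_admissible(1)[OF p(1)] in \<open>simp_all add: S3_def admissible_def\<close>)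
    qed
  qed
qed

lemma bianchi: "bianchi \<mu> H q Om (s 1) (s 2) (s 3) (n 1) (n 2) (n 3)"
proof
  show "((\<lambda>t. n 1 t * n 2 t * n 3 t * (H t)^3) \<longlongrightarrow> 0) at_top"
  proof (rule Lim_transform_eventually[OF volume_tendsto])
    show "\<forall>\<^sub>F t in at_top. Nn (x t) 1 * Nn (x t) 2 * Nn (x t) 3 = n 1 t * n 2 t * n 3 t * (H t)^3"
      using eventually_gt_at_top[of 0]
      by eventually_elim (use admissibleD(7) in \<open>simp add: n_def power3_eq_cube less_imp_neq[symmetric]\<close>)
  qed
  fix t :: real assume t: "0 < t"
  show "0 < n 1 t" "0 < n 2 t" "0 < n 3 t" using admissibleD[OF t] by (simp_all add: n_def)
  show "0 \<le> Om t" using admissibleD[OF t] by (simp add: Om_def)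
qed (rule mu admissibleD hubble_algebra D_s D_n | assumption)+

section \<open>Exclusion of the special points and conclusion\<close>

lemma x_tendsto:
  assumes "(H \<longlongrightarrow> h) at_top" "(s 1 \<longlongrightarrow> a 1) at_top" "(s 2 \<longlongrightarrow> a 2) at_top" "(s 3 \<longlongrightarrow> a 3) at_top"
    "(n 1 \<longlongrightarrow> b 1) at_top" "(n 2 \<longlongrightarrow> b 2) at_top" "(n 3 \<longlongrightarrow> b 3) at_top"
  shows "omega_limit x = {mk_state h (\<lambda>i. h * a i) (\<lambda>i. h * b i)}"
proof (rule omega_limit_if_tendsto, rule Lim_transform_eventually)
  show "((\<lambda>t. (H t, H t * s 1 t, H t * s 2 t, H t * s 3 t, H t * n 1 t, H t * n 2 t, H t * n 3 t))
      \<longlongrightarrow> mk_state h (\<lambda>i. h * a i) (\<lambda>i. h * b i)) at_top"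
    unfolding mk_state_def by (intro tendsto_intros assms)
  show "\<forall>\<^sub>F t in at_top. (H t, H t * s 1 t, H t * s 2 t, H t * s 3 t, H t * n 1 t, H t * n 2 t, H t * n 3 t) = x t"
    using eventually_gt_at_top[of 0]
  proof eventually_elim
    case (elim t)
    have c: "H t * (y / H t) = y" for y using admissibleD(7)[OF elim] by simp
    show ?case unfolding s_def n_def c unfolding H_def by (rule state_eq[symmetric])
  qed
qed

lemma Taub_line_limit:
  assumes "g \<in> {1, 2, 3}" "0 < h" "h < 1" "r = sqrt 6 * sqrt (1 - h\<^sup>2) / h"
  shows "mk_state h (\<lambda>i. h * (if i = g then 2 else - 1)) (\<lambda>i. h * (if i = g then 0 else r)) \<in> Taub_line g"
proof -
  have r: "h * r = sqrt 6 * sqrt (1 - h\<^sup>2)" using assms by simp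
  have "h\<^sup>2 \<le> 1" using assms(2,3) by (intro power_le_one) auto
  then have "(h * r)\<^sup>2 = 6 * (1 - h\<^sup>2)" unfolding r by (simp add: power_mult_distrib)
  then have "Omega (mk_state h (\<lambda>i. h * (if i = g then 2 else - 1)) (\<lambda>i. h * (if i = g then 0 else r))) = 0"
    using assms(1) by (auto simp: Omega_def Sigma2_def mk_state_def power_mult_distrib)
  with assms(1-3) show ?thesis unfolding Taub_line_def
    by (auto simp: mk_state_def r)
qed

lemma pair_products_tendsto:
  assumes "generic w x"
  shows "((\<lambda>t. n 1 t * n 2 t) \<longlongrightarrow> 0) at_top" "((\<lambda>t. n 2 t * n 3 t) \<longlongrightarrow> 0) at_top" "((\<lambda>t. n 3 t * n 1 t) \<longlongrightarrow> 0) at_top"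
proof -
  \<comment> \<open>The numbering refers to the index outside the pair, which is also the index of
    the Taub line.\<close>
  interpret b3: bianchi \<mu> H q Om "s 1" "s 2" "s 3" "n 1" "n 2" "n 3" by (rule bianchi)
  interpret b1: bianchi \<mu> H q Om "s 2" "s 3" "s 1" "n 2" "n 3" "n 1" by (rule b3.rotate)
  interpret b2: bianchi \<mu> H q Om "s 3" "s 1" "s 2" "n 3" "n 1" "n 2" by (rule b1.rotate)
  have no: False
    if "g \<in> {1, 2, 3}" "0 < h" "h < 1" "r = sqrt 6 * sqrt (1 - h\<^sup>2) / h" "(H \<longlongrightarrow> h) at_top"
      and lim: "\<And>i. i \<in> {1, 2, 3} \<Longrightarrow> (s i \<longlongrightarrow> (if i = g then 2 else - 1)) at_top"
        "\<And>i. i \<in> {1, 2, 3} \<Longrightarrow> (n i \<longlongrightarrow> (if i = g then 0 else r)) at_top" for g h r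
    using assms Taub_line_limit[OF that(1-4)] that(1)
      x_tendsto[OF that(5) lim(1) lim(1) lim(1) lim(2) lim(2) lim(2)] unfolding generic_def by blast
  show "((\<lambda>t. n 1 t * n 2 t) \<longlongrightarrow> 0) at_top"
    using b3.pair_dichotomy
  proof
    assume "\<exists>\<delta>>0. \<forall>\<^sub>F t in at_top. \<delta> \<le> b3.P t"
    then obtain \<delta> where "0 < \<delta>" "\<forall>\<^sub>F t in at_top. \<delta> \<le> b3.P t" by blast
    then show ?thesis by (rule b3.taub_limits) (rule FalseE, rule no[of 3]; auto)
  qed (unfold b3.P_def[abs_def])
  show "((\<lambda>t. n 2 t * n 3 t) \<longlongrightarrow> 0) at_top"
    using b1.pair_dichotomy
  proof
    assume "\<exists>\<delta>>0. \<forall>\<^sub>F t in at_top. \<delta> \<le> b1.P t"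
    then obtain \<delta> where "0 < \<delta>" "\<forall>\<^sub>F t in at_top. \<delta> \<le> b1.P t" by blast
    then show ?thesis by (rule b1.taub_limits) (rule FalseE, rule no[of 1]; auto)
  qed (unfold b1.P_def[abs_def])
  show "((\<lambda>t. n 3 t * n 1 t) \<longlongrightarrow> 0) at_top"
    using b2.pair_dichotomy
  proof
    assume "\<exists>\<delta>>0. \<forall>\<^sub>F t in at_top. \<delta> \<le> b2.P t"
    then obtain \<delta> where "0 < \<delta>" "\<forall>\<^sub>F t in at_top. \<delta> \<le> b2.P t" by blast
    then show ?thesis by (rule b2.taub_limits) (rule FalseE, rule no[of 2]; auto)
  qed (unfold b2.P_def[abs_def])
qed

lemma Om_tendsto:
  assumes "generic w x"
  shows "(Om \<longlongrightarrow> 0) at_top"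
proof -
  \<comment> \<open>Here the numbering refers to the leading index, that of the Collins--Stewart
    point.\<close>
  interpret b1: bianchi_small \<mu> H q Om "s 1" "s 2" "s 3" "n 1" "n 2" "n 3"
    unfolding bianchi_small_def bianchi_small_axioms_def
    using bianchi pair_products_tendsto[OF assms] by blast
  interpret b2: bianchi_small \<mu> H q Om "s 2" "s 3" "s 1" "n 2" "n 3" "n 1" by (rule b1.rotate_small)
  interpret b3: bianchi_small \<mu> H q Om "s 3" "s 1" "s 2" "n 3" "n 1" "n 2" by (rule b2.rotate_small)
  have "sqrt (3 * \<mu> * (1 - \<mu>)) = sqrt ((3 / 4)\<^sup>2 * ((1 - w) * (1 + 3 * w)))"
    by (simp add: \<mu>_def power2_eq_square field_simps)
  then have cs: "sqrt (3 * \<mu> * (1 - \<mu>)) = 3 / 4 * sqrt (1 - w) * sqrt (1 + 3 * w)"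
    by (simp add: real_sqrt_mult)
  have no: False
    if "g \<in> {1, 2, 3}" and lim: "\<And>i. i \<in> {1, 2, 3} \<Longrightarrow> (s i \<longlongrightarrow> (if i = g then - \<mu> else \<mu> / 2)) at_top"
        "\<And>i. i \<in> {1, 2, 3} \<Longrightarrow> (n i \<longlongrightarrow> (if i = g then sqrt (3 * \<mu> * (1 - \<mu>)) else 0)) at_top" for g
  proof -
    have "omega_limit x = {mk_state 1 (\<lambda>i. 1 * (if i = g then - \<mu> else \<mu> / 2)) (\<lambda>i. 1 * (if i = g then sqrt (3 * \<mu> * (1 - \<mu>)) else 0))}"
      by (rule x_tendsto[OF b1.H_tendsto lim(1) lim(1) lim(1) lim(2) lim(2) lim(2)]) auto
    also have "mk_state 1 (\<lambda>i. 1 * (if i = g then - \<mu> else \<mu> / 2)) (\<lambda>i. 1 * (if i = g then sqrt (3 * \<mu> * (1 - \<mu>)) else 0)) = CS_point w g"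
      unfolding CS_point_def cs by (simp add: mk_state_def \<mu>_def add_divide_distrib)
    finally show False using assms that(1) unfolding generic_def by blast
  qed
  show ?thesis
    using b1.Om_dichotomy
  proof
    assume "\<exists>\<omega>>0. \<forall>\<^sub>F t in at_top. \<omega> \<le> Om t"
    then obtain \<omega> where \<omega>: "0 < \<omega>" "\<forall>\<^sub>F t in at_top. \<omega> \<le> Om t" by blast
    then show ?thesis
    proof (cases rule: b1.matter_cases)
      case friedmann
      have "omega_limit x = {mk_state 1 (\<lambda>i. 1 * (\<lambda>_. 0) i) (\<lambda>i. 1 * (\<lambda>_. 0) i)}"
        by (rule x_tendsto[OF b1.H_tendsto friedmann])
      then have "omega_limit x = {F_point}" by (simp add: F_point_def)
      with assms show ?thesis unfolding generic_def by blast
    next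
      case (large \<eta>)
      from large(2) show ?thesis
      proof (elim disjE)
        assume "\<forall>\<^sub>F t in at_top. \<eta> \<le> n 1 t"
        note b1.collins_stewart_limits[OF large(1) this \<omega>]
        then show ?thesis by - (rule FalseE, rule no[of 1]; auto)
      next
        assume "\<forall>\<^sub>F t in at_top. \<eta> \<le> n 2 t"
        note b2.collins_stewart_limits[OF large(1) this \<omega>]
        then show ?thesis by - (rule FalseE, rule no[of 2]; auto)
      next
        assume "\<forall>\<^sub>F t in at_top. \<eta> \<le> n 3 t"
        note b3.collins_stewart_limits[OF large(1) this \<omega>]
        then show ?thesis by - (rule FalseE, rule no[of 3]; auto)
      qed
    qed
  qed
qed

text \<open>Undoing the normalisation only shrinks the products, as
  \<open>H \<le> 1\<close>.\<close>

lemma Nn_product_tendsto: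
  assumes "((\<lambda>t. n i t * n j t) \<longlongrightarrow> 0) at_top" "\<And>t. 0 < t \<Longrightarrow> 0 < Nn (x t) i" "\<And>t. 0 < t \<Longrightarrow> 0 < Nn (x t) j"
  shows "((\<lambda>t. Nn (x t) i * Nn (x t) j) \<longlongrightarrow> 0) at_top"
proof (rule tendsto_sandwich[OF _ _ tendsto_const assms(1)])
  show "\<forall>\<^sub>F t in at_top. 0 \<le> Nn (x t) i * Nn (x t) j"
    using eventually_gt_at_top[of 0] by eventually_elim (use assms in \<open>simp add: less_imp_le\<close>)
  show "\<forall>\<^sub>F t in at_top. Nn (x t) i * Nn (x t) j \<le> n i t * n j t"
    using eventually_gt_at_top[of 0]
  proof eventually_elim
    case (elim t)
    have "(H t)\<^sup>2 \<le> 1" using H_le_1[OF elim] admissibleD(7)[OF elim] by (intro power_le_one) auto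
    then have "(n i t * n j t) * (H t)\<^sup>2 \<le> (n i t * n j t) * 1"
      using assms(2,3)[OF elim] admissibleD(7)[OF elim] by (intro mult_left_mono) (auto simp: n_def less_imp_le)
    then show ?case using admissibleD(7)[OF elim] by (simp add: n_def power2_eq_square)
  qed
qed

lemma omega_limit_subset:
  assumes "generic w x"
  shows "omega_limit x \<subseteq> mixmaster_attractor"
proof
  fix p assume p: "p \<in> omega_limit x"
  have "((\<lambda>t. Omega (x t)) \<longlongrightarrow> 0) at_top"
  proof (rule tendsto_sandwich[OF _ _ tendsto_const Om_tendsto[OF assms]])
    show "\<forall>\<^sub>F t in at_top. 0 \<le> Omega (x t)"
      using eventually_gt_at_top[of 0] by eventually_elim (rule admissibleD)
    show "\<forall>\<^sub>F t in at_top. Omega (x t) \<le> Om t"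
      using eventually_gt_at_top[of 0]
    proof eventually_elim
      case (elim t)
      have "(H t)\<^sup>2 \<le> 1" using H_le_1[OF elim] admissibleD(7)[OF elim] by (intro power_le_one) auto
      then have "Omega (x t) * (H t)\<^sup>2 \<le> Omega (x t) * 1"
        using admissibleD(3)[OF elim] by (intro mult_left_mono) auto
      then show ?case using admissibleD(7)[OF elim] by (simp add: Om_def pos_le_divide_eq)
    qed
  qed
  then have O: "Omega p = 0" by (rule omega_limit_value[OF p isCont_field(2)])
  have cont: "isCont (\<lambda>y. Nn y i * Nn y j) y" for i j y by (intro continuous_intros isCont_components)
  note prods = pair_products_tendsto[OF assms]
  have "Nn p 1 * Nn p 2 = 0" "Nn p 2 * Nn p 3 = 0" "Nn p 3 * Nn p 1 = 0"
    by (rule omega_limit_value[OF p cont], rule Nn_product_tendsto, rule prods, (rule admissibleD; assumption)+)+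
  then have "\<exists>j. {i \<in> {1, 2, 3 :: nat}. Nn p i \<noteq> 0} \<subseteq> {j}" by auto
  then obtain j where "{i \<in> {1, 2, 3 :: nat}. Nn p i \<noteq> 0} \<subseteq> {j}" by blast
  then have "card {i \<in> {1, 2, 3 :: nat}. Nn p i \<noteq> 0} \<le> card {j}" by (intro card_mono) auto
  then show "p \<in> mixmaster_attractor"
    unfolding mixmaster_attractor_def using omega_limit_admissible[OF p] O by simp
qed

end

theorem theorem1:
  fixes w :: real and x :: "real \<Rightarrow> state"
  assumes "- 1 / 3 < w" and "w < 1"
    and "is_orbit w x"
    and "generic w x"
  shows "omega_limit x \<subseteq> mixmaster_attractor"
proof -
  interpret orbit w x using assms by unfold_locales
  show ?thesis using assms(4) by (rule omega_limit_subset)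
qed

end
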